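(* Let $\Gamma_0\subset\Gamma$ be a subgraph and assume that the multiplicity function $c$ is constant on the set of simple roots $\Gamma_0^v$ corresponding to the vertices of $\Gamma_0$. Then the parabolic ideal $I_{\Gamma_0}$ is $H_c$-invariant if and only if all the connected components of $\Gamma_0$ have the same Coxeter number $h$ and $h=1/c$ (where $c$ here denotes the constant value on $\Gamma_0^v$).
   Context: Let $W$ be a finite real reflection group acting by orthogonal transformations in its complexified reflection representation $V=\mathbb C^N$, with $(\cdot,\cdot)$ the standard (complex bilinear) scalar product. Let $\mathcal R$ be the corresponding Coxeter root system (real vectors, $W$-invariant set, exactly one pair $\pm\alpha$ per reflection $s_\alpha\in W$), with a chosen positive subsystem $\mathcal R_+$, and let $\Gamma$ be the Coxeter graph, whose vertices are identified with the simple roots. For a subgraph $\Gamma_0\subset\Gamma$, $\Gamma_0^v$ denotes the set of simple roots corresponding to the vertices of $\Gamma_0$; subgraphs are obtained by choosing some vertices and keeping all edges between them. The Coxeter number of a connected subgraph is the Coxeter number of the irreducible finite reflection group with that Coxeter graph. Let $c:\mathcal R\to\mathbb C$, $\alpha\mapsto c_\alpha$, be a $W$-invariant function. For $\xi\in\mathbb C^N$ the Dunkl operator on $\mathbb C[x]=\mathbb C[x_1,\dots,x_N]$ is $$\nabla_\xi=\partial_\xi-\sum_{\alpha\in\mathcal R_+}\frac{c_\alpha(\alpha,\xi)}{(\alpha,x)}(1-s_\alpha),$$ where $s_\alpha$ is the orthogonal reflection in the hyperplane $(\alpha,x)=0$. The rational Cherednik algebra $H_c$ (with $t=1$) is considered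 in its faithful polynomial representation: it is the algebra of operators on $\mathbb C[x]$ generated by multiplications by polynomials, the action of $W$, and all Dunkl operators $\nabla_\xi$. A subspace of $\mathbb C[x]$ is $H_c$-invariant if it is preserved by all these operators. Given $\Gamma_0\subset\Gamma$, put $\pi=\{x\in V\mid (\beta,x)=0\ \forall \beta\in\Gamma_0^v\}$. The parabolic stratum is $D_{\Gamma_0}=\bigcup_{w\in W}w(\pi)$ and the parabolic ideal is $I_{\Gamma_0}=\{p\in\mathbb C[x]\mid p|_{D_{\Gamma_0}}=0\}$. *)

theory Defs
  imports "HOL-Analysis.Analysis"
begin

subsection \<open>Finite real reflection groups\<close>

definition reflection :: "real^'n \<Rightarrow> real^'n \<Rightarrow> real^'n" where
  "reflection \<alpha> x = x - (2 * (\<alpha> \<bullet> x) / (\<alpha> \<bullet> \<alpha>)) *\<^sub>R \<alpha>"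

inductive_set generated_group :: "('a \<Rightarrow> 'a) set \<Rightarrow> ('a \<Rightarrow> 'a) set"
  for S :: "('a \<Rightarrow> 'a) set" where
  one: "id \<in> generated_group S"
| incl: "s \<in> S \<Longrightarrow> s \<in> generated_group S"
| mult: "f \<in> generated_group S \<Longrightarrow> g \<in> generated_group S \<Longrightarrow> f \<circ> g \<in> generated_group S"
| inv: "f \<in> generated_group S \<Longrightarrow> inv f \<in> generated_group S"

text \<open>The group is not required to be essential: its roots need not span the space.\<close>

definition finite_reflection_group :: "(real^'n \<Rightarrow> real^'n) set \<Rightarrow> bool" where
  "finite_reflection_group W \<longleftrightarrow>
     finite W \<and> (\<exists>S. S \<subseteq> {reflection v |v. v \<noteq> 0} \<and> W = generated_group S)"

definition coxeter_root_system :: "(real^'n \<Rightarrow> real^'n) set \<Rightarrow> (real^'n) set \<Rightarrow> bool" where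
  "coxeter_root_system W R \<longleftrightarrow>
     (\<forall>\<alpha>\<in>R. \<alpha> \<noteq> 0 \<and> reflection \<alpha> \<in> W) \<and>
     (\<forall>w\<in>W. \<forall>\<alpha>\<in>R. w \<alpha> \<in> R) \<and>
     (\<forall>v. v \<noteq> 0 \<and> reflection v \<in> W \<longrightarrow>
        (\<exists>\<alpha>. {\<beta> \<in> R. reflection \<beta> = reflection v} = {\<alpha>, - \<alpha>}))"

definition positive_subsystem :: "(real^'n) set \<Rightarrow> (real^'n) set \<Rightarrow> bool" where
  "positive_subsystem R P \<longleftrightarrow>
     (\<exists>t. (\<forall>\<alpha>\<in>R. t \<bullet> \<alpha> \<noteq> 0) \<and> P = {\<alpha> \<in> R. t \<bullet> \<alpha> > 0})"

definition simple_roots :: "(real^'n) set \<Rightarrow> (real^'n) set \<Rightarrow> bool" where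
  "simple_roots P \<Delta> \<longleftrightarrow>
     \<Delta> \<subseteq> P \<and> independent \<Delta> \<and>
     (\<forall>\<alpha>\<in>P. \<exists>a. (\<forall>\<beta>\<in>\<Delta>. a \<beta> \<ge> 0) \<and> \<alpha> = (\<Sum>\<beta>\<in>\<Delta>. a \<beta> *\<^sub>R \<beta>))"


subsection \<open>Coxeter graph and Coxeter numbers\<close>

definition map_order :: "('a \<Rightarrow> 'a) \<Rightarrow> nat" where
  "map_order f = (LEAST n. n > 0 \<and> f ^^ n = id)"

text \<open>A full subgraph of the Coxeter graph is represented by its set of vertices, a set
  \<open>S\<close> of simple roots; two vertices are joined iff the product of their reflections has
  order at least 3 (on the diagonal this order is 1, so there are no loops).\<close>

definition coxeter_edges :: "(real^'n) set \<Rightarrow> ((real^'n) \<times> (real^'n)) set" where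
  "coxeter_edges S =
     {(\<alpha>, \<beta>). \<alpha> \<in> S \<and> \<beta> \<in> S \<and> map_order (reflection \<alpha> \<circ> reflection \<beta>) \<ge> 3}"

definition coxeter_components :: "(real^'n) set \<Rightarrow> (real^'n) set set" where
  "coxeter_components S = S // (coxeter_edges S)\<^sup>*"

text \<open>The Coxeter number is the order of a Coxeter element, i.e. of the product of the simple
  reflections in some order; for a connected set of simple roots of a finite reflection group,
  any two orders give conjugate products, so the choice made by \<open>SOME\<close> is immaterial.\<close>

definition coxeter_element :: "(real^'n) set \<Rightarrow> real^'n \<Rightarrow> real^'n" where
  "coxeter_element C =
     foldr (\<circ>) (map reflection (SOME as. distinct as \<and> set as = C)) id"

definition coxeter_number :: "(real^'n) set \<Rightarrow> nat" where
  "coxeter_number C = map_order (coxeter_element C)"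


subsection \<open>Complexification and polynomials\<close>

definition cvec :: "real^'n \<Rightarrow> complex^'n" where
  "cvec v = (\<chi> i. complex_of_real (v $ i))"

definition cdot :: "complex^'n \<Rightarrow> complex^'n \<Rightarrow> complex" where
  "cdot x y = (\<Sum>i\<in>UNIV. x $ i * y $ i)"

definition complexify :: "(real^'n \<Rightarrow> real^'n) \<Rightarrow> complex^'n \<Rightarrow> complex^'n" where
  "complexify w x = map_matrix complex_of_real (matrix w) *v x"

text \<open>Since the ground field is infinite, polynomials are identified with polynomial functions.\<close>

inductive_set polys :: "(complex^'n \<Rightarrow> complex) set" where
  const: "(\<lambda>x. a) \<in> polys"
| coord: "(\<lambda>x. x $ i) \<in> polys"
| add: "p \<in> polys \<Longrightarrow> q \<in> polys \<Longrightarrow> (\<lambda>x. p x + q x) \<in> polys"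
| mult: "p \<in> polys \<Longrightarrow> q \<in> polys \<Longrightarrow> (\<lambda>x. p x * q x) \<in> polys"

definition group_act ::
    "(real^'n \<Rightarrow> real^'n) \<Rightarrow> (complex^'n \<Rightarrow> complex) \<Rightarrow> complex^'n \<Rightarrow> complex" where
  "group_act w p = (\<lambda>x. p (complexify (inv w) x))"


subsection \<open>Dunkl operators and the rational Cherednik algebra\<close>

definition dir_deriv ::
    "complex^'n \<Rightarrow> (complex^'n \<Rightarrow> complex) \<Rightarrow> complex^'n \<Rightarrow> complex" where
  "dir_deriv \<xi> p = (\<lambda>x. deriv (\<lambda>t. p (x + t *s \<xi>)) 0)"

text \<open>\<open>divided_difference \<alpha> p\<close> is the polynomial $(p - s_\alpha p) / (\alpha, x)$; existence and
  uniqueness are shown in \<open>divided_difference_ex1\<close> below.\<close>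

definition divided_difference ::
    "real^'n \<Rightarrow> (complex^'n \<Rightarrow> complex) \<Rightarrow> complex^'n \<Rightarrow> complex" where
  "divided_difference \<alpha> p =
     (THE q. q \<in> polys \<and>
        (\<forall>x. cdot (cvec \<alpha>) x * q x = p x - group_act (reflection \<alpha>) p x))"

definition dunkl ::
    "(real^'n) set \<Rightarrow> (real^'n \<Rightarrow> complex) \<Rightarrow> complex^'n \<Rightarrow>
     (complex^'n \<Rightarrow> complex) \<Rightarrow> complex^'n \<Rightarrow> complex" where
  "dunkl P c \<xi> p =
     (\<lambda>x. dir_deriv \<xi> p x
            - (\<Sum>\<alpha>\<in>P. c \<alpha> * cdot (cvec \<alpha>) \<xi> * divided_difference \<alpha> p x))"

text \<open>Operators are represented as maps on all functions, but only their values on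
  \<open>polys\<close> are meaningful.\<close>

inductive_set cherednik_algebra ::
    "(real^'n \<Rightarrow> real^'n) set \<Rightarrow> (real^'n) set \<Rightarrow> (real^'n \<Rightarrow> complex) \<Rightarrow>
     ((complex^'n \<Rightarrow> complex) \<Rightarrow> complex^'n \<Rightarrow> complex) set"
  for W :: "(real^'n \<Rightarrow> real^'n) set" and P :: "(real^'n) set" and c :: "real^'n \<Rightarrow> complex" where
  poly: "f \<in> polys \<Longrightarrow> (\<lambda>p x. f x * p x) \<in> cherednik_algebra W P c"
| group: "w \<in> W \<Longrightarrow> group_act w \<in> cherednik_algebra W P c"
| dunkl: "dunkl P c \<xi> \<in> cherednik_algebra W P c"
| add: "A \<in> cherednik_algebra W P c \<Longrightarrow> B \<in> cherednik_algebra W P c \<Longrightarrow>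
    (\<lambda>p x. A p x + B p x) \<in> cherednik_algebra W P c"
| scale: "A \<in> cherednik_algebra W P c \<Longrightarrow> (\<lambda>p x. a * A p x) \<in> cherednik_algebra W P c"
| comp: "A \<in> cherednik_algebra W P c \<Longrightarrow> B \<in> cherednik_algebra W P c \<Longrightarrow>
    A \<circ> B \<in> cherednik_algebra W P c"

definition poly_subspace :: "(complex^'n \<Rightarrow> complex) set \<Rightarrow> bool" where
  "poly_subspace U \<longleftrightarrow>
     U \<subseteq> polys \<and> (\<lambda>x. 0) \<in> U \<and>
     (\<forall>p\<in>U. \<forall>q\<in>U. (\<lambda>x. p x + q x) \<in> U) \<and> (\<forall>a. \<forall>p\<in>U. (\<lambda>x. a * p x) \<in> U)"

definition cherednik_invariant ::
    "(real^'n \<Rightarrow> real^'n) set \<Rightarrow> (real^'n) set \<Rightarrow> (real^'n \<Rightarrow> complex) \<Rightarrow>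
     (complex^'n \<Rightarrow> complex) set \<Rightarrow> bool" where
  "cherednik_invariant W P c U \<longleftrightarrow>
     poly_subspace U \<and> (\<forall>A\<in>cherednik_algebra W P c. \<forall>p\<in>U. A p \<in> U)"


subsection \<open>Parabolic strata and parabolic ideals\<close>

definition parabolic_stratum ::
    "(real^'n \<Rightarrow> real^'n) set \<Rightarrow> (real^'n) set \<Rightarrow> (complex^'n) set" where
  "parabolic_stratum W S =
     (\<Union>w\<in>W. complexify w ` {x. \<forall>\<beta>\<in>S. cdot (cvec \<beta>) x = 0})"

definition parabolic_ideal ::
    "(real^'n \<Rightarrow> real^'n) set \<Rightarrow> (real^'n) set \<Rightarrow> (complex^'n \<Rightarrow> complex) set" where
  "parabolic_ideal W S = {p \<in> polys. \<forall>x\<in>parabolic_stratum W S. p x = 0}"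


subsection \<open>Well-definedness of divided differences\<close>

lemma reflection_involution: "reflection \<alpha> (reflection \<alpha> x) = x"
  by (cases "\<alpha> = 0") (simp_all add: reflection_def inner_diff_right algebra_simps)

lemma inv_reflection: "inv (reflection \<alpha>) = reflection \<alpha>"
  by (rule inv_unique_comp) (auto simp: fun_eq_iff reflection_involution)

lemma complexify_reflection:
  "complexify (reflection \<alpha>) x $ i =
     x $ i - 2 * cdot (cvec \<alpha>) x / complex_of_real (\<alpha> \<bullet> \<alpha>) * complex_of_real (\<alpha> $ i)"
proof -
  have entry: "complex_of_real (matrix (reflection \<alpha>) $ i $ j) =
      (if j = i then 1 else 0)
        - 2 * complex_of_real (\<alpha> $ j) / complex_of_real (\<alpha> \<bullet> \<alpha>) * complex_of_real (\<alpha> $ i)" for j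
  proof -
    have "matrix (reflection \<alpha>) $ i $ j =
        axis j 1 $ i - 2 * (\<alpha> \<bullet> axis j 1) / (\<alpha> \<bullet> \<alpha>) * \<alpha> $ i"
      by (simp add: matrix_def reflection_def)
    also have "\<alpha> \<bullet> axis j 1 = \<alpha> $ j"
      by (simp add: inner_axis)
    finally show ?thesis
      by (simp add: axis_def)
  qed
  have "complexify (reflection \<alpha>) x $ i =
      (\<Sum>j\<in>UNIV. (if j = i then x $ j else 0)
        - 2 * (complex_of_real (\<alpha> $ j) * x $ j) / complex_of_real (\<alpha> \<bullet> \<alpha>) * complex_of_real (\<alpha> $ i))"
    unfolding complexify_def matrix_vector_mult_def nth_map_matrix entry vec_lambda_beta
    by (rule sum.cong[OF refl]) (simp add: left_diff_distrib)
  also have "\<dots> = x $ i - 2 * cdot (cvec \<alpha>) x / complex_of_real (\<alpha> \<bullet> \<alpha>) * complex_of_real (\<alpha> $ i)"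
    by (simp add: sum_subtractf cdot_def cvec_def sum_distrib_left sum_distrib_right
        sum_divide_distrib)
  finally show ?thesis .
qed

lemma polys_sum: "(\<And>i. i \<in> I \<Longrightarrow> f i \<in> polys) \<Longrightarrow> (\<lambda>x. \<Sum>i\<in>I. f i x) \<in> polys"
  by (induction I rule: infinite_finite_induct) (auto intro: polys.intros)

lemma polys_group_act: "p \<in> polys \<Longrightarrow> group_act w p \<in> polys"
proof (induction p rule: polys.induct)
  case (coord i)
  show ?case
    unfolding group_act_def complexify_def matrix_vector_mult_def
    by (auto intro!: polys_sum polys.intros)
qed (auto simp: group_act_def intro: polys.intros)

lemma polys_continuous: "p \<in> polys \<Longrightarrow> continuous_on UNIV p"
  by (induction p rule: polys.induct) (auto intro!: continuous_intros)

lemma cdot_cvec_self: "cdot (cvec \<alpha>) (cvec \<alpha>) = complex_of_real (\<alpha> \<bullet> \<alpha>)"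
  by (simp add: cdot_def cvec_def inner_vec_def)

lemma divided_difference_ex:
  assumes "p \<in> polys"
  shows "\<exists>q\<in>polys. \<forall>x. cdot (cvec \<alpha>) x * q x = p x - group_act (reflection \<alpha>) p x"
  using assms
proof (induction p rule: polys.induct)
  case (const a)
  show ?case
    by (rule bexI[of _ "\<lambda>x. 0"]) (auto simp: group_act_def intro: polys.intros)
next
  case (coord i)
  show ?case
    by (rule bexI[of _ "\<lambda>x. 2 / complex_of_real (\<alpha> \<bullet> \<alpha>) * complex_of_real (\<alpha> $ i)"])
      (auto simp: group_act_def inv_reflection complexify_reflection intro: polys.intros)
next
  case (add p q)
  then obtain p' q' where
    p': "p' \<in> polys" "\<forall>x. cdot (cvec \<alpha>) x * p' x = p x - group_act (reflection \<alpha>) p x" and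
    q': "q' \<in> polys" "\<forall>x. cdot (cvec \<alpha>) x * q' x = q x - group_act (reflection \<alpha>) q x"
    by blast
  show ?case
    by (rule bexI[of _ "\<lambda>x. p' x + q' x"])
      (use p' q' in \<open>auto simp: group_act_def distrib_left intro: polys.intros\<close>)
next
  case (mult p q)
  then obtain p' q' where
    p': "p' \<in> polys" "\<forall>x. cdot (cvec \<alpha>) x * p' x = p x - group_act (reflection \<alpha>) p x" and
    q': "q' \<in> polys" "\<forall>x. cdot (cvec \<alpha>) x * q' x = q x - group_act (reflection \<alpha>) q x"
    by blast
  let ?r = "\<lambda>x. p' x * q x + group_act (reflection \<alpha>) p x * q' x"
  have "cdot (cvec \<alpha>) x * ?r x = p x * q x - group_act (reflection \<alpha>) (\<lambda>x. p x * q x) x" for x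
  proof -
    have "cdot (cvec \<alpha>) x * ?r x =
        (cdot (cvec \<alpha>) x * p' x) * q x + group_act (reflection \<alpha>) p x * (cdot (cvec \<alpha>) x * q' x)"
      by (simp add: algebra_simps)
    also have "\<dots> = (p x - group_act (reflection \<alpha>) p x) * q x
        + group_act (reflection \<alpha>) p x * (q x - group_act (reflection \<alpha>) q x)"
      using p'(2) q'(2) by simp
    also have "\<dots> = p x * q x - group_act (reflection \<alpha>) (\<lambda>x. p x * q x) x"
      by (simp add: group_act_def algebra_simps)
    finally show ?thesis .
  qed
  moreover have "?r \<in> polys"
    using mult p'(1) q'(1) by (intro polys.add polys.mult polys_group_act)
  ultimately show ?case by (intro bexI[of _ ?r]) auto
qed

lemma polys_eq_if_eq_off_mirror:
  assumes "q \<in> polys" "r \<in> polys" "\<alpha> \<noteq> 0"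
    and eq: "\<And>x. cdot (cvec \<alpha>) x \<noteq> 0 \<Longrightarrow> q x = r x"
  shows "q = r"
proof
  fix x
  show "q x = r x"
  proof (cases "cdot (cvec \<alpha>) x = 0")
    case True
    let ?l = "\<lambda>t::complex. x + t *s cvec \<alpha>"
    have "cdot (cvec \<alpha>) (?l t) = cdot (cvec \<alpha>) x + t * cdot (cvec \<alpha>) (cvec \<alpha>)" for t
      by (simp add: cdot_def algebra_simps sum.distrib sum_distrib_left)
    then have ne: "cdot (cvec \<alpha>) (?l t) \<noteq> 0" if "t \<noteq> 0" for t
      using True that \<open>\<alpha> \<noteq> 0\<close> by (simp add: cdot_cvec_self)
    have cl: "continuous_on UNIV ?l"
      unfolding vector_scalar_mult_def
      by (intro continuous_intros continuous_on_vec_lambda)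
    have lim: "((\<lambda>t. p (?l t)) \<longlongrightarrow> p x) (at 0)" if "p \<in> polys" for p
    proof -
      have "continuous_on UNIV (p \<circ> ?l)"
        by (rule continuous_on_compose[OF cl])
          (rule continuous_on_subset[OF polys_continuous[OF that] subset_UNIV])
      then have "isCont (p \<circ> ?l) 0"
        by (simp add: continuous_on_eq_continuous_at o_def)
      then show ?thesis by (simp add: isCont_def o_def)
    qed
    have ev: "\<forall>\<^sub>F t in at 0. r (?l t) = q (?l t)"
      unfolding eventually_at_filter by (intro always_eventually allI impI eq[symmetric] ne)
    have "((\<lambda>t. q (?l t)) \<longlongrightarrow> r x) (at 0)"
      by (rule Lim_transform_eventually[OF lim[OF \<open>r \<in> polys\<close>] ev])
    with lim[OF \<open>q \<in> polys\<close>] show ?thesis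
      by (rule tendsto_unique[OF trivial_limit_at])
  qed (rule eq)
qed

lemma divided_difference_ex1:
  assumes "p \<in> polys" "\<alpha> \<noteq> 0"
  shows "\<exists>!q. q \<in> polys \<and> (\<forall>x. cdot (cvec \<alpha>) x * q x = p x - group_act (reflection \<alpha>) p x)"
proof (rule ex_ex1I)
  show "\<exists>q. q \<in> polys \<and> (\<forall>x. cdot (cvec \<alpha>) x * q x = p x - group_act (reflection \<alpha>) p x)"
    using divided_difference_ex[OF assms(1)] by blast
next
  fix q r
  assume q: "q \<in> polys \<and> (\<forall>x. cdot (cvec \<alpha>) x * q x = p x - group_act (reflection \<alpha>) p x)"
    and r: "r \<in> polys \<and> (\<forall>x. cdot (cvec \<alpha>) x * r x = p x - group_act (reflection \<alpha>) p x)"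
  then have "cdot (cvec \<alpha>) x * q x = cdot (cvec \<alpha>) x * r x" for x
    by simp
  with q r show "q = r"
    using polys_eq_if_eq_off_mirror[of q r \<alpha>] assms(2) mult_left_cancel by blast
qed

lemma dunkl_off_mirrors:
  assumes "p \<in> polys" "0 \<notin> P" "\<And>\<alpha>. \<alpha> \<in> P \<Longrightarrow> cdot (cvec \<alpha>) x \<noteq> 0"
  shows "dunkl P c \<xi> p x =
    dir_deriv \<xi> p x
      - (\<Sum>\<alpha>\<in>P. c \<alpha> * cdot (cvec \<alpha>) \<xi> / cdot (cvec \<alpha>) x
                   * (p x - p (complexify (reflection \<alpha>) x)))"
proof -
  have "cdot (cvec \<alpha>) x * divided_difference \<alpha> p x = p x - p (complexify (reflection \<alpha>) x)"
    if "\<alpha> \<in> P" for \<alpha>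
  proof -
    have "\<alpha> \<noteq> 0" using that assms(2) by auto
    from theI'[OF divided_difference_ex1[OF assms(1) this]] show ?thesis
      unfolding divided_difference_def by (simp add: group_act_def inv_reflection)
  qed
  then have "divided_difference \<alpha> p x = (p x - p (complexify (reflection \<alpha>) x)) / cdot (cvec \<alpha>) x"
    if "\<alpha> \<in> P" for \<alpha>
    using that assms(3) by (metis nonzero_mult_div_cancel_left)
  then show ?thesis
    unfolding dunkl_def by (simp cong: sum.cong)
qed

end

theory Submission
  imports Defs
begin

text \<open>At a generic point \<open>x\<close> of the fixed space of the parabolic subgroup, the value of
  \<open>dunkl P c \<xi> p\<close> for a \<open>p\<close> in the parabolic ideal is the derivative of \<open>p\<close> at \<open>x\<close> along
  \<open>\<xi> - k F \<xi>\<close>, where \<open>F \<xi>\<close> is the sum of \<open>((\<alpha>, \<xi>) / (\<alpha>, \<alpha>)) \<alpha>\<close> over the roots of the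
  parabolic subsystem. Since elements of the ideal can have any differential that vanishes on
  the fixed space, the ideal is invariant iff \<open>k F\<close> is the identity on the span of the
  parabolic roots. As \<open>F\<close> commutes with the reflections, it is a scalar on the span of each
  connected component of the graph, and taking traces identifies this scalar with the number
  of roots divided by the rank. It remains to see that this quotient is the Coxeter number.

  Because the graph is a forest, all Coxeter elements are conjugate, so one may choose a
  bipartite one. A positive eigenvector of the Gram matrix of the unit simple roots yields a
  plane that meets the open chamber in a sector and on which the Coxeter element is a rotation
  by twice the angle of that sector. As no mirror crosses the sector, the angle is \<open>pi / h\<close>.
  Hence the orbit of every root changes sign from positive to negative exactly once in \<open>h\<close>
  steps, while there are as many positive roots made negative by the Coxeter element as simple
  roots.\<close>

subsection \<open>Simple systems and words in the simple reflections\<close>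

text \<open>No classification of finite reflection groups enters. Its substitute is the rank-two
  case of the plane argument: two joined simple roots enclose the angle pi - pi / K with K at least
  3, so their unit vectors have inner product at most -1/2. A subgraph in which every vertex has two
  neighbours would then force the sum of its unit roots to vanish; this is where the forest comes
  from. Two obstacles shape the passage to ideals. An element of the ideal has to vanish on every
  \<open>W\<close>-translate of the fixed space, so a linear form must be multiplied by a factor
  that kills the other translates but not the generic point. And the formula for the value of a
  Dunkl operator is available only where no further mirror passes, so the remaining points of the
  stratum are reached by continuity along lines.\<close>

lemma reflection_eq_scale: "a \<noteq> 0 \<Longrightarrow> reflection (a *\<^sub>R \<alpha>) = reflection \<alpha>"
  by (auto simp: reflection_def fun_eq_iff)

lemma reflection_self [simp]: "reflection \<alpha> \<alpha> = - \<alpha>"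
  by (simp add: reflection_def scaleR_2)

lemma reflection_orthogonal: "\<alpha> \<bullet> x = 0 \<Longrightarrow> reflection \<alpha> x = x"
  by (simp add: reflection_def)

lemma linear_reflection: "linear (reflection \<alpha>)"
  by (rule linearI)
    (simp_all add: reflection_def algebra_simps add_divide_distrib inner_add_right)

lemma reflection_inner [simp]: "reflection \<alpha> x \<bullet> reflection \<alpha> y = x \<bullet> y"
  by (cases "\<alpha> = 0")
    (simp_all add: reflection_def algebra_simps inner_diff_left inner_diff_right inner_commute)

lemma orthogonal_transformation_reflection: "orthogonal_transformation (reflection \<alpha>)"
  by (simp add: orthogonal_transformation_def linear_reflection)

lemma reflection_conj:
  assumes "orthogonal_transformation f"
  shows "reflection (f \<alpha>) (f x) = f (reflection \<alpha> x)"
  using assms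
  by (simp add: orthogonal_transformation_def reflection_def linear_diff linear_scale)

definition word :: "(real^'n) list \<Rightarrow> real^'n \<Rightarrow> real^'n" where
  "word L = foldr (\<circ>) (map reflection L) id"

lemma word_Nil [simp]: "word [] = id"
  and word_Cons [simp]: "word (\<alpha> # L) = reflection \<alpha> \<circ> word L"
  by (simp_all add: word_def)

lemma word_append [simp]: "word (L @ M) = word L \<circ> word M"
  by (induction L) (simp_all add: o_assoc)

lemma orthogonal_transformation_word: "orthogonal_transformation (word L)"
proof (induction L)
  case (Cons \<alpha> L)
  then show ?case
    unfolding word_Cons
    by (intro orthogonal_transformation_compose orthogonal_transformation_reflection)
qed (simp add: id_def)

lemma linear_word: "linear (word L)"
  using orthogonal_transformation_linear orthogonal_transformation_word by blast

lemma word_inner [simp]: "word L x \<bullet> word L y = x \<bullet> y"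
  using orthogonal_transformation_word by (auto simp: orthogonal_transformation_def)

lemma word_rev_word [simp]: "word (rev L) (word L x) = x"
  by (induction L arbitrary: x) (simp_all add: reflection_involution)

lemma word_word_rev [simp]: "word L (word (rev L) x) = x"
  using word_rev_word[of "rev L"] by simp

lemma word_diff_in_span: "word L x - x \<in> span (set L)"
proof (induction L)
  case (Cons \<alpha> L)
  have eq: "word (\<alpha> # L) x - x = (word L x - x) - (2 * (\<alpha> \<bullet> word L x) / (\<alpha> \<bullet> \<alpha>)) *\<^sub>R \<alpha>"
    by (simp add: reflection_def)
  have "word L x - x \<in> span (set (\<alpha> # L))"
    using Cons span_mono[of "set L" "set (\<alpha> # L)"] by auto
  then show ?case
    unfolding eq by (intro span_diff[OF _ span_scale[OF span_base]]) auto
qed (simp add: span_zero)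

text \<open>Peeling off the first letter \<alpha> gives
  \<open>word L x = reflection \<alpha> x\<close>, so the displacement lies both on the line of
  \<alpha> and in the span of the other letters. By independence it is zero, and the induction
  continues with the shorter word.\<close>

lemma word_fixed_imp_orthogonal:
  assumes "independent (set L)" "distinct L" "word L x = x"
  shows "\<forall>\<alpha>\<in>set L. \<alpha> \<bullet> x = 0"
  using assms
proof (induction L)
  case (Cons \<alpha> L)
  have ne: "\<alpha> \<noteq> 0" "\<alpha> \<notin> span (set L)" and ind: "independent (set L)"
    using Cons.prems(1,2) dependent_zero[of "set (\<alpha> # L)"] span_zero
    by (auto simp: independent_insert)
  have eq: "word L x = reflection \<alpha> x"
    using Cons.prems(3) by (metis comp_apply reflection_involution word_Cons)
  have *: "(2 * (\<alpha> \<bullet> x) / (\<alpha> \<bullet> \<alpha>)) *\<^sub>R \<alpha> \<in> span (set L)"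
    using word_diff_in_span[of L x] span_neg unfolding eq by (fastforce simp: reflection_def)
  have "\<alpha> \<bullet> x = 0"
  proof (rule ccontr)
    assume "\<alpha> \<bullet> x \<noteq> 0"
    with ne have "2 * (\<alpha> \<bullet> x) / (\<alpha> \<bullet> \<alpha>) \<noteq> 0" by simp
    from span_scale[OF *, of "inverse (2 * (\<alpha> \<bullet> x) / (\<alpha> \<bullet> \<alpha>))"] this ne(2)
    show False by simp
  qed
  with eq have "word L x = x" by (simp add: reflection_orthogonal)
  with Cons.IH[OF ind] Cons.prems(2) \<open>\<alpha> \<bullet> x = 0\<close> show ?case by simp
qed simp

lemma word_fixed_in_span:
  assumes "independent (set L)" "distinct L" "word L x = x" "x \<in> span (set L)"
  shows "x = 0"
proof -
  have "orthogonal x y" if "y \<in> span (set L)" for y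
    using word_fixed_imp_orthogonal[OF assms(1-3)] that
    by (intro orthogonal_to_span[OF that]) (auto simp: orthogonal_def inner_commute)
  from this[OF assms(4)] show ?thesis by (simp add: orthogonal_self)
qed

text \<open>Positivity is measured by a vector \<open>t\<close> and no group is mentioned, so that
  \<open>R \<inter> span S\<close> for any \<open>S \<subseteq> \<Delta>\<close> is an instance with
  the same \<open>t\<close>. The theory thus applies to the whole system, the parabolic one, each
  component and each pair of simple roots.\<close>

locale simple_system =
  fixes R \<Delta> :: "(real^'n) set" and t :: "real^'n"
  assumes finite_R: "finite R"
    and regular: "\<alpha> \<in> R \<Longrightarrow> t \<bullet> \<alpha> \<noteq> 0"
    and reflection_closed: "\<alpha> \<in> R \<Longrightarrow> \<beta> \<in> R \<Longrightarrow> reflection \<alpha> \<beta> \<in> R"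
    and reduced: "\<alpha> \<in> R \<Longrightarrow> a *\<^sub>R \<alpha> \<in> R \<Longrightarrow> a = 1 \<or> a = -1"
    and simple_in: "\<Delta> \<subseteq> R"
    and simple_pos: "\<beta> \<in> \<Delta> \<Longrightarrow> t \<bullet> \<beta> > 0"
    and indep: "independent \<Delta>"
    and combination: "\<alpha> \<in> R \<Longrightarrow> t \<bullet> \<alpha> > 0 \<Longrightarrow>
      \<exists>a. (\<forall>\<beta>\<in>\<Delta>. a \<beta> \<ge> 0) \<and> \<alpha> = (\<Sum>\<beta>\<in>\<Delta>. a \<beta> *\<^sub>R \<beta>)"
begin

lemma finite_simple: "finite \<Delta>"
  using finite_R simple_in finite_subset by blast

lemma zero_notin: "0 \<notin> R"
  using regular by fastforce

lemma simple_nonzero: "\<beta> \<in> \<Delta> \<Longrightarrow> \<beta> \<noteq> 0"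
  using zero_notin simple_in by blast

lemma minus_closed: "\<alpha> \<in> R \<Longrightarrow> - \<alpha> \<in> R"
  using reflection_closed[of \<alpha> \<alpha>] by simp

lemma coeffs_unique:
  assumes "(\<Sum>\<beta>\<in>\<Delta>. a \<beta> *\<^sub>R \<beta>) = (\<Sum>\<beta>\<in>\<Delta>. b \<beta> *\<^sub>R \<beta>)" "\<beta> \<in> \<Delta>"
  shows "a \<beta> = b \<beta>"
proof -
  have "(\<Sum>\<beta>\<in>\<Delta>. (a \<beta> - b \<beta>) *\<^sub>R \<beta>) = 0"
    using assms(1) by (simp add: scaleR_left_diff_distrib sum_subtractf)
  then have "a \<beta> - b \<beta> = 0"
    using independentD[OF indep finite_simple subset_refl, of "\<lambda>\<beta>. a \<beta> - b \<beta>"] assms(2) by blast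
  then show ?thesis by simp
qed

text \<open>A root or its negative has nonnegative coefficients, and coefficients are unique; so one
  positive coefficient decides the sign of all the others and of the root.\<close>

lemma not_mixed:
  assumes "\<alpha> \<in> R" "\<alpha> = (\<Sum>\<beta>\<in>\<Delta>. a \<beta> *\<^sub>R \<beta>)" "\<beta> \<in> \<Delta>" "\<gamma> \<in> \<Delta>" "a \<beta> > 0"
  shows "a \<gamma> \<ge> 0" "t \<bullet> \<alpha> > 0"
proof -
  have "t \<bullet> \<alpha> > 0"
  proof (rule ccontr)
    assume "\<not> t \<bullet> \<alpha> > 0"
    with regular[OF assms(1)] have "t \<bullet> (- \<alpha>) > 0" by simp
    from combination[OF minus_closed[OF assms(1)] this] obtain b where
      b: "\<forall>\<beta>\<in>\<Delta>. b \<beta> \<ge> 0" "- \<alpha> = (\<Sum>\<beta>\<in>\<Delta>. b \<beta> *\<^sub>R \<beta>)" by blast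
    then have "(\<Sum>\<beta>\<in>\<Delta>. a \<beta> *\<^sub>R \<beta>) = (\<Sum>\<beta>\<in>\<Delta>. (- b \<beta>) *\<^sub>R \<beta>)"
      unfolding assms(2)[symmetric] by (simp add: sum_negf b(2)[symmetric])
    from coeffs_unique[OF this assms(3)] b(1) assms(3,5) show False by force
  qed
  then show "t \<bullet> \<alpha> > 0" .
  from combination[OF assms(1) this] obtain b where
    b: "\<forall>\<beta>\<in>\<Delta>. b \<beta> \<ge> 0" "\<alpha> = (\<Sum>\<beta>\<in>\<Delta>. b \<beta> *\<^sub>R \<beta>)" by blast
  with coeffs_unique[of a b \<gamma>] assms(2,4) show "a \<gamma> \<ge> 0" by simp
qed

lemma sum_update_coeff:
  assumes "\<beta> \<in> \<Delta>"
  shows "(\<Sum>\<gamma>\<in>\<Delta>. a \<gamma> *\<^sub>R \<gamma>) - c *\<^sub>R \<beta> = (\<Sum>\<gamma>\<in>\<Delta>. (a(\<beta> := a \<beta> - c)) \<gamma> *\<^sub>R \<gamma>)"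
proof -
  have "(\<Sum>\<gamma>\<in>\<Delta>. (a(\<beta> := a \<beta> - c)) \<gamma> *\<^sub>R \<gamma>) =
      (\<Sum>\<gamma>\<in>\<Delta>. a \<gamma> *\<^sub>R \<gamma> - (if \<gamma> = \<beta> then c *\<^sub>R \<beta> else 0))"
    by (rule sum.cong) (auto simp: scaleR_left_diff_distrib)
  then show ?thesis
    using assms finite_simple by (simp add: sum_subtractf)
qed

text \<open>The reflection changes only the coefficient at \<beta>. By reducedness, a positive root
  other than \<beta> is no multiple of \<beta>, so it has another positive coefficient, which
  survives and decides the sign.\<close>

lemma reflection_pos:
  assumes "\<beta> \<in> \<Delta>" "\<alpha> \<in> R" "t \<bullet> \<alpha> > 0" "\<alpha> \<noteq> \<beta>"
  shows "t \<bullet> reflection \<beta> \<alpha> > 0"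
proof -
  from combination[OF assms(2,3)] obtain a where
    a: "\<forall>\<beta>\<in>\<Delta>. a \<beta> \<ge> 0" "\<alpha> = (\<Sum>\<beta>\<in>\<Delta>. a \<beta> *\<^sub>R \<beta>)" by blast
  have "\<exists>\<gamma>\<in>\<Delta>. \<gamma> \<noteq> \<beta> \<and> a \<gamma> > 0"
  proof (rule ccontr)
    assume "\<not> (\<exists>\<gamma>\<in>\<Delta>. \<gamma> \<noteq> \<beta> \<and> a \<gamma> > 0)"
    with a(1) have "\<And>\<gamma>. \<gamma> \<in> \<Delta> \<Longrightarrow> \<gamma> \<noteq> \<beta> \<Longrightarrow> a \<gamma> = 0" by force
    then have "\<alpha> = (\<Sum>\<gamma>\<in>\<Delta>. if \<gamma> = \<beta> then a \<beta> *\<^sub>R \<beta> else 0)"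
      unfolding a(2) by (intro sum.cong) auto
    then have eq: "\<alpha> = a \<beta> *\<^sub>R \<beta>" using assms(1) finite_simple by simp
    with reduced[of \<beta> "a \<beta>"] assms(1,2) simple_in have "a \<beta> = 1 \<or> a \<beta> = -1" by auto
    with a(1) assms(1) have "a \<beta> = 1" by force
    with eq assms(4) show False by simp
  qed
  then obtain \<gamma> where \<gamma>: "\<gamma> \<in> \<Delta>" "\<gamma> \<noteq> \<beta>" "a \<gamma> > 0" by blast
  define c where "c = 2 * (\<beta> \<bullet> \<alpha>) / (\<beta> \<bullet> \<beta>)"
  have "reflection \<beta> \<alpha> = (\<Sum>\<gamma>\<in>\<Delta>. (a(\<beta> := a \<beta> - c)) \<gamma> *\<^sub>R \<gamma>)"
    using sum_update_coeff[OF assms(1), of a c] a(2) by (simp add: reflection_def c_def)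
  moreover have "reflection \<beta> \<alpha> \<in> R"
    using reflection_closed assms(1,2) simple_in by blast
  ultimately show ?thesis
    using not_mixed(2)[of _ "a(\<beta> := a \<beta> - c)" \<gamma> \<gamma>] \<gamma> by simp
qed

lemma reflection_neg:
  assumes "\<beta> \<in> \<Delta>" "\<alpha> \<in> R" "t \<bullet> \<alpha> > 0" "\<not> t \<bullet> reflection \<beta> \<alpha> > 0"
  shows "\<alpha> = \<beta>"
  using reflection_pos assms by blast

text \<open>With a positive product, \<open>reflection \<beta> \<gamma>\<close> would be a root with
  coefficient 1 at \<gamma> and a negative one at \<beta>.\<close>

lemma obtuse:
  assumes "\<beta> \<in> \<Delta>" "\<gamma> \<in> \<Delta>" "\<beta> \<noteq> \<gamma>"
  shows "\<beta> \<bullet> \<gamma> \<le> 0"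
proof (rule ccontr)
  assume "\<not> \<beta> \<bullet> \<gamma> \<le> 0"
  define c where "c = 2 * (\<beta> \<bullet> \<gamma>) / (\<beta> \<bullet> \<beta>)"
  have "c > 0"
    using \<open>\<not> \<beta> \<bullet> \<gamma> \<le> 0\<close> simple_nonzero[OF assms(1)] by (simp add: c_def)
  define a where "a = (\<lambda>\<delta>. if \<delta> = \<gamma> then 1 else 0 :: real)"
  have "\<gamma> = (\<Sum>\<delta>\<in>\<Delta>. if \<delta> = \<gamma> then \<delta> else 0)"
    using assms(2) finite_simple by simp
  also have "\<dots> = (\<Sum>\<delta>\<in>\<Delta>. a \<delta> *\<^sub>R \<delta>)"
    by (rule sum.cong) (auto simp: a_def)
  finally have "reflection \<beta> \<gamma> = (\<Sum>\<delta>\<in>\<Delta>. (a(\<beta> := a \<beta> - c)) \<delta> *\<^sub>R \<delta>)"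
    using sum_update_coeff[OF assms(1), of a c] by (simp add: reflection_def c_def)
  moreover have "reflection \<beta> \<gamma> \<in> R"
    using reflection_closed assms(1,2) simple_in by blast
  ultimately show False
    using not_mixed(1)[of _ "a(\<beta> := a \<beta> - c)" \<gamma> \<beta>] assms \<open>c > 0\<close> by (simp add: a_def)
qed

text \<open>Every vector of the open chamber defines the same positive roots as \<open>t\<close>;
  this lets a vector of the Coxeter plane take over the role of \<open>t\<close>.\<close>

lemma pos_if_chamber:
  assumes "\<And>\<beta>. \<beta> \<in> \<Delta> \<Longrightarrow> u \<bullet> \<beta> > 0" "\<alpha> \<in> R"
  shows "u \<bullet> \<alpha> \<noteq> 0" "t \<bullet> \<alpha> > 0 \<longleftrightarrow> u \<bullet> \<alpha> > 0"
proof -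
  have *: "u \<bullet> \<alpha> > 0" if "t \<bullet> \<alpha> > 0" "\<alpha> \<in> R" for \<alpha>
  proof -
    from combination[OF that(2,1)] obtain a where
      a: "\<forall>\<beta>\<in>\<Delta>. a \<beta> \<ge> 0" "\<alpha> = (\<Sum>\<beta>\<in>\<Delta>. a \<beta> *\<^sub>R \<beta>)" by blast
    have "\<exists>\<beta>\<in>\<Delta>. a \<beta> > 0"
    proof (rule ccontr)
      assume "\<not> (\<exists>\<beta>\<in>\<Delta>. a \<beta> > 0)"
      with a(1) have "\<And>\<beta>. \<beta> \<in> \<Delta> \<Longrightarrow> a \<beta> = 0" by force
      with a(2) have "\<alpha> = 0" by simp
      with that zero_notin show False by simp
    qed
    then obtain \<beta> where \<beta>: "\<beta> \<in> \<Delta>" "a \<beta> > 0" by blast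
    have "(\<Sum>\<beta>\<in>\<Delta>. a \<beta> * (u \<bullet> \<beta>)) > 0"
    proof (rule sum_pos2[OF finite_simple \<beta>(1)])
      show "a \<beta> * (u \<bullet> \<beta>) > 0" using \<beta> assms(1) by simp
      show "a \<gamma> * (u \<bullet> \<gamma>) \<ge> 0" if "\<gamma> \<in> \<Delta>" for \<gamma>
        using a(1) assms(1)[OF that] that by simp
    qed
    then show ?thesis unfolding a(2) by (simp add: inner_sum_right)
  qed
  have "t \<bullet> \<alpha> > 0 \<and> u \<bullet> \<alpha> > 0 \<or> t \<bullet> \<alpha> < 0 \<and> u \<bullet> \<alpha> < 0"
  proof (cases "t \<bullet> \<alpha> > 0")
    case False
    with regular[OF assms(2)] have "t \<bullet> (- \<alpha>) > 0" by simp
    from *[OF this minus_closed[OF assms(2)]] \<open>t \<bullet> (- \<alpha>) > 0\<close> show ?thesis by simp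
  qed (use *[OF _ assms(2)] in blast)
  then show "u \<bullet> \<alpha> \<noteq> 0" "t \<bullet> \<alpha> > 0 \<longleftrightarrow> u \<bullet> \<alpha> > 0"
    by auto
qed

lemma word_closed: "set L \<subseteq> \<Delta> \<Longrightarrow> \<alpha> \<in> R \<Longrightarrow> word L \<alpha> \<in> R"
  using simple_in by (induction L) (auto intro: reflection_closed)

lemma word_power_closed: "set L \<subseteq> \<Delta> \<Longrightarrow> \<alpha> \<in> R \<Longrightarrow> (word L ^^ k) \<alpha> \<in> R"
  by (induction k) (auto intro: word_closed)

lemma root_in_span: assumes "\<alpha> \<in> R" shows "\<alpha> \<in> span \<Delta>"
proof -
  have *: "\<alpha> \<in> span \<Delta>" if "\<alpha> \<in> R" "t \<bullet> \<alpha> > 0" for \<alpha>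
  proof -
    from combination[OF that] obtain a where a: "\<alpha> = (\<Sum>\<beta>\<in>\<Delta>. a \<beta> *\<^sub>R \<beta>)" by blast
    show ?thesis unfolding a by (intro span_sum span_scale span_base)
  qed
  show ?thesis
  proof (cases "t \<bullet> \<alpha> > 0")
    case False
    with regular[OF assms] have "t \<bullet> (- \<alpha>) > 0" by simp
    from span_neg[OF *[OF minus_closed[OF assms] this]] show ?thesis by simp
  qed (rule *[OF assms])
qed

lemma subsystem:
  assumes "S \<subseteq> \<Delta>"
  shows "simple_system (R \<inter> span S) S t"
proof
  fix \<alpha> assume \<alpha>: "\<alpha> \<in> R \<inter> span S" "t \<bullet> \<alpha> > 0"
  from combination[of \<alpha>] \<alpha> obtain a where
    a: "\<forall>\<beta>\<in>\<Delta>. a \<beta> \<ge> 0" "\<alpha> = (\<Sum>\<beta>\<in>\<Delta>. a \<beta> *\<^sub>R \<beta>)" by auto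
  have finS: "finite S" using assms finite_simple finite_subset by blast
  from \<alpha>(1) obtain b where b: "\<alpha> = (\<Sum>\<beta>\<in>S. b \<beta> *\<^sub>R \<beta>)"
    by (auto simp: span_finite[OF finS])
  \<comment> \<open>Extended by zero, the expansion over \<open>S\<close> becomes one over \<Delta>,
    and uniqueness transfers nonnegativity from \<open>a\<close> to \<open>b\<close>.\<close>
  define b' where "b' = (\<lambda>\<beta>. if \<beta> \<in> S then b \<beta> else 0)"
  have "(\<Sum>\<beta>\<in>S. b \<beta> *\<^sub>R \<beta>) = (\<Sum>\<beta>\<in>\<Delta>. b' \<beta> *\<^sub>R \<beta>)"
    using assms finite_simple by (intro sum.mono_neutral_cong_left) (auto simp: b'_def)
  then have "a \<beta> = b' \<beta>" if "\<beta> \<in> \<Delta>" for \<beta>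
    using coeffs_unique[of a b' \<beta>] a(2) b that by simp
  with a(1) assms have "\<forall>\<beta>\<in>S. b \<beta> \<ge> 0" by (force simp: b'_def)
  with b show "\<exists>a. (\<forall>\<beta>\<in>S. a \<beta> \<ge> 0) \<and> \<alpha> = (\<Sum>\<beta>\<in>S. a \<beta> *\<^sub>R \<beta>)" by blast
next
  fix \<alpha> \<beta> assume "\<alpha> \<in> R \<inter> span S" "\<beta> \<in> R \<inter> span S"
  then show "reflection \<alpha> \<beta> \<in> R \<inter> span S"
    by (auto simp: reflection_closed) (auto simp: reflection_def intro: span_diff span_scale)
next
  show "independent S" using indep assms independent_mono by blast
  show "S \<subseteq> R \<inter> span S" using assms simple_in span_superset by blast
qed (use finite_R regular reduced simple_pos assms in auto)

text \<open>Letters act from the right. A simple reflection makes a single positive root negative,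
  namely its own, so a letter at which the sign drops meets exactly its own root.\<close>

lemma word_sign_change:
  assumes "set L \<subseteq> \<Delta>" "\<alpha> \<in> R" "t \<bullet> \<alpha> > 0" "\<not> t \<bullet> word L \<alpha> > 0"
  obtains L2 \<gamma> L1 where "L = L2 @ \<gamma> # L1" "word L1 \<alpha> = \<gamma>"
proof -
  have "\<exists>L2 \<gamma> L1. L = L2 @ \<gamma> # L1 \<and> word L1 \<alpha> = \<gamma>"
    using assms(1,4)
  proof (induction L)
    case Nil
    with assms(3) show ?case by simp
  next
    case (Cons \<delta> L)
    show ?case
    proof (cases "t \<bullet> word L \<alpha> > 0")
      case True
      with reflection_neg[of \<delta> "word L \<alpha>"] Cons.prems word_closed[OF _ assms(2)]
      have "word L \<alpha> = \<delta>" by auto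
      then show ?thesis by blast
    next
      case False
      with Cons obtain L2 \<gamma> L1 where "L = L2 @ \<gamma> # L1" "word L1 \<alpha> = \<gamma>" by auto
      then have "\<delta> # L = (\<delta> # L2) @ \<gamma> # L1" "word L1 \<alpha> = \<gamma>" by auto
      then show ?thesis by blast
    qed
  qed
  with that show thesis by blast
qed

text \<open>The deletion argument: a word whose last letter is not cancelled by an earlier one
  makes the corresponding simple root negative.\<close>

lemma simply_transitive:
  assumes "set L \<subseteq> \<Delta>" "\<And>\<alpha>. \<alpha> \<in> R \<Longrightarrow> t \<bullet> \<alpha> > 0 \<Longrightarrow> t \<bullet> word L \<alpha> > 0"
  shows "word L = id"
  using assms
proof (induction L rule: length_induct)
  case (1 L)
  show ?case
  proof (cases L rule: rev_cases)
    case (snoc M \<beta>)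
    have \<beta>: "\<beta> \<in> \<Delta>" "\<beta> \<in> R" "set M \<subseteq> \<Delta>" using 1(2) snoc simple_in by auto
    from 1(3)[of \<beta>] \<beta> simple_pos have "t \<bullet> word L \<beta> > 0" by blast
    then have "\<not> t \<bullet> word M \<beta> > 0"
      by (simp add: snoc linear_neg[OF linear_word])
    from word_sign_change[OF \<beta>(3,2) simple_pos[OF \<beta>(1)] this]
    obtain M2 \<gamma> M1 where M: "M = M2 @ \<gamma> # M1" "word M1 \<beta> = \<gamma>" by blast
    \<comment> \<open>As \<open>word M1\<close> carries \<beta> to \<gamma>, it conjugates one
      reflection into the other; hence the letter \<gamma> cancels against the final \<beta>, and
      the word gets shorter by two.\<close>
    have "reflection \<gamma> (word M1 x) = word M1 (reflection \<beta> x)" for x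
      using reflection_conj[OF orthogonal_transformation_word, of M1 \<beta>] M(2) by simp
    then have eq: "word L = word (M2 @ M1)"
      unfolding snoc M(1) by (auto simp: fun_eq_iff reflection_involution)
    have "length (M2 @ M1) < length L" "set (M2 @ M1) \<subseteq> \<Delta>"
      using snoc M(1) 1(2) by auto
    with 1 eq show ?thesis by metis
  qed simp
qed

text \<open>Prefixing a new letter \<beta> adds precisely one root, the preimage
  \<open>\<alpha>0\<close> of \<beta> under \<open>word L\<close>. It is positive because the
  letters of \<open>L\<close>, all different from \<beta>, leave the coefficient 1 at \<beta>
  untouched.\<close>

lemma card_sign_changes:
  assumes "set L \<subseteq> \<Delta>" "distinct L"
  shows "card {\<alpha> \<in> R. t \<bullet> \<alpha> > 0 \<and> \<not> t \<bullet> word L \<alpha> > 0} = length L"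
  using assms
proof (induction L)
  case (Cons \<beta> L)
  let ?T = "\<lambda>L. {\<alpha> \<in> R. t \<bullet> \<alpha> > 0 \<and> \<not> t \<bullet> word L \<alpha> > 0}"
  define \<alpha>0 where "\<alpha>0 = word (rev L) \<beta>"
  have \<beta>: "\<beta> \<in> \<Delta>" "\<beta> \<in> R" "set L \<subseteq> \<Delta>" "\<beta> \<notin> set L" using Cons.prems simple_in by auto
  have w0: "word L \<alpha>0 = \<beta>" by (simp add: \<alpha>0_def)
  have \<alpha>0: "\<alpha>0 \<in> R" unfolding \<alpha>0_def using \<beta> by (intro word_closed) auto
  have pos0: "t \<bullet> \<alpha>0 > 0"
  proof -
    have "\<alpha>0 - \<beta> \<in> span (set L)"
      using word_diff_in_span[of "rev L" \<beta>] by (simp add: \<alpha>0_def)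
    then obtain b where b: "\<alpha>0 - \<beta> = (\<Sum>\<gamma>\<in>set L. b \<gamma> *\<^sub>R \<gamma>)"
      by (auto simp: span_finite)
    define a where "a = (\<lambda>\<gamma>. if \<gamma> = \<beta> then 1 else if \<gamma> \<in> set L then b \<gamma> else 0)"
    have "(\<Sum>\<gamma>\<in>\<Delta>. a \<gamma> *\<^sub>R \<gamma>) = (\<Sum>\<gamma>\<in>insert \<beta> (set L). a \<gamma> *\<^sub>R \<gamma>)"
      using \<beta> finite_simple by (intro sum.mono_neutral_right) (auto simp: a_def)
    also have "\<dots> = \<beta> + (\<Sum>\<gamma>\<in>set L. a \<gamma> *\<^sub>R \<gamma>)"
      using \<beta> by (simp add: a_def)
    also have "(\<Sum>\<gamma>\<in>set L. a \<gamma> *\<^sub>R \<gamma>) = (\<Sum>\<gamma>\<in>set L. b \<gamma> *\<^sub>R \<gamma>)"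
      using \<beta> by (intro sum.cong) (auto simp: a_def)
    finally have "\<alpha>0 = (\<Sum>\<gamma>\<in>\<Delta>. a \<gamma> *\<^sub>R \<gamma>)" using b by (simp add: algebra_simps)
    from not_mixed(2)[OF \<alpha>0 this \<beta>(1,1)] show ?thesis by (simp add: a_def)
  qed
  have "?T (\<beta> # L) = insert \<alpha>0 (?T L)"
  proof (intro set_eqI iffI)
    fix \<alpha> assume \<alpha>: "\<alpha> \<in> ?T (\<beta> # L)"
    show "\<alpha> \<in> insert \<alpha>0 (?T L)"
    proof (cases "t \<bullet> word L \<alpha> > 0")
      case True
      with \<alpha> \<beta> reflection_neg[of \<beta> "word L \<alpha>"] word_closed[of L \<alpha>] have "word L \<alpha> = \<beta>" by auto
      then have "\<alpha> = \<alpha>0" unfolding \<alpha>0_def using word_rev_word by metis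
      then show ?thesis by simp
    qed (use \<alpha> in auto)
  next
    fix \<alpha> assume \<alpha>: "\<alpha> \<in> insert \<alpha>0 (?T L)"
    show "\<alpha> \<in> ?T (\<beta> # L)"
    proof (cases "\<alpha> = \<alpha>0")
      case True
      then show ?thesis using \<alpha>0 pos0 w0 simple_pos[OF \<beta>(1)] by simp
    next
      case False
      with \<alpha> have \<alpha>: "\<alpha> \<in> R" "t \<bullet> \<alpha> > 0" "\<not> t \<bullet> word L \<alpha> > 0" by auto
      have "word L \<alpha> \<noteq> - \<beta>"
      proof
        assume "word L \<alpha> = - \<beta>"
        then have "\<alpha> = word (rev L) (- \<beta>)" by (metis word_rev_word)
        then have "\<alpha> = - \<alpha>0" by (simp add: \<alpha>0_def linear_neg[OF linear_word])
        with \<alpha>(2) pos0 show False by simp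
      qed
      moreover have wR: "word L \<alpha> \<in> R" using word_closed \<alpha> \<beta> by blast
      ultimately have "t \<bullet> reflection \<beta> (- word L \<alpha>) > 0"
        using \<alpha>(3) regular[OF wR] by (intro reflection_pos \<beta> minus_closed) auto
      with \<alpha> show ?thesis by (simp add: linear_neg[OF linear_reflection])
    qed
  qed
  moreover have "\<alpha>0 \<notin> ?T L" using w0 simple_pos[OF \<beta>(1)] by simp
  moreover have "finite (?T L)" using finite_R by simp
  ultimately show ?case using Cons by simp
qed simp

text \<open>The sum over a period of the orbit is fixed by the word and lies in the span of its
  letters, so it is zero. Hence \<open>t\<close> takes both signs along the orbit, and a periodic
  sequence with both signs has a drop.\<close>

lemma exists_sign_change:
  assumes "set L = \<Delta>" "distinct L" "\<alpha> \<in> R"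
  shows "\<exists>k. t \<bullet> (word L ^^ k) \<alpha> > 0 \<and> \<not> t \<bullet> (word L ^^ Suc k) \<alpha> > 0"
proof -
  let ?c = "word L"
  have inR: "(?c ^^ k) \<alpha> \<in> R" for k using word_power_closed assms by blast
  have inj: "inj (?c ^^ k)" for k
    using orthogonal_transformation_inj[OF orthogonal_transformation_word] by (rule inj_fn)
  have "\<not> inj (\<lambda>k. (?c ^^ k) \<alpha>)"
  proof
    assume "inj (\<lambda>k. (?c ^^ k) \<alpha>)"
    moreover have "finite (range (\<lambda>k. (?c ^^ k) \<alpha>))"
      using inR by (intro finite_subset[OF _ finite_R]) blast
    ultimately show False using finite_imageD infinite_UNIV_nat by blast
  qed
  then obtain i j where "i \<noteq> j" "(?c ^^ i) \<alpha> = (?c ^^ j) \<alpha>"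
    unfolding inj_def by blast
  then obtain i j where ij: "i < j" "(?c ^^ i) \<alpha> = (?c ^^ j) \<alpha>"
    by (cases i j rule: linorder_cases) auto
  define m where "m = j - i"
  have "m > 0" using ij by (simp add: m_def)
  have "(?c ^^ j) \<alpha> = (?c ^^ i) ((?c ^^ m) \<alpha>)"
    using ij(1) by (metis comp_apply funpow_add le_add_diff_inverse less_imp_le_nat m_def)
  with ij(2) inj have per: "(?c ^^ m) \<alpha> = \<alpha>" by (metis injD)
  define v where "v = (\<Sum>k<m. (?c ^^ k) \<alpha>)"
  have "?c v = (\<Sum>k<m. (?c ^^ Suc k) \<alpha>)"
    by (simp add: v_def linear_sum[OF linear_word])
  also have "\<dots> = v + (?c ^^ m) \<alpha> - \<alpha>"
  proof -
    have "(\<Sum>k<m. (?c ^^ Suc k) \<alpha>) + \<alpha> = v + (?c ^^ m) \<alpha>"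
      unfolding v_def using sum.lessThan_Suc_shift[of "\<lambda>k. (?c ^^ k) \<alpha>" m]
        sum.lessThan_Suc[of "\<lambda>k. (?c ^^ k) \<alpha>" m]
      by (simp only: funpow_0 add.commute)
    then show ?thesis by (simp only: eq_diff_eq)
  qed
  finally have "?c v = v" by (simp add: per)
  moreover have "v \<in> span (set L)"
    unfolding v_def assms(1) by (intro span_sum root_in_span inR)
  ultimately have "v = 0"
    using word_fixed_in_span[of L v] indep assms(1,2) by simp
  then have sum0: "(\<Sum>k<m. t \<bullet> (?c ^^ k) \<alpha>) = 0"
    by (metis v_def inner_sum_right inner_zero_right)
  have perk: "(?c ^^ (k + m)) \<alpha> = (?c ^^ k) \<alpha>" for k
    by (simp add: funpow_add per)
  have "\<exists>k<m. t \<bullet> (?c ^^ k) \<alpha> > 0"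
  proof (rule ccontr)
    assume "\<not> ?thesis"
    with regular[OF inR] have "\<And>k. k < m \<Longrightarrow> t \<bullet> (?c ^^ k) \<alpha> < 0" by (meson linorder_neqE)
    then have "(\<Sum>k<m. t \<bullet> (?c ^^ k) \<alpha>) < (\<Sum>k<m. 0)"
      using \<open>m > 0\<close> by (intro sum_strict_mono) auto
    with sum0 show False by simp
  qed
  then obtain a where a: "a < m" "t \<bullet> (?c ^^ a) \<alpha> > 0" by blast
  have "\<exists>k<m. \<not> t \<bullet> (?c ^^ k) \<alpha> > 0"
  proof (rule ccontr)
    assume "\<not> ?thesis"
    then have "(\<Sum>k<m. t \<bullet> (?c ^^ k) \<alpha>) > (\<Sum>k<m. 0)"
      using \<open>m > 0\<close> by (intro sum_strict_mono) auto
    with sum0 show False by simp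
  qed
  then obtain b where b: "b < m" "\<not> t \<bullet> (?c ^^ b) \<alpha> > 0" by blast
  show ?thesis
  proof (rule ccontr)
    assume no: "\<not> ?thesis"
    have "t \<bullet> (?c ^^ (a + k)) \<alpha> > 0" for k
      by (induction k) (use a no in auto)
    \<comment> \<open>Adding the period \<open>m\<close> makes the index at least \<open>a\<close>,
      so the subtraction of natural numbers is exact.\<close>
    from this[of "b + m - a"] a b perk[of b] show False by simp
  qed
qed

text \<open>Some power of the Coxeter word turns the root into a positive one that the next
  application makes negative. At the letter where the sign drops it equals that letter, and the
  reversed word leads back.\<close>

lemma conjugate_to_simple:
  assumes "\<alpha> \<in> R"
  obtains L \<beta> where "set L \<subseteq> \<Delta>" "\<beta> \<in> \<Delta>" "\<alpha> = word L \<beta>"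
proof -
  obtain L where L: "set L = \<Delta>" "distinct L"
    using finite_distinct_list[OF finite_simple] by blast
  from exists_sign_change[OF L assms] obtain k where
    k: "t \<bullet> (word L ^^ k) \<alpha> > 0" "\<not> t \<bullet> word L ((word L ^^ k) \<alpha>) > 0" by auto
  define M where "M = concat (replicate k L)"
  have M: "word M = word L ^^ k" "set M \<subseteq> \<Delta>"
    unfolding M_def L(1)[symmetric] by (induction k) auto
  from word_sign_change[OF _ word_power_closed[OF _ assms] k] L
  obtain L2 \<gamma> L1 where L': "L = L2 @ \<gamma> # L1" "word L1 ((word L ^^ k) \<alpha>) = \<gamma>" by blast
  then have "word (L1 @ M) \<alpha> = \<gamma>" by (simp add: M)
  then have "\<alpha> = word (rev (L1 @ M)) \<gamma>" using word_rev_word by metis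
  moreover have "set (rev (L1 @ M)) \<subseteq> \<Delta>" "\<gamma> \<in> \<Delta>" using L L'(1) M by auto
  ultimately show thesis using that by blast
qed

end

subsection \<open>The Coxeter plane\<close>

lemma map_order_eqI:
  assumes "n > 0" "f ^^ n = id" "\<And>j. 0 < j \<Longrightarrow> j < n \<Longrightarrow> f ^^ j \<noteq> id"
  shows "map_order f = n"
  unfolding map_order_def using assms
  by (intro Least_equality) (auto simp: not_less[symmetric])

lemma reflection_sgn: "reflection b v = v - (2 * (sgn b \<bullet> v)) *\<^sub>R sgn b"
proof -
  have "b \<bullet> b = norm b * norm b"
    by (simp flip: power2_norm_eq_inner add: power2_eq_square)
  then show ?thesis
    by (simp add: reflection_def sgn_div_norm field_simps)
qed

text \<open>Orthogonality keeps each letter from changing the inner products with the others, so the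
  corrections add up.\<close>

lemma word_orthogonal:
  assumes "distinct L" "\<And>b d. b \<in> set L \<Longrightarrow> d \<in> set L \<Longrightarrow> b \<noteq> d \<Longrightarrow> b \<bullet> d = 0"
  shows "word L v = v - (\<Sum>b\<in>set L. (2 * (sgn b \<bullet> v)) *\<^sub>R sgn b)"
  using assms
proof (induction L)
  case (Cons b L)
  have "sgn b \<bullet> (\<Sum>d\<in>set L. (2 * (sgn d \<bullet> v)) *\<^sub>R sgn d) = 0"
    using Cons.prems
    by (fastforce simp: inner_sum_right sgn_div_norm intro!: sum.neutral)
  moreover have IH: "word L v = v - (\<Sum>d\<in>set L. (2 * (sgn d \<bullet> v)) *\<^sub>R sgn d)"
    using Cons by simp
  ultimately have "sgn b \<bullet> word L v = sgn b \<bullet> v" by (simp add: inner_diff_right)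
  then have "word (b # L) v = word L v - (2 * (sgn b \<bullet> v)) *\<^sub>R sgn b"
    by (simp add: reflection_sgn)
  then show ?case using Cons.prems(1) IH by simp
qed simp

lemma cos_nonpos: "pi / 2 \<le> y \<Longrightarrow> y \<le> 3 * pi / 2 \<Longrightarrow> cos y \<le> 0"
  using cos_ge_zero[of "y - pi"] by (simp add: cos_diff)

text \<open>The samples make one turn in K steps. After a drop across pi / 2 the cosine can become
  positive again only past 3 * pi / 2, and the turn is over before it can drop once more.\<close>

lemma cos_one_sign_change:
  fixes \<psi> \<delta> :: real and K j :: nat
  assumes K: "K * \<delta> = 2 * pi" "\<delta> > 0" and j: "0 < j" "j < K"
    and c0: "cos \<psi> > 0" "cos (\<psi> + \<delta>) < 0"
    and cj: "cos (\<psi> + j * \<delta>) > 0" "cos (\<psi> + (j + 1) * \<delta>) < 0"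
  shows False
proof -
  \<comment> \<open>Subtracting this many full turns brings the starting angle between - pi and
    pi.\<close>
  define n where "n = \<lfloor>(\<psi> + pi) / (2 * pi)\<rfloor>"
  define b where "b = \<psi> - 2 * pi * of_int n"
  have cosb: "cos (b + y) = cos (\<psi> + y)" for y
  proof -
    have "cos (b + y) = cos ((\<psi> + y) - 2 * pi * of_int n)" by (simp add: b_def algebra_simps)
    also have "\<dots> = cos (\<psi> + y)"
      by (simp only: cos_diff cos_int_2pin sin_int_2pin mult_1_right mult_zero_right add_0_right)
    finally show ?thesis .
  qed
  have n: "of_int n \<le> (\<psi> + pi) / (2 * pi)" "(\<psi> + pi) / (2 * pi) < of_int n + 1"
    unfolding n_def by (rule of_int_floor_le, rule floor_correct[THEN conjunct2, simplified])
  have b: "- pi \<le> b" "b < pi"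
    using n by (simp_all add: b_def field_simps)
  have b1: "b < pi / 2"
    using cos_nonpos[of b] cosb[of 0] c0(1) b pi_gt_zero by fastforce
  have b2: "b > - (pi / 2)"
    using cos_nonpos[of "- b"] cosb[of 0] c0(1) b pi_gt_zero by fastforce
  have b3: "b + \<delta> > pi / 2"
    using cos_ge_zero[of "b + \<delta>"] cosb[of \<delta>] c0(2) b2 K(2) by fastforce
  have j1: "\<delta> \<le> j * \<delta>" using j(1) K(2) by simp
  have "(real j + 1) * \<delta> \<le> K * \<delta>"
    using j(2) K(2) by (intro mult_right_mono) auto
  then have j2: "j * \<delta> + \<delta> \<le> 2 * pi" using K(1) by (simp add: algebra_simps)
  have b4: "b + j * \<delta> > 3 * pi / 2"
    using cos_nonpos[of "b + j * \<delta>"] cosb[of "j * \<delta>"] cj(1) b3 j1 by fastforce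
  have "cos (b + (j + 1) * \<delta> - 2 * pi) \<ge> 0"
    using b4 j2 b1 K(2) by (intro cos_ge_zero) (auto simp: algebra_simps)
  then show False
    using cosb[of "(j + 1) * \<delta>"] cj(2) by (simp add: cos_diff)
qed

text \<open>Turns the inner product of a root with a moving point of the Coxeter plane into one
  cosine, whose sign changes can be counted. A negative amplitude is absorbed by a shift of
  pi.\<close>

lemma sinusoid:
  fixes A B \<theta> :: real
  obtains \<rho> \<phi> where "\<rho> \<ge> 0" "\<And>s. A * sin s + B * sin (s + \<theta>) = \<rho> * cos (s - \<phi>)"
proof -
  obtain r a where ra: "B * sin \<theta> = r * cos a" "A + B * cos \<theta> = r * sin a"
    using polar_Ex by blast
  have eq: "A * sin s + B * sin (s + \<theta>) = r * cos (s - a)" for s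
  proof -
    have "A * sin s + B * sin (s + \<theta>) = (A + B * cos \<theta>) * sin s + (B * sin \<theta>) * cos s"
      by (simp add: sin_add algebra_simps)
    then show ?thesis unfolding ra by (simp add: cos_diff algebra_simps)
  qed
  show thesis
  proof (cases "r \<ge> 0")
    case True then show thesis using that eq by blast
  next
    case False
    have "r * cos (s - a) = (- r) * cos (s - (a + pi))" for s
      by (simp add: diff_diff_eq[symmetric] cos_diff[of "s - a"])
    with False eq that[of "- r" "a + pi"] show thesis by simp
  qed
qed

context simple_system
begin

lemma word_power_inner [simp]: "(word L ^^ k) x \<bullet> (word L ^^ k) y = x \<bullet> y"
  by (induction k) simp_all

lemma word_power_bij: assumes "set L \<subseteq> \<Delta>" shows "bij_betw (word L ^^ k) R R"
proof -
  have "inj (word L ^^ k)"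
    using orthogonal_transformation_inj[OF orthogonal_transformation_word] by (rule inj_fn)
  then have inj: "inj_on (word L ^^ k) R" using inj_on_subset by blast
  have "(word L ^^ k) ` R \<subseteq> R" using word_power_closed assms by blast
  then have "(word L ^^ k) ` R = R"
    using endo_inj_surj[OF finite_R _ inj] by blast
  with inj show ?thesis by (simp add: bij_betw_def)
qed

text \<open>Double counting of the pairs of a root and an index \<open>k < K\<close> for which the
  \<open>k\<close>-th image of the root lies in \<open>T\<close>, the positive roots made negative.
  Each root has one such index; each index has \<open>card T\<close> such roots, because powers of
  the word permute \<open>R\<close>.\<close>

lemma card_roots:
  assumes L: "set L = \<Delta>" "distinct L"
    and ex1: "\<And>\<alpha>. \<alpha> \<in> R \<Longrightarrow>
      \<exists>!k. k < K \<and> t \<bullet> (word L ^^ k) \<alpha> > 0 \<and> \<not> t \<bullet> (word L ^^ Suc k) \<alpha> > 0"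
  shows "card R = K * card \<Delta>"
proof -
  define T where "T = {\<alpha> \<in> R. t \<bullet> \<alpha> > 0 \<and> \<not> t \<bullet> word L \<alpha> > 0}"
  have T: "card T = card \<Delta>"
    unfolding T_def using card_sign_changes[of L] L distinct_card by fastforce
  have "card R = (\<Sum>\<alpha>\<in>R. card {k. k < K \<and> (word L ^^ k) \<alpha> \<in> T})"
  proof -
    have "card {k. k < K \<and> (word L ^^ k) \<alpha> \<in> T} = 1" if "\<alpha> \<in> R" for \<alpha>
    proof -
      have iff: "(word L ^^ k) \<alpha> \<in> T \<longleftrightarrow>
          t \<bullet> (word L ^^ k) \<alpha> > 0 \<and> \<not> t \<bullet> (word L ^^ Suc k) \<alpha> > 0" for k
        using word_power_closed[of L \<alpha> k] that L(1) by (simp add: T_def)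
      show ?thesis unfolding iff using ex1[OF that] by (simp add: card_1_singleton_iff Ex1_def) blast
    qed
    then show ?thesis by simp
  qed
  also have "\<dots> = (\<Sum>\<alpha>\<in>R. \<Sum>k<K. if (word L ^^ k) \<alpha> \<in> T then 1 else 0)"
    by (intro sum.cong refl) (simp add: sum.If_cases Int_def)
  also have "\<dots> = (\<Sum>k<K. \<Sum>\<alpha>\<in>R. if (word L ^^ k) \<alpha> \<in> T then 1 else 0)"
    by (rule sum.swap)
  also have "\<dots> = (\<Sum>k<K. \<Sum>\<alpha>\<in>R. if \<alpha> \<in> T then 1 else 0)"
  proof (rule sum.cong[OF refl])
    fix k
    show "(\<Sum>\<alpha>\<in>R. if (word L ^^ k) \<alpha> \<in> T then 1 else 0) = (\<Sum>\<alpha>\<in>R. if \<alpha> \<in> T then 1 else (0::nat))"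
      using sum.reindex_bij_betw[OF word_power_bij[of L k], of "\<lambda>\<alpha>. if \<alpha> \<in> T then 1 else (0::nat)"] L
      by simp
  qed
  also have "(\<Sum>\<alpha>\<in>R. if \<alpha> \<in> T then 1 else (0::nat)) = card T"
  proof -
    have "R \<inter> T = T" by (auto simp: T_def)
    then show ?thesis using finite_R by (simp add: sum.If_cases)
  qed
  finally show ?thesis by (simp add: T)
qed

text \<open>The vectors \<open>e s\<close> run through a plane on which the Coxeter element is a rotation by
  \<open>2 * \<theta>\<close>, and those with \<open>pi / 2 - \<theta> < s < pi / 2\<close> lie in the open chamber. No root may
  vanish on a rotated copy of that sector, which forces \<open>\<theta>\<close> to divide \<open>pi\<close>.\<close>

lemma coxeter_plane:
  fixes x :: "real^'n \<Rightarrow> real" and \<theta> :: real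
  assumes YZ: "Y \<union> Z = \<Delta>" "Y \<inter> Z = {}" "Y \<noteq> {}" "Z \<noteq> {}"
    and orthY: "\<And>b d. b \<in> Y \<Longrightarrow> d \<in> Y \<Longrightarrow> b \<noteq> d \<Longrightarrow> b \<bullet> d = 0"
    and orthZ: "\<And>b d. b \<in> Z \<Longrightarrow> d \<in> Z \<Longrightarrow> b \<noteq> d \<Longrightarrow> b \<bullet> d = 0"
    and x: "\<And>b. b \<in> \<Delta> \<Longrightarrow> x b > 0"
    and \<theta>: "0 < \<theta>" "\<theta> \<le> pi / 2"
    and eigY: "\<And>b. b \<in> Y \<Longrightarrow> (\<Sum>d\<in>Z. x d * (sgn b \<bullet> sgn d)) = - cos \<theta> * x b"
    and eigZ: "\<And>b. b \<in> Z \<Longrightarrow> (\<Sum>d\<in>Y. x d * (sgn b \<bullet> sgn d)) = - cos \<theta> * x b"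
  shows "\<exists>K L. K \<ge> 2 \<and> \<theta> * real K = pi \<and> set L = \<Delta> \<and> distinct L \<and>
    map_order (word L) = K \<and> card R = K * card \<Delta>"
proof -
  have fin: "finite Y" "finite Z" using YZ(1) finite_simple by auto
  obtain LY where LY: "set LY = Y" "distinct LY" using finite_distinct_list[OF fin(1)] by blast
  obtain LZ where LZ: "set LZ = Z" "distinct LZ" using finite_distinct_list[OF fin(2)] by blast
  define L where "L = LZ @ LY"
  have L: "set L = \<Delta>" "distinct L" using LY LZ YZ by (auto simp: L_def)
  \<comment> \<open>The weighted sums of unit roots over the two classes. By the eigenvector
    equations, \<open>(sgn b \<bullet> v) / x b\<close> is the same for all \<open>b\<close> in one
    class whenever \<open>v\<close> is in the span of \<open>p\<close> and \<open>q\<close>.\<close>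
  define p where "p = (\<Sum>d\<in>Y. x d *\<^sub>R sgn d)"
  define q where "q = (\<Sum>d\<in>Z. x d *\<^sub>R sgn d)"
  have selfY: "sgn b \<bullet> (\<Sum>d\<in>S. x d *\<^sub>R sgn d) = x b"
    if "b \<in> S" "finite S" "S \<subseteq> \<Delta>" "\<And>b d. b \<in> S \<Longrightarrow> d \<in> S \<Longrightarrow> b \<noteq> d \<Longrightarrow> b \<bullet> d = 0" for b S
  proof -
    have "b \<noteq> 0" using that simple_nonzero by blast
    then have "sgn b \<bullet> sgn b = 1" by (simp add: dot_square_norm norm_sgn)
    have "sgn b \<bullet> (\<Sum>d\<in>S. x d *\<^sub>R sgn d) = (\<Sum>d\<in>S. if d = b then x b else 0)"
      unfolding inner_sum_right
      using that \<open>sgn b \<bullet> sgn b = 1\<close> by (intro sum.cong) (auto simp: sgn_div_norm)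
    then show ?thesis using that by simp
  qed
  have bp: "sgn b \<bullet> p = x b" if "b \<in> Y" for b
    unfolding p_def using that fin YZ orthY by (intro selfY) auto
  have bq: "sgn b \<bullet> q = - cos \<theta> * x b" if "b \<in> Y" for b
    unfolding q_def eigY[OF that, symmetric] by (simp add: inner_sum_right)
  have dq: "sgn b \<bullet> q = x b" if "b \<in> Z" for b
    unfolding q_def using that fin YZ orthZ by (intro selfY) auto
  have dp: "sgn b \<bullet> p = - cos \<theta> * x b" if "b \<in> Z" for b
    unfolding p_def eigZ[OF that, symmetric] by (simp add: inner_sum_right)
  have sin_add2: "2 * sin \<theta> * cos (s + \<theta>) = sin (s + 2 * \<theta>) - sin s" for s
  proof -
    have "s + 2 * \<theta> = (s + \<theta>) + \<theta>" by simp
    then show ?thesis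
      using sin_add[of "s + \<theta>" \<theta>] sin_diff[of "s + \<theta>" \<theta>] by (simp only: add_diff_cancel_right') simp
  qed
  have wY: "word LY v = v - (\<Sum>b\<in>Y. (2 * (sgn b \<bullet> v)) *\<^sub>R sgn b)" for v
    using word_orthogonal[of LY] LY orthY by simp
  have wZ: "word LZ v = v - (\<Sum>b\<in>Z. (2 * (sgn b \<bullet> v)) *\<^sub>R sgn b)" for v
    using word_orthogonal[of LZ] LZ orthZ by simp
  have shift1: "sin s - cos \<theta> * sin (s + \<theta>) = - sin \<theta> * cos (s + \<theta>)" for s
    using sin_diff[of "s + \<theta>" \<theta>] by (simp add: algebra_simps)
  have shift2: "sin (s + \<theta>) - cos \<theta> * sin s = sin \<theta> * cos s" for s
    by (simp add: sin_add)
  \<comment> \<open>The total correction is a multiple of \<open>p\<close>, so only the coefficient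
    of \<open>p\<close> changes: its argument, \<theta> behind that of \<open>q\<close>, moves to
    \<theta> ahead of it.\<close>
  have stepY: "word LY (sin s *\<^sub>R p + sin (s + \<theta>) *\<^sub>R q) =
      sin (s + 2 * \<theta>) *\<^sub>R p + sin (s + \<theta>) *\<^sub>R q" for s
  proof -
    let ?v = "sin s *\<^sub>R p + sin (s + \<theta>) *\<^sub>R q"
    have "sgn b \<bullet> ?v = x b * (- sin \<theta> * cos (s + \<theta>))" if "b \<in> Y" for b
      unfolding shift1[symmetric] using bp[OF that] bq[OF that]
      by (simp add: inner_add_right algebra_simps)
    then have "(\<Sum>b\<in>Y. (2 * (sgn b \<bullet> ?v)) *\<^sub>R sgn b) =
        (\<Sum>b\<in>Y. (- (2 * sin \<theta> * cos (s + \<theta>))) *\<^sub>R (x b *\<^sub>R sgn b))"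
      by (intro sum.cong refl) (simp add: mult_ac)
    also have "\<dots> = (- (2 * sin \<theta> * cos (s + \<theta>))) *\<^sub>R p"
      unfolding p_def scaleR_sum_right ..
    also have "\<dots> = (sin s - sin (s + 2 * \<theta>)) *\<^sub>R p" unfolding sin_add2 by simp
    finally show ?thesis unfolding wY by (simp add: scaleR_left_diff_distrib)
  qed
  have stepZ: "word LZ (sin (s + \<theta>) *\<^sub>R p + sin s *\<^sub>R q) =
      sin (s + \<theta>) *\<^sub>R p + sin (s + 2 * \<theta>) *\<^sub>R q" for s
  proof -
    let ?v = "sin (s + \<theta>) *\<^sub>R p + sin s *\<^sub>R q"
    have "sgn b \<bullet> ?v = x b * (- sin \<theta> * cos (s + \<theta>))" if "b \<in> Z" for b
      unfolding shift1[symmetric] using dp[OF that] dq[OF that]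
      by (simp add: inner_add_right algebra_simps)
    then have "(\<Sum>b\<in>Z. (2 * (sgn b \<bullet> ?v)) *\<^sub>R sgn b) =
        (\<Sum>b\<in>Z. (- (2 * sin \<theta> * cos (s + \<theta>))) *\<^sub>R (x b *\<^sub>R sgn b))"
      by (intro sum.cong refl) (simp add: mult_ac)
    also have "\<dots> = (- (2 * sin \<theta> * cos (s + \<theta>))) *\<^sub>R q"
      unfolding q_def scaleR_sum_right ..
    also have "\<dots> = (sin s - sin (s + 2 * \<theta>)) *\<^sub>R q" unfolding sin_add2 by simp
    finally show ?thesis unfolding wZ by (simp add: scaleR_left_diff_distrib)
  qed
  \<comment> \<open>The arguments of the two sines differ by \<theta>, so that \<open>LY\<close>
    lets \<open>p\<close> overtake \<open>q\<close>, and then \<open>LZ\<close> lets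
    \<open>q\<close> overtake \<open>p\<close>; together both advance by 2 * \<theta>.\<close>
  define e where "e = (\<lambda>s. sin s *\<^sub>R p + sin (s + \<theta>) *\<^sub>R q)"
  have ce: "word L (e s) = e (s + 2 * \<theta>)" for s
  proof -
    have "word L (e s) = word LZ (sin (s + 2 * \<theta>) *\<^sub>R p + sin (s + \<theta>) *\<^sub>R q)"
      by (simp add: L_def e_def stepY)
    also have "\<dots> = sin (s + 2 * \<theta>) *\<^sub>R p + sin (s + \<theta> + 2 * \<theta>) *\<^sub>R q"
      using stepZ[of "s + \<theta>"] by (simp add: add.assoc)
    finally show ?thesis by (simp add: e_def algebra_simps)
  qed
  have cke: "(word L ^^ k) (e s) = e (s + 2 * real k * \<theta>)" for k s
    by (induction k) (simp_all add: ce algebra_simps)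
  have eY: "sgn b \<bullet> e s = - x b * sin \<theta> * cos (s + \<theta>)" if "b \<in> Y" for b s
  proof -
    have "sgn b \<bullet> e s = x b * (sin s - cos \<theta> * sin (s + \<theta>))"
      using bp[OF that] bq[OF that] by (simp add: e_def inner_add_right algebra_simps)
    then show ?thesis by (simp add: shift1)
  qed
  have eZ: "sgn b \<bullet> e s = x b * sin \<theta> * cos s" if "b \<in> Z" for b s
  proof -
    have "sgn b \<bullet> e s = x b * (sin (s + \<theta>) - cos \<theta> * sin s)"
      using dp[OF that] dq[OF that] by (simp add: e_def inner_add_right algebra_simps)
    then show ?thesis by (simp add: shift2)
  qed
  have "\<theta> < pi" using \<theta> pi_gt_zero by linarith
  then have sin\<theta>: "sin \<theta> > 0" using \<theta> sin_gt_zero by blast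
  have sgn_pos: "u \<bullet> b > 0 \<longleftrightarrow> sgn b \<bullet> u > 0" if "b \<in> \<Delta>" for b u
    using simple_nonzero[OF that]
    by (simp add: sgn_div_norm inner_commute zero_less_mult_iff)
  have chamber: "e (pi / 2 - \<sigma>) \<bullet> b > 0" if "0 < \<sigma>" "\<sigma> < \<theta>" "b \<in> \<Delta>" for \<sigma> b
  proof (cases "b \<in> Y")
    case True
    have "cos (pi / 2 - \<sigma> + \<theta>) = - sin (\<theta> - \<sigma>)" by (simp add: cos_add cos_diff sin_diff)
    moreover have "sin (\<theta> - \<sigma>) > 0" using that \<open>\<theta> < pi\<close> by (intro sin_gt_zero) auto
    ultimately show ?thesis
      unfolding sgn_pos[OF that(3)] eY[OF True] using x[OF that(3)] sin\<theta> by simp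
  next
    case False
    with that YZ have "b \<in> Z" by blast
    moreover have "sin \<sigma> > 0" using that \<open>\<theta> < pi\<close> by (intro sin_gt_zero) auto
    moreover have "cos (pi / 2 - \<sigma>) = sin \<sigma>" by (simp add: cos_diff)
    ultimately show ?thesis
      unfolding sgn_pos[OF that(3)] eZ[OF \<open>b \<in> Z\<close>] using x[OF that(3)] sin\<theta> by simp
  qed
  have nonvanish: "\<alpha> \<bullet> e (pi / 2 - \<sigma> + 2 * real k * \<theta>) \<noteq> 0"
    if \<sigma>: "0 < \<sigma>" "\<sigma> < \<theta>" and \<alpha>: "\<alpha> \<in> R" for \<sigma> \<alpha> and k :: nat
  proof -
    obtain \<alpha>' where \<alpha>': "\<alpha>' \<in> R" "(word L ^^ k) \<alpha>' = \<alpha>"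
      using word_power_bij[of L k] L \<alpha> unfolding bij_betw_def
      by (metis imageE order_refl)
    have "\<alpha> \<bullet> e (pi / 2 - \<sigma> + 2 * real k * \<theta>) = \<alpha>' \<bullet> e (pi / 2 - \<sigma>)"
      unfolding \<alpha>'(2)[symmetric] using word_power_inner[of k L \<alpha>' "e (pi / 2 - \<sigma>)"]
      by (simp only: cke)
    with pos_if_chamber(1)[OF chamber[OF \<sigma>] \<alpha>'(1)] show ?thesis
      by (simp add: inner_commute)
  qed
  \<comment> \<open>In effect no multiple of pi lies strictly between
    \<open>(j - 1) * \<theta>\<close> and \<open>j * \<theta>\<close>. A root of \<open>Z\<close>
    shows this for even \<open>j\<close> and a root of \<open>Y\<close> for odd \<open>j\<close>, as
    the cosines that govern the two classes are shifted by \<theta>.\<close>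
  have nosin: "sin (j * \<theta> - \<sigma>) \<noteq> 0" if "0 < \<sigma>" "\<sigma> < \<theta>" for \<sigma> and j :: nat
  proof (cases "even j")
    case True
    then obtain k where k: "j = 2 * k" by blast
    obtain b where b: "b \<in> Z" "b \<in> R" using YZ simple_in by blast
    have "sgn b \<bullet> e (pi / 2 - \<sigma> + 2 * real k * \<theta>) \<noteq> 0"
      using nonvanish[OF that b(2), of k] zero_notin b(2) by (auto simp: sgn_div_norm)
    then have "cos (pi / 2 - \<sigma> + 2 * real k * \<theta>) \<noteq> 0" unfolding eZ[OF b(1)] by auto
    moreover have "cos (pi / 2 - \<sigma> + 2 * real k * \<theta>) = - sin (2 * real k * \<theta> - \<sigma>)"
      by (simp add: cos_add cos_diff sin_diff)
    ultimately show ?thesis by (simp add: k)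
  next
    case False
    then obtain k where k: "j = 2 * k + 1" by (auto elim: oddE)
    obtain b where b: "b \<in> Y" "b \<in> R" using YZ simple_in by blast
    have "sgn b \<bullet> e (pi / 2 - \<sigma> + 2 * real k * \<theta>) \<noteq> 0"
      using nonvanish[OF that b(2), of k] zero_notin b(2) by (auto simp: sgn_div_norm)
    then have "cos (pi / 2 - \<sigma> + 2 * real k * \<theta> + \<theta>) \<noteq> 0" unfolding eY[OF b(1)] by auto
    moreover have "cos (pi / 2 - \<sigma> + 2 * real k * \<theta> + \<theta>) = - sin (j * \<theta> - \<sigma>)"
    proof -
      have "pi / 2 - \<sigma> + 2 * real k * \<theta> + \<theta> = pi / 2 + (j * \<theta> - \<sigma>)"
        by (simp add: k algebra_simps)
      then show ?thesis by (simp only: cos_add) simp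
    qed
    ultimately show ?thesis by simp
  qed
  \<comment> \<open>The least \<open>K\<close> with \<open>K * \<theta>\<close> at least pi. An
    overshoot would be smaller than \<theta>, and \<open>nosin\<close> with the overshoot as
    \<sigma> rules it out.\<close>
  define K where "K = nat \<lceil>pi / \<theta>\<rceil>"
  have Kr: "pi / \<theta> \<le> real K" "real K < pi / \<theta> + 1"
    using \<theta>(1) pi_gt_zero unfolding K_def by (simp_all add: of_nat_nat le_of_int_ceiling ceiling_less_iff) linarith+
  have "\<not> (0 < K * \<theta> - pi)"
  proof
    assume *: "0 < K * \<theta> - pi"
    have "K * \<theta> - pi < \<theta>" using Kr(2) \<theta>(1) by (simp add: field_simps)
    from nosin[OF * this, of K] show False by simp
  qed
  then have K: "\<theta> * K = pi" using Kr(1) \<theta>(1) by (simp add: field_simps)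
  have K2: "K \<ge> 2"
  proof (rule ccontr)
    assume "\<not> K \<ge> 2"
    then have "\<theta> * K \<le> \<theta>" using \<theta>(1) by (simp add: mult_le_cancel_left2)
    with K \<theta> show False by simp
  qed
  \<comment> \<open>The middle of the sector, which replaces \<open>t\<close> as the vector that
    decides signs.\<close>
  define u where "u = e (pi / 2 - \<theta> / 2)"
  have u: "u \<bullet> b > 0" if "b \<in> \<Delta>" for b
    unfolding u_def using \<theta>(1) that by (intro chamber) auto
  have per: "e (s + 2 * pi) = e s" for s
    by (simp add: e_def add.assoc add.commute[of "2 * pi"]) (simp flip: add.assoc)
  \<comment> \<open>After \<open>K\<close> steps the argument has grown by 2 * pi, so the chamber
    vector \<open>u\<close> is fixed. Then no root changes sign, and
    \<open>simply_transitive\<close> gives the identity.\<close>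
  have cK: "word L ^^ K = id"
  proof -
    define M where "M = concat (replicate K L)"
    have M: "word M = word L ^^ K" "set M \<subseteq> \<Delta>"
      unfolding M_def L(1)[symmetric] by (induction K) auto
    have full: "2 * real K * \<theta> = 2 * pi" using K by (simp add: mult_ac)
    have fixu: "word M u = u"
      unfolding M(1) u_def cke full by (rule per)
    have "word M = id"
    proof (rule simply_transitive[OF M(2)])
      fix \<alpha> assume \<alpha>: "\<alpha> \<in> R" "t \<bullet> \<alpha> > 0"
      have "u \<bullet> word M \<alpha> = u \<bullet> \<alpha>" using word_inner[of M u \<alpha>] fixu by simp
      with pos_if_chamber(2)[OF u \<alpha>(1)] pos_if_chamber(2)[OF u word_closed[OF M(2) \<alpha>(1)]] \<alpha>(2)
      show "t \<bullet> word M \<alpha> > 0" by simp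
    qed
    then show ?thesis by (simp add: M)
  qed
  \<comment> \<open>Pairing \<open>e 0\<close> and its image with a root of \<open>Z\<close> forces
    \<open>cos (2 * j * \<theta>) = 1\<close>, that is, \<open>j * \<theta>\<close> is a multiple of
    pi, although it lies strictly between 0 and pi.\<close>
  have cj: "word L ^^ j \<noteq> id" if "0 < j" "j < K" for j
  proof
    assume *: "word L ^^ j = id"
    obtain b where b: "b \<in> Z" "b \<in> \<Delta>" using YZ by blast
    have "e (2 * j * \<theta>) = e 0" using cke[of j 0] * by simp
    then have "cos (2 * j * \<theta>) = 1"
      using eZ[OF b(1), of 0] eZ[OF b(1), of "2 * j * \<theta>"] x[OF b(2)] sin\<theta> by simp
    then obtain n :: int where n: "2 * j * \<theta> = n * 2 * pi" by (auto simp: cos_one_2pi_int)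
    have "0 < j * \<theta>" "j * \<theta> < \<theta> * K" using that \<theta>(1) by (simp_all add: mult.commute)
    moreover have "j * \<theta> = n * pi" using n by simp
    ultimately have "0 < real_of_int n * pi" "real_of_int n * pi < 1 * pi" using K by simp_all
    then have "0 < n" "n < 1"
      using pi_gt_zero by (simp_all only: mult_less_cancel_right zero_less_mult_iff) auto
    then show False by simp
  qed
  have "map_order (word L) = K"
    using cK cj K2 by (intro map_order_eqI) auto
  moreover have "card R = K * card \<Delta>"
  proof (rule card_roots[OF L])
    fix \<alpha> assume \<alpha>: "\<alpha> \<in> R"
    have inR: "(word L ^^ k) \<alpha> \<in> R" for k using word_power_closed \<alpha> L by blast
    have modK: "(word L ^^ (k mod K)) \<alpha> = (word L ^^ k) \<alpha>" for k
    proof -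
      have "word L ^^ k = word L ^^ (k mod K + K * (k div K))" by simp
      also have "\<dots> = word L ^^ (k mod K)" by (simp only: funpow_add funpow_mult[symmetric] cK) simp
      finally show ?thesis by simp
    qed
    obtain \<rho> \<phi> where \<rho>: "\<rho> \<ge> 0"
      "\<And>s. (\<alpha> \<bullet> p) * sin s + (\<alpha> \<bullet> q) * sin (s + \<theta>) = \<rho> * cos (s - \<phi>)"
      using sinusoid by blast
    \<comment> \<open>Moving the power of the word to the other side of the inner product, the orbit
      of \<alpha> paired with \<open>u\<close> is a cosine sampled at steps of 2 * \<theta>, and
      \<psi> is its initial phase.\<close>
    define \<psi> where "\<psi> = \<phi> - (pi / 2 - \<theta> / 2)"
    have cos_eq: "u \<bullet> (word L ^^ k) \<alpha> = \<rho> * cos (\<psi> + k * (2 * \<theta>))" for k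
    proof -
      have "u = (word L ^^ k) (e (pi / 2 - \<theta> / 2 - 2 * real k * \<theta>))"
        unfolding u_def cke by simp
      then have "u \<bullet> (word L ^^ k) \<alpha> = \<alpha> \<bullet> e (pi / 2 - \<theta> / 2 - 2 * real k * \<theta>)"
        by (metis word_power_inner inner_commute)
      also have "\<dots> = \<rho> * cos (pi / 2 - \<theta> / 2 - 2 * real k * \<theta> - \<phi>)"
        unfolding \<rho>(2)[symmetric] by (simp add: e_def inner_add_right mult_ac)
      also have "pi / 2 - \<theta> / 2 - 2 * real k * \<theta> - \<phi> = - (\<psi> + k * (2 * \<theta>))"
        by (simp add: \<psi>_def algebra_simps)
      finally show ?thesis by (simp only: cos_minus)
    qed
    have "\<rho> > 0"
      using \<rho>(1) pos_if_chamber(1)[OF u \<alpha>] cos_eq[of 0] by (cases "\<rho> = 0") auto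
    have tpos: "t \<bullet> (word L ^^ k) \<alpha> > 0 \<longleftrightarrow> cos (\<psi> + k * (2 * \<theta>)) > 0" for k
      using pos_if_chamber(2)[OF u inR, of k] \<open>\<rho> > 0\<close>
      by (simp add: cos_eq zero_less_mult_iff)
    have nz: "cos (\<psi> + k * (2 * \<theta>)) \<noteq> 0" for k :: nat
      using pos_if_chamber(1)[OF u inR, of k] by (auto simp: cos_eq)
    define P where "P k \<longleftrightarrow> t \<bullet> (word L ^^ k) \<alpha> > 0 \<and> \<not> t \<bullet> (word L ^^ Suc k) \<alpha> > 0" for k
    have uniq: "\<not> (i < j \<and> j < K \<and> P i \<and> P j)" for i j
    proof
      assume a: "i < j \<and> j < K \<and> P i \<and> P j"
      define m where "m = j - i"
      have m: "0 < m" "m < K" and j: "j = i + m" using a by (auto simp: m_def)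
      have s: "cos (\<psi> + i * (2 * \<theta>)) > 0" "cos (\<psi> + Suc i * (2 * \<theta>)) < 0"
        "cos (\<psi> + (i + m) * (2 * \<theta>)) > 0" "cos (\<psi> + Suc (i + m) * (2 * \<theta>)) < 0"
        using a nz[of "Suc i"] nz[of "Suc (i + m)"] unfolding P_def tpos j by auto
      show False
        by (rule cos_one_sign_change[of K "2 * \<theta>" m "\<psi> + i * (2 * \<theta>)"])
          (use K \<theta>(1) m s in \<open>simp_all add: algebra_simps\<close>)
    qed
    obtain k where k: "P k" using exists_sign_change[OF L \<alpha>] unfolding P_def by blast
    have "P (k mod K)"
      using k modK[of k] unfolding P_def by simp
    moreover have "k mod K < K" using K2 by simp
    ultimately show "\<exists>!k. k < K \<and> t \<bullet> (word L ^^ k) \<alpha> > 0 \<and> \<not> t \<bullet> (word L ^^ Suc k) \<alpha> > 0"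
      unfolding P_def[symmetric] using uniq by (metis linorder_neqE_nat)
  qed
  ultimately show ?thesis using K2 K L by blast
qed

end

subsection \<open>Coxeter elements of irreducible systems\<close>

lemma map_order_conj:
  assumes "a \<circ> b = id" "b \<circ> a = id"
  shows "map_order (a \<circ> f \<circ> b) = map_order f"
proof -
  have ba: "b (a y) = y" for y using assms(2) by (metis comp_apply id_apply)
  have ab: "a (b y) = y" for y using assms(1) by (metis comp_apply id_apply)
  have "((a \<circ> f \<circ> b) ^^ n) y = a ((f ^^ n) (b y))" for n y
    by (induction n) (simp_all add: ba ab)
  then have pow: "(a \<circ> f \<circ> b) ^^ n = a \<circ> f ^^ n \<circ> b" for n
    by (simp add: fun_eq_iff)
  have "(a \<circ> f \<circ> b) ^^ n = id \<longleftrightarrow> f ^^ n = id" for n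
  proof
    assume "(a \<circ> f \<circ> b) ^^ n = id"
    then have "a ((f ^^ n) (b (a y))) = a y" for y by (simp add: pow fun_eq_iff)
    then show "f ^^ n = id" by (metis ba ext id_apply)
  qed (simp add: pow assms)
  then show ?thesis by (simp add: map_order_def)
qed

lemma reflection_comp_self: "reflection \<alpha> \<circ> reflection \<alpha> = id"
  by (simp add: fun_eq_iff reflection_involution)

lemma map_order_rotate: "map_order (word (L @ [\<alpha>])) = map_order (word (\<alpha> # L))"
proof -
  have "word (L @ [\<alpha>]) = reflection \<alpha> \<circ> word (\<alpha> # L) \<circ> reflection \<alpha>"
    by (simp add: fun_eq_iff reflection_involution)
  then show ?thesis
    using map_order_conj[OF reflection_comp_self reflection_comp_self] by metis
qed

lemma reflections_commute:
  assumes "\<alpha> \<bullet> \<beta> = 0"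
  shows "reflection \<alpha> \<circ> reflection \<beta> = reflection \<beta> \<circ> reflection \<alpha>"
  using reflection_conj[OF orthogonal_transformation_reflection, of \<alpha> \<beta>]
    reflection_orthogonal[OF assms] by (simp add: fun_eq_iff)

text \<open>Exchanging orthogonal neighbours and rotating change the product of the reflections at
  most by conjugation, hence not its order. The relation lives on lists rather than on products so
  that a removed letter can be inserted again.\<close>

inductive shift_equiv :: "(real^'n) list \<Rightarrow> (real^'n) list \<Rightarrow> bool" where
  equiv_refl: "shift_equiv L L"
| equiv_sym: "shift_equiv L M \<Longrightarrow> shift_equiv M L"
| equiv_trans: "shift_equiv L M \<Longrightarrow> shift_equiv M N \<Longrightarrow> shift_equiv L N"
| equiv_swap: "\<alpha> \<bullet> \<beta> = 0 \<Longrightarrow> shift_equiv (L @ \<alpha> # \<beta> # M) (L @ \<beta> # \<alpha> # M)"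
| equiv_rotate: "shift_equiv (\<alpha> # L) (L @ [\<alpha>])"

lemma shift_equiv_map_order: "shift_equiv L M \<Longrightarrow> map_order (word L) = map_order (word M)"
proof (induction rule: shift_equiv.induct)
  case (equiv_swap \<alpha> \<beta> L M)
  have "word (L @ \<alpha> # \<beta> # M) = word L \<circ> (reflection \<alpha> \<circ> reflection \<beta>) \<circ> word M"
    by (simp add: o_assoc)
  also have "\<dots> = word (L @ \<beta> # \<alpha> # M)"
    by (simp only: reflections_commute[OF equiv_swap]) (simp add: o_assoc)
  finally show ?case by simp
qed (simp_all only: map_order_rotate)

lemma shift_equiv_mset: "shift_equiv L M \<Longrightarrow> mset L = mset M"
  by (induction rule: shift_equiv.induct) auto

lemma shift_equiv_append: "shift_equiv (L @ M) (M @ L)"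
proof (induction L arbitrary: M)
  case (Cons \<alpha> L)
  from Cons[of "M @ [\<alpha>]"] show ?case
    using shift_equiv.equiv_rotate[of \<alpha> "L @ M"] shift_equiv.equiv_trans by fastforce
qed (simp add: shift_equiv.equiv_refl)

lemma shift_equiv_move:
  assumes "\<And>\<alpha>. \<alpha> \<in> set M \<Longrightarrow> \<alpha> \<bullet> v = 0"
  shows "shift_equiv (L @ v # M @ N) (L @ M @ v # N)"
  using assms
proof (induction M arbitrary: L)
  case (Cons \<alpha> M)
  have "shift_equiv (L @ v # (\<alpha> # M) @ N) (L @ \<alpha> # v # M @ N)"
    using shift_equiv.equiv_swap[of v \<alpha> L "M @ N"] Cons.prems[of \<alpha>] by (simp add: inner_commute)
  moreover have "shift_equiv (L @ \<alpha> # v # M @ N) (L @ (\<alpha> # M) @ v # N)"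
    using Cons.IH[of "L @ [\<alpha>]"] Cons.prems by simp
  ultimately show ?case by (rule shift_equiv.equiv_trans)
qed (simp add: shift_equiv.equiv_refl)

text \<open>Only \<open>u\<close> may fail to be orthogonal to \<open>v\<close>. If another letter
  rotates, it first passes \<open>v\<close>; if \<open>u\<close> rotates, \<open>v\<close> goes to
  the end and returns through the remaining letters, which by distinctness differ from
  \<open>u\<close>.\<close>

lemma shift_equiv_Cons:
  assumes "shift_equiv L M" "distinct L" "\<And>\<alpha>. \<alpha> \<in> set L \<Longrightarrow> \<alpha> \<noteq> u \<Longrightarrow> \<alpha> \<bullet> v = 0"
  shows "shift_equiv (v # L) (v # M)"
  using assms
proof (induction rule: shift_equiv.induct)
  case (equiv_sym L M)
  from shift_equiv_mset[OF equiv_sym(1)] equiv_sym show ?case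
    by (metis shift_equiv.equiv_sym mset_eq_setD mset_eq_imp_distinct_iff)
next
  case (equiv_trans L M N)
  from shift_equiv_mset[OF equiv_trans(1)] equiv_trans show ?case
    by (metis shift_equiv.equiv_trans mset_eq_setD mset_eq_imp_distinct_iff)
next
  case (equiv_swap \<alpha> \<beta> L M)
  from shift_equiv.equiv_swap[OF equiv_swap(1), of "v # L" M] show ?case by simp
next
  case (equiv_rotate \<alpha> L)
  show ?case
  proof (cases "\<alpha> = u")
    case False
    with equiv_rotate have "v \<bullet> \<alpha> = 0" by (simp add: inner_commute)
    then have "shift_equiv (v # \<alpha> # L) (\<alpha> # v # L)"
      using shift_equiv.equiv_swap[of v \<alpha> "[]" L] by simp
    then show ?thesis
      using shift_equiv.equiv_rotate[of \<alpha> "v # L"] shift_equiv.equiv_trans by fastforce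
  next
    case True
    with equiv_rotate have "\<And>\<beta>. \<beta> \<in> set L \<Longrightarrow> \<beta> \<bullet> v = 0" by auto
    then have "shift_equiv ([\<alpha>] @ v # L @ []) ([\<alpha>] @ L @ [v])"
      by (rule shift_equiv_move)
    then have "shift_equiv (\<alpha> # L @ [v]) (\<alpha> # v # L)"
      using shift_equiv.equiv_sym by simp
    with shift_equiv.equiv_rotate[of v "\<alpha> # L"] shift_equiv.equiv_rotate[of \<alpha> "v # L"]
    show ?thesis by (auto intro: shift_equiv.equiv_trans)
  qed
qed (rule shift_equiv.equiv_refl)

section \<open>The Coxeter graph is a forest\<close>

context simple_system
begin

text \<open>Two joined roots are simple roots of a rank-two system, to which
  \<open>coxeter_plane\<close> applies with both weights 1: \<theta> is pi / K with K the order of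
  the product, and K = 2 would mean orthogonality. The value \<open>a = 1\<close> would make the
  unit roots opposite, although \<open>t\<close> is positive on both.\<close>

lemma edge_angle:
  assumes "\<beta> \<in> \<Delta>" "\<gamma> \<in> \<Delta>" "\<beta> \<noteq> \<gamma>" "\<beta> \<bullet> \<gamma> \<noteq> 0"
  shows "sgn \<beta> \<bullet> sgn \<gamma> \<le> - (1 / 2)" "map_order (reflection \<beta> \<circ> reflection \<gamma>) \<ge> 3"
proof -
  interpret S: simple_system "R \<inter> span {\<beta>, \<gamma>}" "{\<beta>, \<gamma>}" t
    using assms by (intro subsystem) auto
  have nz: "\<beta> \<noteq> 0" "\<gamma> \<noteq> 0" using simple_nonzero assms by auto
  define a where "a = - (sgn \<beta> \<bullet> sgn \<gamma>)"
  have "\<beta> \<bullet> \<gamma> < 0" using obtuse[OF assms(1-3)] assms(4) by simp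
  then have a0: "a > 0" using nz by (simp add: a_def sgn_div_norm mult_less_0_iff divide_less_0_iff zero_less_mult_iff)
  have n1: "norm (sgn \<beta>) = 1" "norm (sgn \<gamma>) = 1" using nz by (simp_all add: norm_sgn)
  have "a \<le> 1" using Cauchy_Schwarz_ineq2[of "sgn \<beta>" "sgn \<gamma>"] n1 by (simp add: a_def)
  moreover have "a \<noteq> 1"
  proof
    assume "a = 1"
    moreover have "(sgn \<beta> + sgn \<gamma>) \<bullet> (sgn \<beta> + sgn \<gamma>) =
        (norm (sgn \<beta>))\<^sup>2 + 2 * (sgn \<beta> \<bullet> sgn \<gamma>) + (norm (sgn \<gamma>))\<^sup>2"
      unfolding power2_norm_eq_inner
      by (simp add: inner_add_left inner_add_right inner_commute[of "sgn \<gamma>" "sgn \<beta>"])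
    ultimately have "(sgn \<beta> + sgn \<gamma>) \<bullet> (sgn \<beta> + sgn \<gamma>) = 0"
      using n1 by (simp only: a_def) simp
    then have "sgn \<beta> + sgn \<gamma> = 0" by (simp only: inner_eq_zero_iff)
    then have "t \<bullet> sgn \<beta> + t \<bullet> sgn \<gamma> = 0" by (simp only: inner_add_right[symmetric] inner_zero_right)
    moreover have "t \<bullet> sgn \<beta> > 0" "t \<bullet> sgn \<gamma> > 0"
      using simple_pos assms(1,2) nz by (simp_all add: sgn_div_norm)
    ultimately show False by simp
  qed
  ultimately have a1: "a < 1" by simp
  define \<theta> where "\<theta> = arccos a"
  have cos\<theta>: "cos \<theta> = a" using a0 a1 by (simp add: \<theta>_def)
  have \<theta>: "0 < \<theta>" "\<theta> < pi / 2"
    using arccos_lt_bounded[of a] arccos_less_arccos[of 0 a] a0 a1 by (auto simp: \<theta>_def)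
  have "\<exists>K L. K \<ge> 2 \<and> \<theta> * real K = pi \<and> set L = {\<beta>, \<gamma>} \<and> distinct L \<and>
      map_order (word L) = K \<and> card (R \<inter> span {\<beta>, \<gamma>}) = K * card {\<beta>, \<gamma>}"
    by (rule S.coxeter_plane[of "{\<beta>}" "{\<gamma>}" "\<lambda>_. 1" \<theta>])
      (use assms \<theta> cos\<theta> in \<open>auto simp: a_def inner_commute\<close>)
  then obtain K L where K: "K \<ge> 2" "\<theta> * real K = pi" "set L = {\<beta>, \<gamma>}" "distinct L"
    "map_order (word L) = K"
    by blast
  have K3: "K \<ge> 3"
  proof (rule ccontr)
    assume "\<not> K \<ge> 3"
    with K(1) have "K = 2" by simp
    with K(2) \<theta> show False by simp
  qed
  have "\<theta> = pi / K" using K(1,2) by (simp add: field_simps)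
  also have "\<dots> \<le> pi / 3" using K3 by (intro divide_left_mono) auto
  finally have "cos (pi / 3) \<le> cos \<theta>" using \<theta> by (intro cos_monotone_0_pi_le) auto
  then show "sgn \<beta> \<bullet> sgn \<gamma> \<le> - (1 / 2)" by (simp add: cos_60 cos\<theta> a_def)
  have "length L = 2" using K(3,4) distinct_card[of L] assms(3) by simp
  then obtain p q where "L = [p, q]" by (auto simp: length_Suc_conv numeral_2_eq_2)
  with K(3,4) have "L = [\<beta>, \<gamma>] \<or> L = [\<gamma>, \<beta>]" by (auto simp: doubleton_eq_iff)
  then have "map_order (word [\<beta>, \<gamma>]) = K"
    using K(5) map_order_rotate[of "[\<beta>]" \<gamma>] by auto
  with K3 show "map_order (reflection \<beta> \<circ> reflection \<gamma>) \<ge> 3" by simp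
qed

lemma coxeter_edges_eq:
  assumes "S \<subseteq> \<Delta>"
  shows "coxeter_edges S = {(\<alpha>, \<beta>). \<alpha> \<in> S \<and> \<beta> \<in> S \<and> \<alpha> \<noteq> \<beta> \<and> \<alpha> \<bullet> \<beta> \<noteq> 0}"
proof -
  have "map_order (reflection \<alpha> \<circ> reflection \<beta>) \<ge> 3 \<longleftrightarrow> \<alpha> \<noteq> \<beta> \<and> \<alpha> \<bullet> \<beta> \<noteq> 0"
    if "\<alpha> \<in> S" "\<beta> \<in> S" for \<alpha> \<beta>
  proof (cases "\<alpha> \<noteq> \<beta> \<and> \<alpha> \<bullet> \<beta> \<noteq> 0")
    case False
    have "(reflection \<alpha> \<circ> reflection \<beta>) ^^ 2 = id"
    proof (cases "\<alpha> = \<beta>")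
      case True
      then show ?thesis by (simp add: reflection_comp_self)
    next
      case False
      with \<open>\<not> (\<alpha> \<noteq> \<beta> \<and> \<alpha> \<bullet> \<beta> \<noteq> 0)\<close> have "\<alpha> \<bullet> \<beta> = 0" by simp
      from reflections_commute[OF this] show ?thesis
        by (simp add: fun_eq_iff numeral_2_eq_2 reflection_involution)
    qed
    then have "map_order (reflection \<alpha> \<circ> reflection \<beta>) \<le> 2"
      unfolding map_order_def by (intro Least_le) auto
    with False show ?thesis by simp
  qed (use edge_angle(2) assms that in auto)
  then show ?thesis by (auto simp: coxeter_edges_def)
qed

text \<open>If every vertex had two neighbours, each unit root would have inner product at most 1 -
  2 / 2 = 0 with the sum of all unit roots. That sum would vanish, contrary to independence. The
  vector \<open>u\<close> stands for the only possible neighbour.\<close>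

lemma leaf:
  assumes "S \<subseteq> \<Delta>" "S \<noteq> {}"
  obtains v u where "v \<in> S" "\<And>w. w \<in> S \<Longrightarrow> w \<noteq> v \<Longrightarrow> w \<noteq> u \<Longrightarrow> w \<bullet> v = 0"
proof -
  have fin: "finite S" using assms(1) finite_simple finite_subset by blast
  define N where "N = (\<lambda>v. {w \<in> S. w \<noteq> v \<and> w \<bullet> v \<noteq> 0})"
  have "\<exists>v\<in>S. card (N v) \<le> 1"
  proof (rule ccontr)
    assume "\<not> ?thesis"
    then have two: "card (N v) \<ge> 2" if "v \<in> S" for v using that by force
    have row: "(\<Sum>w\<in>S. sgn v \<bullet> sgn w) \<le> 0" if "v \<in> S" for v
    proof -
      have v: "v \<in> \<Delta>" "v \<noteq> 0" using that assms(1) simple_nonzero by auto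
      have "(\<Sum>w\<in>S. sgn v \<bullet> sgn w) \<le> (\<Sum>w\<in>S. (if w = v then 1 else 0) + (if w \<in> N v then - (1/2) else 0))"
      proof (rule sum_mono)
        fix w assume w: "w \<in> S"
        consider "w = v" | "w \<in> N v" "w \<noteq> v" | "w \<notin> N v" "w \<noteq> v" by blast
        then show "sgn v \<bullet> sgn w \<le> (if w = v then 1 else 0) + (if w \<in> N v then - (1/2) else 0)"
        proof cases
          case 1
          then show ?thesis using v by (simp add: dot_square_norm norm_sgn N_def)
        next
          case 2
          then show ?thesis
            using edge_angle(1)[of v w] v w assms(1) by (auto simp: N_def inner_commute)
        next
          case 3
          then show ?thesis using w by (simp add: N_def sgn_div_norm inner_commute)
        qed
      qed
      also have "\<dots> = 1 - card (N v) / 2"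
      proof -
        have "S \<inter> N v = N v" by (auto simp: N_def)
        then show ?thesis using fin that by (simp add: sum.distrib sum.If_cases)
      qed
      also have "\<dots> \<le> 0" using two[OF that] by simp
      finally show ?thesis .
    qed
    define z where "z = (\<Sum>v\<in>S. sgn v)"
    have "z \<bullet> z = (\<Sum>v\<in>S. \<Sum>w\<in>S. sgn v \<bullet> sgn w)"
      unfolding z_def inner_sum_left inner_sum_right by (rule sum.swap)
    also have "\<dots> \<le> 0" using row by (rule sum_nonpos)
    finally have "z = 0" by (metis inner_ge_zero inner_eq_zero_iff order_antisym)
    then have "(\<Sum>v\<in>S. (1 / norm v) *\<^sub>R v) = 0" by (simp add: z_def sgn_div_norm inverse_eq_divide)
    moreover obtain v where v: "v \<in> S" using assms(2) by blast
    ultimately have "1 / norm v = 0"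
      using independentD[OF indep fin assms(1), where u = "\<lambda>v. 1 / norm v" and v = v] by simp
    with v assms(1) simple_nonzero show False by auto
  qed
  then obtain v where v: "v \<in> S" "card (N v) \<le> 1" by blast
  have "finite (N v)" using fin by (simp add: N_def)
  then have "\<exists>u. N v \<subseteq> {u}"
    using v(2) by (cases "card (N v)") (auto simp: card_1_singleton_iff le_Suc_eq)
  then obtain u where "N v \<subseteq> {u}" by blast
  with v(1) that[of v u] show thesis by (auto simp: N_def)
qed

text \<open>Rotation brings a leaf to the front of both lists; the rests are equivalent by
  induction, and a letter with at most one neighbour can be put back in front.\<close>

lemma orderings_shift_equiv:
  assumes "set L \<subseteq> \<Delta>" "set M = set L" "distinct L" "distinct M"
  shows "shift_equiv L M"
  using assms
proof (induction "length L" arbitrary: L M)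
  case 0
  then show ?case by (simp add: shift_equiv.equiv_refl)
next
  case (Suc n)
  then have "set L \<noteq> {}" by auto
  then obtain v u where
    v: "v \<in> set L" "\<And>w. w \<in> set L \<Longrightarrow> w \<noteq> v \<Longrightarrow> w \<noteq> u \<Longrightarrow> w \<bullet> v = 0"
    using leaf[OF Suc.prems(1)] by metis
  obtain L1 L2 where L: "L = L1 @ v # L2" using split_list[OF v(1)] by blast
  have "v \<in> set M" using v(1) Suc.prems(2) by simp
  from split_list[OF this] obtain M1 M2 where M: "M = M1 @ v # M2" by blast
  have "shift_equiv (L2 @ L1) (M2 @ M1)"
    using Suc.hyps(2) Suc.prems unfolding L M by (intro Suc.hyps(1)) (auto 0 3)
  moreover have "distinct (L2 @ L1)" using Suc.prems(3) by (auto simp: L)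
  moreover have "\<alpha> \<bullet> v = 0" if "\<alpha> \<in> set (L2 @ L1)" "\<alpha> \<noteq> u" for \<alpha>
    using v(2)[of \<alpha>] that Suc.prems(3) by (auto simp: L)
  ultimately have "shift_equiv (v # L2 @ L1) (v # M2 @ M1)"
    by (rule shift_equiv_Cons)
  with shift_equiv_append[of L1 "v # L2"] shift_equiv_append[of "v # M2" M1]
  show ?case unfolding L M by (auto intro: shift_equiv.equiv_trans)
qed

lemma coxeter_number_eq:
  assumes "set L = \<Delta>" "distinct L"
  shows "coxeter_number \<Delta> = map_order (word L)"
proof -
  define M where "M = (SOME L. distinct L \<and> set L = \<Delta>)"
  have "distinct M \<and> set M = \<Delta>"
    unfolding M_def by (rule someI[of _ L]) (simp add: assms)
  then have "shift_equiv M L" using assms by (intro orderings_shift_equiv) auto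
  from shift_equiv_map_order[OF this] show ?thesis
    by (simp add: coxeter_number_def coxeter_element_def M_def word_def)
qed

text \<open>A leaf joins the class that does not contain its possible neighbour
  \<open>u\<close>.\<close>

lemma bipartition:
  assumes "S \<subseteq> \<Delta>"
  shows "\<exists>Y Z. Y \<union> Z = S \<and> Y \<inter> Z = {} \<and>
    (\<forall>b\<in>Y. \<forall>d\<in>Y. b \<noteq> d \<longrightarrow> b \<bullet> d = 0) \<and> (\<forall>b\<in>Z. \<forall>d\<in>Z. b \<noteq> d \<longrightarrow> b \<bullet> d = 0)"
  using assms
proof (induction "card S" arbitrary: S)
  case 0
  then have "S = {}" using finite_simple finite_subset by fastforce
  then show ?case by blast
next
  case (Suc n)
  then have "S \<noteq> {}" by auto
  then obtain v u where
    v: "v \<in> S" "\<And>w. w \<in> S \<Longrightarrow> w \<noteq> v \<Longrightarrow> w \<noteq> u \<Longrightarrow> w \<bullet> v = 0"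
    using leaf[OF Suc.prems] by metis
  have "n = card (S - {v})" using Suc.hyps(2) v(1) by simp
  from Suc.hyps(1)[OF this] Suc.prems obtain Y Z where
    YZ: "Y \<union> Z = S - {v}" "Y \<inter> Z = {}"
      "\<forall>b\<in>Y. \<forall>d\<in>Y. b \<noteq> d \<longrightarrow> b \<bullet> d = 0" "\<forall>b\<in>Z. \<forall>d\<in>Z. b \<noteq> d \<longrightarrow> b \<bullet> d = 0"
    by blast
  have ext: "\<forall>b\<in>insert v T. \<forall>d\<in>insert v T. b \<noteq> d \<longrightarrow> b \<bullet> d = 0"
    if T: "T \<subseteq> S - {v}" "u \<notin> T" "\<forall>b\<in>T. \<forall>d\<in>T. b \<noteq> d \<longrightarrow> b \<bullet> d = 0" for T
  proof (intro ballI impI)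
    have v': "w \<bullet> v = 0" "v \<bullet> w = 0" if "w \<in> T" for w
      using v(2)[of w] that T(1,2) by (auto simp: inner_commute)
    fix b d assume "b \<in> insert v T" "d \<in> insert v T" "b \<noteq> d"
    then consider "b = v" "d \<in> T" | "d = v" "b \<in> T" | "b \<in> T" "d \<in> T" by blast
    then show "b \<bullet> d = 0" using v' T(3) \<open>b \<noteq> d\<close> by cases auto
  qed
  show ?case
  proof (cases "u \<in> Y")
    case True
    then have "\<forall>b\<in>insert v Z. \<forall>d\<in>insert v Z. b \<noteq> d \<longrightarrow> b \<bullet> d = 0"
      using YZ by (intro ext) auto
    moreover have "Y \<union> insert v Z = S" "Y \<inter> insert v Z = {}" using YZ(1,2) v(1) by auto
    ultimately show ?thesis using YZ(3) by blast
  next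
    case False
    then have "\<forall>b\<in>insert v Y. \<forall>d\<in>insert v Y. b \<noteq> d \<longrightarrow> b \<bullet> d = 0"
      using YZ by (intro ext) auto
    moreover have "insert v Y \<union> Z = S" "insert v Y \<inter> Z = {}" using YZ(1,2) v(1) by auto
    ultimately show ?thesis using YZ(4) by blast
  qed
qed

end

section \<open>A positive eigenvector of the Gram matrix\<close>

lemma linear_coefficient_zero:
  fixes c d :: real
  assumes "\<And>s. 2 * s * c + s\<^sup>2 * d \<ge> 0"
  shows "c = 0"
proof (rule ccontr)
  assume "c \<noteq> 0"
  \<comment> \<open>Large enough for the linear term to dominate the quadratic one at the test point
    \<open>- c / D\<close>.\<close>
  define D where "D = \<bar>d\<bar> + 1"
  have D: "D > 0" "d < 2 * D" by (auto simp: D_def)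
  have "2 * (- c / D) * c + (- c / D)\<^sup>2 * d = (c / D)\<^sup>2 * (d - 2 * D)"
    using D by (simp add: field_simps power2_eq_square)
  also have "\<dots> < 0" using D \<open>c \<noteq> 0\<close> by (simp add: mult_less_0_iff)
  finally show False using assms[of "- c / D"] by simp
qed

text \<open>Coefficient families are encoded as vectors of \<open>real^'n\<close> supported on an
  injective image of \<open>I\<close>, whence the bound on \<open>card I\<close>; compactness of the
  unit sphere then provides the minimum.\<close>

lemma norm_combination_minimizer:
  fixes g :: "'i \<Rightarrow> real^'n"
  assumes "finite I" "I \<noteq> {}" "card I \<le> CARD('n)"
  obtains x where "(\<Sum>i\<in>I. (x i)\<^sup>2) = 1"
    "\<And>y. (\<Sum>i\<in>I. (y i)\<^sup>2) = 1 \<Longrightarrow> norm (\<Sum>i\<in>I. x i *\<^sub>R g i) \<le> norm (\<Sum>i\<in>I. y i *\<^sub>R g i)"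
proof -
  obtain e :: "'i \<Rightarrow> 'n" where e: "inj_on e I"
    using assms by (metis card_le_inj finite_class.finite_UNIV)
  define h where "h = (\<lambda>v::real^'n. \<Sum>i\<in>I. (v $ e i) *\<^sub>R g i)"
  define K where "K = {v::real^'n. norm v = 1} \<inter> {v. \<forall>j\<in>- e ` I. v $ j = 0}"
  have normK: "(norm v)\<^sup>2 = (\<Sum>i\<in>I. (v $ e i)\<^sup>2)" if "\<forall>j\<in>- e ` I. v $ j = 0" for v :: "real^'n"
  proof -
    have "(norm v)\<^sup>2 = (\<Sum>j\<in>UNIV. (v $ j)\<^sup>2)"
      by (simp add: norm_vec_def L2_set_def sum_nonneg)
    also have "\<dots> = (\<Sum>j\<in>e ` I. (v $ j)\<^sup>2)"
      using that by (intro sum.mono_neutral_right) auto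
    also have "\<dots> = (\<Sum>i\<in>I. (v $ e i)\<^sup>2)" by (simp add: sum.reindex[OF e])
    finally show ?thesis .
  qed
  define f where "f = (\<lambda>y::'i \<Rightarrow> real. (\<chi> j. if j \<in> e ` I then y (the_inv_into I e j) else 0) :: real^'n)"
  have f: "f y $ e i = y i" if "i \<in> I" for y i
    using that e by (simp add: f_def the_inv_into_f_f)
  have fK: "f y \<in> K" if "(\<Sum>i\<in>I. (y i)\<^sup>2) = 1" for y
  proof -
    have 0: "\<forall>j\<in>- e ` I. f y $ j = 0" by (simp add: f_def)
    have "(norm (f y))\<^sup>2 = 1" unfolding normK[OF 0] using that f by simp
    then have "norm (f y) = 1" by (simp add: power2_eq_1_iff) (smt (verit) norm_ge_zero)
    with 0 show ?thesis by (simp add: K_def)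
  qed
  have "closed {v::real^'n. \<forall>j\<in>- e ` I. v $ j = 0}"
  proof -
    have "{v::real^'n. \<forall>j\<in>- e ` I. v $ j = 0} = (\<Inter>j\<in>- e ` I. {v. v $ j = 0})" by auto
    then show ?thesis by (auto intro!: closed_INT closed_Collect_eq continuous_intros)
  qed
  moreover have "compact {v::real^'n. norm v = 1}"
    using compact_sphere[of "0::real^'n" 1] by (simp add: sphere_def dist_norm)
  ultimately have "compact K" unfolding K_def by blast
  moreover have "K \<noteq> {}"
  proof -
    obtain i where "i \<in> I" using assms(2) by blast
    have "(\<Sum>k\<in>I. ((if k = i then 1 else 0) :: real)\<^sup>2) = (\<Sum>k\<in>I. if k = i then 1 else 0)"
      by (intro sum.cong) auto
    also have "\<dots> = 1" using \<open>i \<in> I\<close> assms(1) by simp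
    finally show ?thesis using fK[of "\<lambda>k. if k = i then 1 else 0"] by blast
  qed
  moreover have "continuous_on K (\<lambda>v. norm (h v))"
    unfolding h_def by (intro continuous_intros)
  ultimately obtain v where v: "v \<in> K" "\<And>w. w \<in> K \<Longrightarrow> norm (h v) \<le> norm (h w)"
    using continuous_attains_inf[of K "\<lambda>v. norm (h v)"] by blast
  show thesis
  proof (rule that[of "\<lambda>i. v $ e i"])
    show "(\<Sum>i\<in>I. (v $ e i)\<^sup>2) = 1"
      using normK[of v] v(1) by (auto simp: K_def)
    fix y :: "'i \<Rightarrow> real" assume "(\<Sum>i\<in>I. (y i)\<^sup>2) = 1"
    from v(2)[OF fK[OF this]] show "norm (\<Sum>i\<in>I. (v $ e i) *\<^sub>R g i) \<le> norm (\<Sum>i\<in>I. y i *\<^sub>R g i)"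
      using f by (simp add: h_def)
  qed
qed

text \<open>Perron--Frobenius for the Gram matrix: replacing the coefficients of a minimizer by
  their absolute values does not increase the norm, as distinct vectors meet at obtuse
  angles.\<close>

lemma positive_gram_eigenvector:
  fixes g :: "'i \<Rightarrow> real^'n"
  assumes fin: "finite I" "I \<noteq> {}" "card I \<le> CARD('n)"
    and obtuse: "\<And>i j. i \<in> I \<Longrightarrow> j \<in> I \<Longrightarrow> i \<noteq> j \<Longrightarrow> g i \<bullet> g j \<le> 0"
    and conn: "\<And>A. A \<subseteq> I \<Longrightarrow> A \<noteq> {} \<Longrightarrow> A \<noteq> I \<Longrightarrow> \<exists>i\<in>A. \<exists>j\<in>I - A. g i \<bullet> g j \<noteq> 0"
    and indep: "\<And>x. (\<Sum>i\<in>I. x i *\<^sub>R g i) = 0 \<Longrightarrow> \<forall>i\<in>I. x i = 0"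
  shows "\<exists>x \<mu>. \<mu> > 0 \<and> (\<forall>i\<in>I. x i > 0) \<and> (\<forall>i\<in>I. (\<Sum>j\<in>I. x j * (g i \<bullet> g j)) = \<mu> * x i)"
proof -
  define V where "V = (\<lambda>x. \<Sum>i\<in>I. x i *\<^sub>R g i)"
  from norm_combination_minimizer[OF fin, of g] obtain x0 where
    x0: "(\<Sum>i\<in>I. (x0 i)\<^sup>2) = 1" and
    min0: "\<And>y. (\<Sum>i\<in>I. (y i)\<^sup>2) = 1 \<Longrightarrow> norm (V x0) \<le> norm (V y)"
    unfolding V_def by blast
  have sq: "V y \<bullet> V y = (\<Sum>i\<in>I. \<Sum>j\<in>I. y i * y j * (g i \<bullet> g j))" for y
    unfolding V_def inner_sum_left
    by (simp add: inner_sum_right mult_ac)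
  define x where "x = (\<lambda>i. \<bar>x0 i\<bar>)"
  have x1: "(\<Sum>i\<in>I. (x i)\<^sup>2) = 1" using x0 by (simp add: x_def)
  define \<mu> where "\<mu> = V x \<bullet> V x"
  have "\<mu> \<le> V x0 \<bullet> V x0"
    unfolding \<mu>_def sq
  proof (intro sum_mono)
    fix i j assume ij: "i \<in> I" "j \<in> I"
    show "x i * x j * (g i \<bullet> g j) \<le> x0 i * x0 j * (g i \<bullet> g j)"
    proof (cases "i = j")
      case False
      with obtuse[OF ij] show ?thesis
        unfolding x_def abs_mult[symmetric] by (intro mult_right_mono_neg) auto
    qed (simp add: x_def)
  qed
  then have min: "\<mu> \<le> V y \<bullet> V y" if "(\<Sum>i\<in>I. (y i)\<^sup>2) = 1" for y
    using min0[OF that] by (smt (verit) norm_le)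
  have min': "\<mu> * (\<Sum>i\<in>I. (y i)\<^sup>2) \<le> V y \<bullet> V y" for y
  proof (cases "(\<Sum>i\<in>I. (y i)\<^sup>2) = 0")
    case False
    define r where "r = sqrt (\<Sum>i\<in>I. (y i)\<^sup>2)"
    have r: "r > 0" "r\<^sup>2 = (\<Sum>i\<in>I. (y i)\<^sup>2)"
      using False by (simp_all add: r_def sum_nonneg less_le)
    have "(\<Sum>i\<in>I. (y i / r)\<^sup>2) = (\<Sum>i\<in>I. (y i)\<^sup>2) / r\<^sup>2"
      by (simp add: power_divide sum_divide_distrib)
    also have "\<dots> = 1" unfolding r(2)[symmetric] using r(1) by simp
    finally have "\<mu> \<le> V (\<lambda>i. y i / r) \<bullet> V (\<lambda>i. y i / r)" by (rule min)
    also have "V (\<lambda>i. y i / r) = (1 / r) *\<^sub>R V y"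
      by (simp add: V_def scaleR_sum_right)
    finally show ?thesis using r by (simp add: field_simps power2_eq_square)
  qed simp
  have eig: "(\<Sum>j\<in>I. x j * (g i \<bullet> g j)) = \<mu> * x i" if i: "i \<in> I" for i
  proof -
    \<comment> \<open>The minimizer is compared with itself after adding \<open>s\<close> to its
      coefficient at \<open>i\<close>. The inequality holds for all \<open>s\<close>, so the linear
      term vanishes, and this is the eigenvector equation.\<close>
    have "2 * s * (g i \<bullet> V x - \<mu> * x i) + s\<^sup>2 * (g i \<bullet> g i - \<mu>) \<ge> 0" for s
    proof -
      define y where "y = (\<lambda>j. x j + (if j = i then s else 0))"
      have "V y = V x + (\<Sum>j\<in>I. if j = i then s *\<^sub>R g i else 0)"
        unfolding V_def y_def sum.distrib[symmetric]
        by (intro sum.cong) (auto simp: scaleR_left_distrib)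
      then have Vy: "V y = V x + s *\<^sub>R g i" using i fin by simp
      have "(\<Sum>j\<in>I. (y j)\<^sup>2) = (\<Sum>j\<in>I. (x j)\<^sup>2) + (\<Sum>j\<in>I. if j = i then 2 * s * x i + s\<^sup>2 else 0)"
        unfolding y_def sum.distrib[symmetric]
        by (intro sum.cong) (auto simp: power2_eq_square algebra_simps)
      then have "(\<Sum>j\<in>I. (y j)\<^sup>2) = 1 + 2 * s * x i + s\<^sup>2" using i fin x1 by simp
      with min'[of y] have "\<mu> * (1 + 2 * s * x i + s\<^sup>2) \<le> (V x + s *\<^sub>R g i) \<bullet> (V x + s *\<^sub>R g i)"
        by (simp add: Vy)
      also have "\<dots> = \<mu> + 2 * s * (g i \<bullet> V x) + s\<^sup>2 * (g i \<bullet> g i)"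
        by (simp add: \<mu>_def inner_add_left inner_add_right inner_commute power2_eq_square)
      finally show ?thesis by (simp add: algebra_simps)
    qed
    then have "g i \<bullet> V x - \<mu> * x i = 0" by (rule linear_coefficient_zero)
    then show ?thesis by (simp add: V_def inner_sum_right)
  qed
  have nonneg: "x i \<ge> 0" for i by (simp add: x_def)
  \<comment> \<open>At an index where \<open>x\<close> vanishes, all terms of the eigenvector
    equation have the same sign and add up to zero. So this set is joined to nothing outside it, and
    connectedness makes it empty.\<close>
  define A where "A = {i \<in> I. x i = 0}"
  have "A = {}"
  proof (rule ccontr)
    assume "A \<noteq> {}"
    moreover have "A \<noteq> I"
    proof
      assume "A = I"
      then have "(\<Sum>i\<in>I. (x i)\<^sup>2) = 0" by (intro sum.neutral) (auto simp: A_def)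
      with x1 show False by simp
    qed
    ultimately obtain i j where ij: "i \<in> A" "j \<in> I - A" "g i \<bullet> g j \<noteq> 0"
      using conn[of A] by (auto simp: A_def)
    have "(\<Sum>j\<in>I. - (x j * (g i \<bullet> g j))) = 0"
      using eig[of i] ij(1) by (simp add: sum_negf A_def)
    moreover have "- (x k * (g i \<bullet> g k)) \<ge> 0" if "k \<in> I" for k
      using obtuse[of i k] that ij(1) nonneg[of k]
      by (cases "k = i") (auto simp: A_def mult_nonneg_nonpos)
    ultimately have "- (x j * (g i \<bullet> g j)) = 0"
      using ij(2) sum_nonneg_eq_0_iff[OF fin(1), of "\<lambda>j. - (x j * (g i \<bullet> g j))"] by blast
    with ij show False by (auto simp: A_def)
  qed
  then have pos: "x i > 0" if "i \<in> I" for i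
    using nonneg[of i] that by (force simp: A_def)
  have "V x \<noteq> 0"
    using indep[of x] pos fin(2) unfolding V_def by force
  then have "\<mu> > 0" by (simp add: \<mu>_def)
  with pos eig show ?thesis by blast
qed

context simple_system
begin

text \<open>Rank one is done by hand because the plane argument wants two nonempty classes.
  Otherwise the eigenvalue \<mu> splits into 1 from the diagonal and \<mu> - 1 from the other class,
  which identifies 1 - \<mu> with cos \<theta>.\<close>

lemma card_irreducible:
  assumes "\<Delta> \<noteq> {}"
    and conn: "\<And>A. A \<subseteq> \<Delta> \<Longrightarrow> A \<noteq> {} \<Longrightarrow> A \<noteq> \<Delta> \<Longrightarrow> \<exists>\<alpha>\<in>A. \<exists>\<beta>\<in>\<Delta> - A. \<alpha> \<bullet> \<beta> \<noteq> 0"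
  shows "coxeter_number \<Delta> > 0" "card R = coxeter_number \<Delta> * card \<Delta>"
proof -
  have "coxeter_number \<Delta> > 0 \<and> card R = coxeter_number \<Delta> * card \<Delta>"
  proof (cases "\<exists>\<gamma>. \<Delta> = {\<gamma>}")
    case True
    then obtain \<gamma> where \<gamma>: "\<Delta> = {\<gamma>}" by blast
    have \<gamma>0: "\<gamma> \<noteq> 0" "\<gamma> \<in> R" using simple_nonzero simple_in \<gamma> by auto
    have \<gamma>_neg: "\<gamma> \<noteq> - \<gamma>"
    proof
      assume "\<gamma> = - \<gamma>"
      then have "t \<bullet> \<gamma> = - (t \<bullet> \<gamma>)" by (metis inner_minus_right)
      with regular[OF \<gamma>0(2)] show False by simp
    qed
    have "reflection \<gamma> \<noteq> id"
    proof
      assume "reflection \<gamma> = id"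
      then have "- \<gamma> = \<gamma>" using reflection_self[of \<gamma>] by simp
      with \<gamma>_neg show False by simp
    qed
    then have "map_order (word [\<gamma>]) = 2"
      by (intro map_order_eqI)
        (auto simp: numeral_2_eq_2 reflection_comp_self less_Suc_eq)
    then have cn: "coxeter_number \<Delta> = 2" using coxeter_number_eq[of "[\<gamma>]"] \<gamma> by simp
    have "R = {\<gamma>, - \<gamma>}"
    proof
      show "{\<gamma>, - \<gamma>} \<subseteq> R" using \<gamma>0 minus_closed by simp
      show "R \<subseteq> {\<gamma>, - \<gamma>}"
      proof
        fix \<alpha> assume "\<alpha> \<in> R"
        with root_in_span[of \<alpha>] obtain a where "\<alpha> = a *\<^sub>R \<gamma>"
          unfolding \<gamma> span_singleton by auto
        with reduced[OF \<gamma>0(2), of a] \<open>\<alpha> \<in> R\<close> show "\<alpha> \<in> {\<gamma>, - \<gamma>}" by auto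
      qed
    qed
    then show ?thesis using cn \<gamma> \<gamma>_neg by simp
  next
    case False
    obtain Y Z where YZ: "Y \<union> Z = \<Delta>" "Y \<inter> Z = {}"
      "\<forall>b\<in>Y. \<forall>d\<in>Y. b \<noteq> d \<longrightarrow> b \<bullet> d = 0" "\<forall>b\<in>Z. \<forall>d\<in>Z. b \<noteq> d \<longrightarrow> b \<bullet> d = 0"
      using bipartition[of \<Delta>] by blast
    have nb: "\<exists>d\<in>\<Delta>. d \<noteq> b \<and> b \<bullet> d \<noteq> 0" if "b \<in> \<Delta>" for b
      using conn[of "{b}"] that False by auto
    obtain b0 where b0: "b0 \<in> \<Delta>" using assms(1) by blast
    from nb[OF b0] obtain d0 where d0: "d0 \<in> \<Delta>" "d0 \<noteq> b0" "b0 \<bullet> d0 \<noteq> 0" by blast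
    have "Y \<noteq> {}"
    proof
      assume "Y = {}"
      with YZ(1) b0 d0(1) have "b0 \<in> Z" "d0 \<in> Z" by auto
      with YZ(4) d0(2,3) show False by metis
    qed
    have "Z \<noteq> {}"
    proof
      assume "Z = {}"
      with YZ(1) b0 d0(1) have "b0 \<in> Y" "d0 \<in> Y" by auto
      with YZ(3) d0(2,3) show False by metis
    qed
    have fin: "finite Y" "finite Z" using YZ(1) finite_simple by auto
    have nz: "sgn b \<bullet> sgn d = 0 \<longleftrightarrow> b \<bullet> d = 0" if "b \<in> \<Delta>" "d \<in> \<Delta>" for b d
      using simple_nonzero that by (simp add: sgn_div_norm)
    have dim: "card \<Delta> \<le> CARD('n)"
      using independent_bound[OF indep] by simp
    have obt: "sgn i \<bullet> sgn j \<le> 0" if "i \<in> \<Delta>" "j \<in> \<Delta>" "i \<noteq> j" for i j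
      using obtuse[OF that] by (simp add: sgn_div_norm mult_nonneg_nonpos divide_nonpos_nonneg)
    have con: "\<exists>i\<in>A. \<exists>j\<in>\<Delta> - A. sgn i \<bullet> sgn j \<noteq> 0" if "A \<subseteq> \<Delta>" "A \<noteq> {}" "A \<noteq> \<Delta>" for A
      using conn[OF that] nz that(1) by blast
    have ind: "\<forall>i\<in>\<Delta>. x i = 0" if "(\<Sum>i\<in>\<Delta>. x i *\<^sub>R sgn i) = 0" for x
    proof -
      have "(\<Sum>i\<in>\<Delta>. (x i / norm i) *\<^sub>R i) = 0"
        using that by (simp add: sgn_div_norm divide_inverse)
      then have "x i / norm i = 0" if "i \<in> \<Delta>" for i
        using independentD[OF indep finite_simple subset_refl, where u = "\<lambda>i. x i / norm i" and v = i] that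
        by simp
      then show ?thesis using simple_nonzero by auto
    qed
    obtain x \<mu> where x: "\<mu> > 0" "\<And>i. i \<in> \<Delta> \<Longrightarrow> x i > 0"
      "\<And>i. i \<in> \<Delta> \<Longrightarrow> (\<Sum>j\<in>\<Delta>. x j * (sgn i \<bullet> sgn j)) = \<mu> * x i"
      using positive_gram_eigenvector[OF finite_simple assms(1) dim obt con ind] by blast
    have part: "(\<Sum>d\<in>T. x d * (sgn b \<bullet> sgn d)) = (\<mu> - 1) * x b"
      if "b \<in> S" "S \<union> T = \<Delta>" "S \<inter> T = {}" "\<forall>b\<in>S. \<forall>d\<in>S. b \<noteq> d \<longrightarrow> b \<bullet> d = 0" for b S T
    proof -
      have b: "b \<in> \<Delta>" "b \<noteq> 0" and fST: "finite S" "finite T"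
        using that simple_nonzero finite_simple by (auto intro: finite_subset)
      have "(\<Sum>d\<in>S. x d * (sgn b \<bullet> sgn d)) = (\<Sum>d\<in>S. if d = b then x b else 0)"
        using that b nz by (intro sum.cong) (auto simp: dot_square_norm norm_sgn)
      also have "\<dots> = x b" using fST that by simp
      finally show ?thesis
        using x(3)[OF b(1)] sum.union_disjoint[OF fST that(3), of "\<lambda>d. x d * (sgn b \<bullet> sgn d)"] that(2)
        by (simp add: algebra_simps)
    qed
    \<comment> \<open>Some edge leaves \<open>b\<close>, so the sum over the other class is
      negative; this brings \<theta> into the range that the plane argument requires.\<close>
    have "\<mu> < 1"
    proof -
      obtain b where b: "b \<in> Y" "b \<in> \<Delta>" using \<open>Y \<noteq> {}\<close> YZ by blast
      from nb[OF b(2)] obtain d where d': "d \<in> \<Delta>" "d \<noteq> b" "b \<bullet> d \<noteq> 0" by blast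
      have "d \<notin> Y" using YZ(3) b(1) d'(2,3) by metis
      with d' YZ(1) have d: "d \<in> Z" "d \<in> \<Delta>" "b \<noteq> d" "b \<bullet> d \<noteq> 0" by auto
      have "(\<Sum>d\<in>Z. x d * (sgn b \<bullet> sgn d)) < 0"
      proof -
        have le: "x e * (sgn b \<bullet> sgn e) \<le> 0" if "e \<in> Z" for e
        proof -
          have e: "e \<in> \<Delta>" "e \<noteq> b" using that YZ b by auto
          have "sgn b \<bullet> sgn e \<le> 0"
            using obtuse[of b e] e b by (simp add: sgn_div_norm mult_nonneg_nonpos divide_nonpos_nonneg)
          then show ?thesis using x(2)[OF e(1)] by (simp add: mult_nonneg_nonpos)
        qed
        have "x d * (sgn b \<bullet> sgn d) \<noteq> 0" using x(2)[OF d(2)] nz[OF b(2) d(2)] d(4) by simp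
        with le[OF d(1)] have "x d * (sgn b \<bullet> sgn d) < 0" by linarith
        with le d(1) fin(2) show ?thesis
          using sum_strict_mono_ex1[of Z "\<lambda>d. x d * (sgn b \<bullet> sgn d)" "\<lambda>_. 0"] by auto
      qed
      then show ?thesis
        unfolding part[OF b(1) YZ(1-3)] using x(2)[OF b(2)] by (simp add: mult_less_0_iff)
    qed
    define \<theta> where "\<theta> = arccos (1 - \<mu>)"
    have cos\<theta>: "cos \<theta> = 1 - \<mu>" using x(1) \<open>\<mu> < 1\<close> by (simp add: \<theta>_def)
    have \<theta>: "0 < \<theta>" "\<theta> \<le> pi / 2"
      using arccos_lt_bounded[of "1 - \<mu>"] arccos_less_arccos[of 0 "1 - \<mu>"] x(1) \<open>\<mu> < 1\<close>
      by (auto simp: \<theta>_def)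
    have YZ': "Z \<union> Y = \<Delta>" "Z \<inter> Y = {}" using YZ by auto
    have eigY: "(\<Sum>d\<in>Z. x d * (sgn b \<bullet> sgn d)) = - cos \<theta> * x b" if "b \<in> Y" for b
      unfolding part[OF that YZ(1-3)] cos\<theta> by simp
    have eigZ: "(\<Sum>d\<in>Y. x d * (sgn b \<bullet> sgn d)) = - cos \<theta> * x b" if "b \<in> Z" for b
      unfolding part[OF that YZ' YZ(4)] cos\<theta> by simp
    have orthY: "b \<bullet> d = 0" if "b \<in> Y" "d \<in> Y" "b \<noteq> d" for b d using YZ(3) that by blast
    have orthZ: "b \<bullet> d = 0" if "b \<in> Z" "d \<in> Z" "b \<noteq> d" for b d using YZ(4) that by blast
    obtain K L where K: "K \<ge> 2" "set L = \<Delta>" "distinct L"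
      "map_order (word L) = K" "card R = K * card \<Delta>"
      using coxeter_plane[OF YZ(1,2) \<open>Y \<noteq> {}\<close> \<open>Z \<noteq> {}\<close> orthY orthZ x(2) \<theta> eigY eigZ] by blast
    with coxeter_number_eq[OF K(2,3)] show ?thesis by simp
  qed
  then show "coxeter_number \<Delta> > 0" "card R = coxeter_number \<Delta> * card \<Delta>" by blast+
qed

end

subsection \<open>The invariant operator of a root system\<close>

context simple_system
begin

text \<open>The summands are the orthogonal projections onto the lines of the roots. Hence the
  operator is symmetric, commutes with the reflections, and has a trace that counts roots.\<close>

definition frame :: "real^'n \<Rightarrow> real^'n" where
  "frame v = (\<Sum>\<alpha>\<in>R. ((\<alpha> \<bullet> v) / (\<alpha> \<bullet> \<alpha>)) *\<^sub>R \<alpha>)"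

lemma linear_frame: "linear frame"
  by (rule linearI)
    (simp_all add: frame_def inner_add_right add_divide_distrib scaleR_left_distrib
      sum.distrib scaleR_sum_right)

lemma frame_inner: "frame v \<bullet> w = v \<bullet> frame w"
  by (simp add: frame_def inner_sum_left inner_sum_right inner_commute mult_ac)

lemma frame_reflection:
  assumes "\<beta> \<in> R"
  shows "frame (reflection \<beta> v) = reflection \<beta> (frame v)"
proof -
  have "bij_betw (reflection \<beta>) R R"
    by (rule bij_betw_byWitness[of _ "reflection \<beta>"])
      (auto simp: reflection_involution reflection_closed assms)
  then have "frame (reflection \<beta> v) =
      (\<Sum>\<alpha>\<in>R. ((reflection \<beta> \<alpha> \<bullet> reflection \<beta> v) / (reflection \<beta> \<alpha> \<bullet> reflection \<beta> \<alpha>)) *\<^sub>R reflection \<beta> \<alpha>)"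
    unfolding frame_def by (rule sum.reindex_bij_betw[symmetric])
  also have "\<dots> = reflection \<beta> (frame v)"
    by (simp add: frame_def linear_sum[OF linear_reflection] linear_scale[OF linear_reflection])
  finally show ?thesis .
qed

text \<open>Commuting with \<open>reflection \<beta>\<close>, which negates \<beta>, the operator
  sends \<beta> to a vector that is negated too, and such vectors lie on the line of
  \<beta>.\<close>

lemma frame_root:
  assumes "\<beta> \<in> R"
  obtains a where "frame \<beta> = a *\<^sub>R \<beta>"
proof -
  have "reflection \<beta> (frame \<beta>) = - frame \<beta>"
    using frame_reflection[OF assms, of \<beta>] by (simp add: linear_neg[OF linear_frame])
  then have "2 *\<^sub>R frame \<beta> = (2 * (\<beta> \<bullet> frame \<beta>) / (\<beta> \<bullet> \<beta>)) *\<^sub>R \<beta>"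
    by (simp add: reflection_def scaleR_2 algebra_simps)
  then have "(1 / 2) *\<^sub>R 2 *\<^sub>R frame \<beta> = (1 / 2) *\<^sub>R (2 * (\<beta> \<bullet> frame \<beta>) / (\<beta> \<bullet> \<beta>)) *\<^sub>R \<beta>"
    by (rule arg_cong)
  then have "frame \<beta> = ((1 / 2) * (2 * (\<beta> \<bullet> frame \<beta>) / (\<beta> \<bullet> \<beta>))) *\<^sub>R \<beta>"
    by simp
  with that show thesis by blast
qed

lemma word_in_span:
  assumes "C \<subseteq> \<Delta>" "\<And>\<alpha> \<gamma>. \<alpha> \<in> C \<Longrightarrow> \<gamma> \<in> \<Delta> - C \<Longrightarrow> \<alpha> \<bullet> \<gamma> = 0"
    and "v \<in> span C" "set L \<subseteq> \<Delta>"
  shows "word L v \<in> span C"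
  using assms(4)
proof (induction L)
  case (Cons \<gamma> L)
  then have IH: "word L v \<in> span C" by simp
  show ?case
  proof (cases "\<gamma> \<in> C")
    case True
    with IH show ?thesis by (simp add: reflection_def span_diff span_scale span_base)
  next
    case False
    have "orthogonal \<gamma> (word L v)"
      using assms(2) False Cons.prems
      by (intro orthogonal_to_span[OF IH]) (simp add: orthogonal_def inner_commute)
    with IH show ?thesis by (simp add: reflection_orthogonal orthogonal_def)
  qed
qed (simp add: assms(3))

text \<open>A root arises from a simple root by simple reflections, and these preserve both
  \<open>span C\<close> and the span of \<open>\<Delta> - C\<close>. So each root lies in one of two
  orthogonal spans.\<close>

lemma root_in_or_orthogonal:
  assumes "C \<subseteq> \<Delta>" "\<And>\<alpha> \<gamma>. \<alpha> \<in> C \<Longrightarrow> \<gamma> \<in> \<Delta> - C \<Longrightarrow> \<alpha> \<bullet> \<gamma> = 0" "\<alpha> \<in> R" "\<alpha> \<notin> span C"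
    and "v \<in> span C"
  shows "\<alpha> \<bullet> v = 0"
proof -
  obtain L \<beta> where L: "set L \<subseteq> \<Delta>" "\<beta> \<in> \<Delta>" "\<alpha> = word L \<beta>"
    using conjugate_to_simple[OF assms(3)] by blast
  have "\<beta> \<in> \<Delta> - C"
    using word_in_span[OF assms(1,2) span_base L(1)] L assms(4) by blast
  have "\<gamma> \<bullet> \<delta> = 0" if "\<gamma> \<in> \<Delta> - C" "\<delta> \<in> \<Delta> - (\<Delta> - C)" for \<gamma> \<delta>
    using assms(2)[of \<delta> \<gamma>] that by (simp add: inner_commute)
  from word_in_span[OF Diff_subset this span_base[OF \<open>\<beta> \<in> \<Delta> - C\<close>] L(1)]
  have D: "\<alpha> \<in> span (\<Delta> - C)" by (simp add: L(3))
  have "orthogonal y v" if "y \<in> \<Delta> - C" for y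
    using assms(2) that
    by (intro orthogonal_to_span[OF assms(5)]) (simp add: orthogonal_def inner_commute)
  then have "orthogonal v \<alpha>"
    by (intro orthogonal_to_span[OF D]) (simp add: orthogonal_commute)
  then show ?thesis by (simp add: orthogonal_def inner_commute)
qed

text \<open>Both sides are the trace of \<open>frame\<close> on \<open>span C\<close>. In an
  orthonormal basis, a root in \<open>span C\<close> contributes 1 by Parseval, and any other root
  is orthogonal to it and contributes 0.\<close>

lemma frame_trace:
  assumes C: "C \<subseteq> \<Delta>" "\<And>\<alpha> \<gamma>. \<alpha> \<in> C \<Longrightarrow> \<gamma> \<in> \<Delta> - C \<Longrightarrow> \<alpha> \<bullet> \<gamma> = 0"
    and a: "\<And>\<beta>. \<beta> \<in> C \<Longrightarrow> frame \<beta> = a *\<^sub>R \<beta>"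
  shows "a * card C = card (R \<inter> span C)"
proof -
  obtain B where B: "B \<subseteq> span C" "pairwise orthogonal B" "\<And>x. x \<in> B \<Longrightarrow> norm x = 1"
    "independent B" "card B = dim (span C)" "span B = span C"
    using orthonormal_basis_subspace[OF subspace_span[of C]] by blast
  have finB: "finite B" using B(4) independent_imp_finite by blast
  have "card B = card C"
    using B(5) dim_span indep independent_mono[OF _ C(1)] dim_eq_card_independent by metis
  have eig: "frame v = a *\<^sub>R v" if "v \<in> span C" for v
    using that
  proof (induction rule: span_induct_alt)
    case base
    then show ?case by (simp add: linear_0[OF linear_frame])
  next
    case (step c x y)
    then show ?case
      by (simp add: linear_add[OF linear_frame] linear_scale[OF linear_frame] a algebra_simps)
  qed
  have parseval: "(\<Sum>b\<in>B. (\<alpha> \<bullet> b)\<^sup>2) = \<alpha> \<bullet> \<alpha>" if "\<alpha> \<in> span C" for \<alpha>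
  proof -
    have "\<alpha> = (\<Sum>b\<in>B. (\<alpha> \<bullet> b) *\<^sub>R b)"
      using orthonormal_basis_expand[OF B(2,3) _ finB] that B(6) by auto
    then have "\<alpha> \<bullet> \<alpha> = \<alpha> \<bullet> (\<Sum>b\<in>B. (\<alpha> \<bullet> b) *\<^sub>R b)" by simp
    also have "\<dots> = (\<Sum>b\<in>B. (\<alpha> \<bullet> b)\<^sup>2)"
      unfolding inner_sum_right by (simp add: power2_eq_square)
    finally show ?thesis by simp
  qed
  have "(\<Sum>b\<in>B. b \<bullet> frame b) = (\<Sum>b\<in>B. a)"
  proof (rule sum.cong[OF refl])
    fix b assume "b \<in> B"
    with B(1) eig[of b] B(3)[of b] show "b \<bullet> frame b = a" by (auto simp: dot_square_norm)
  qed
  also have "\<dots> = a * card C" using \<open>card B = card C\<close> by simp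
  finally have 1: "(\<Sum>b\<in>B. b \<bullet> frame b) = a * card C" .
  have "(\<Sum>b\<in>B. b \<bullet> frame b) = (\<Sum>b\<in>B. \<Sum>\<alpha>\<in>R. (\<alpha> \<bullet> b)\<^sup>2 / (\<alpha> \<bullet> \<alpha>))"
    by (simp add: frame_def inner_sum_right inner_commute power2_eq_square)
  also have "\<dots> = (\<Sum>\<alpha>\<in>R. (\<Sum>b\<in>B. (\<alpha> \<bullet> b)\<^sup>2) / (\<alpha> \<bullet> \<alpha>))"
    by (subst sum.swap) (simp add: sum_divide_distrib)
  also have "\<dots> = (\<Sum>\<alpha>\<in>R. if \<alpha> \<in> span C then 1 else 0)"
  proof (rule sum.cong[OF refl])
    fix \<alpha> assume \<alpha>: "\<alpha> \<in> R"
    show "(\<Sum>b\<in>B. (\<alpha> \<bullet> b)\<^sup>2) / (\<alpha> \<bullet> \<alpha>) = (if \<alpha> \<in> span C then 1 else 0)"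
    proof (cases "\<alpha> \<in> span C")
      case True
      moreover have "\<alpha> \<noteq> 0" using \<alpha> zero_notin by blast
      ultimately show ?thesis by (simp add: parseval)
    next
      case False
      with root_in_or_orthogonal[OF C \<alpha>] B(1) have "\<alpha> \<bullet> b = 0" if "b \<in> B" for b
        using that by blast
      with False show ?thesis by simp
    qed
  qed
  also have "\<dots> = card (R \<inter> span C)"
    using finite_R by (simp add: sum.If_cases)
  finally show ?thesis using 1 by simp
qed

text \<open>Simple roots are eigenvectors by \<open>frame_root\<close>, and symmetry of
  \<open>frame\<close> equates the eigenvalues of joined roots. Comparing the trace with the number
  of roots yields the common value.\<close>

lemma frame_component:
  assumes "C \<in> coxeter_components \<Delta>"
  shows "C \<subseteq> \<Delta>" "C \<noteq> {}" "coxeter_number C > 0"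
    "\<And>\<beta>. \<beta> \<in> C \<Longrightarrow> frame \<beta> = coxeter_number C *\<^sub>R \<beta>"
proof -
  let ?E = "coxeter_edges \<Delta>"
  have E: "(\<alpha>, \<beta>) \<in> ?E \<longleftrightarrow> \<alpha> \<in> \<Delta> \<and> \<beta> \<in> \<Delta> \<and> \<alpha> \<noteq> \<beta> \<and> \<alpha> \<bullet> \<beta> \<noteq> 0" for \<alpha> \<beta>
    using coxeter_edges_eq[OF subset_refl] by auto
  from assms obtain x where x: "x \<in> \<Delta>" "C = ?E\<^sup>* `` {x}"
    unfolding coxeter_components_def quotient_def by blast
  have xC: "x \<in> C" by (simp add: x(2))
  then show ne: "C \<noteq> {}" by blast
  \<comment> \<open>Induction along paths from \<open>x\<close>; it serves the inclusion in
    \<Delta>, the connectedness of \<open>C\<close> and the spreading of the eigenvalue.\<close>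
  have stay: "y \<in> T" if T: "x \<in> T" "\<And>\<alpha> \<beta>. \<alpha> \<in> T \<Longrightarrow> \<alpha> \<in> C \<Longrightarrow> (\<alpha>, \<beta>) \<in> ?E \<Longrightarrow> \<beta> \<in> C \<Longrightarrow> \<beta> \<in> T"
    and y: "y \<in> C" for y T
  proof -
    have "(x, y) \<in> ?E\<^sup>*" using y x(2) by simp
    then show ?thesis
    proof (induction rule: rtrancl_induct)
      case (step y z)
      then have "y \<in> C" "z \<in> C" by (auto simp: x(2))
      with step T(2) show ?case by blast
    qed (rule T(1))
  qed
  show sub: "C \<subseteq> \<Delta>"
    using stay[of \<Delta>] x(1) E by blast
  have closed: "\<alpha> \<bullet> \<gamma> = 0" if "\<alpha> \<in> C" "\<gamma> \<in> \<Delta> - C" for \<alpha> \<gamma>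
  proof (rule ccontr)
    assume "\<alpha> \<bullet> \<gamma> \<noteq> 0"
    with that sub have "(\<alpha>, \<gamma>) \<in> ?E" using E by blast
    with that(1) have "\<gamma> \<in> C" by (auto simp: x(2))
    with that(2) show False by blast
  qed
  have conn: "\<exists>\<alpha>\<in>A. \<exists>\<beta>\<in>C - A. \<alpha> \<bullet> \<beta> \<noteq> 0" if A: "A \<subseteq> C" "A \<noteq> {}" "A \<noteq> C" for A
  proof (rule ccontr)
    assume no: "\<not> ?thesis"
    show False
    proof (cases "x \<in> A")
      case True
      have "C \<subseteq> A"
      proof
        fix y assume "y \<in> C"
        show "y \<in> A"
          by (rule stay[OF True _ \<open>y \<in> C\<close>]) (use no E in blast)
      qed
      with A show False by blast
    next
      case False
      have "C \<subseteq> C - A"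
      proof
        fix y assume y: "y \<in> C"
        have "x \<in> C - A" using False xC by simp
        from this _ y show "y \<in> C - A"
          by (rule stay) (use no E in \<open>metis DiffD2 DiffI inner_commute\<close>)
      qed
      with A show False by blast
    qed
  qed
  interpret S: simple_system "R \<inter> span C" C t
    using sub by (rule subsystem)
  show "coxeter_number C > 0" using S.card_irreducible(1)[OF ne conn] .
  have xR: "\<And>\<beta>. \<beta> \<in> C \<Longrightarrow> \<beta> \<in> R" using sub simple_in by blast
  obtain a where a: "frame x = a *\<^sub>R x" using frame_root[OF xR[OF xC]] by blast
  have all: "frame y = a *\<^sub>R y" if "y \<in> C" for y
  proof -
    have "y \<in> {y. frame y = a *\<^sub>R y}"
    proof (rule stay[OF _ _ that])
      fix \<alpha> \<beta>
      assume *: "\<alpha> \<in> {y. frame y = a *\<^sub>R y}" "(\<alpha>, \<beta>) \<in> ?E" "\<beta> \<in> C"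
      obtain b where b: "frame \<beta> = b *\<^sub>R \<beta>" using frame_root[OF xR[OF *(3)]] by blast
      have "a * (\<alpha> \<bullet> \<beta>) = b * (\<alpha> \<bullet> \<beta>)" using frame_inner[of \<alpha> \<beta>] * b by simp
      with *(2) E have "a = b" by simp
      with b show "\<beta> \<in> {y. frame y = a *\<^sub>R y}" by simp
    qed (simp add: a)
    then show ?thesis by simp
  qed
  have "a * card C = coxeter_number C * card C"
    using frame_trace[OF sub closed all] S.card_irreducible(2)[OF ne conn] by simp
  moreover have "card C > 0" using ne S.finite_simple by (simp add: card_gt_0_iff)
  ultimately have "a = coxeter_number C" by simp
  with all show "\<And>\<beta>. \<beta> \<in> C \<Longrightarrow> frame \<beta> = coxeter_number C *\<^sub>R \<beta>" by simp
qed

lemma in_component: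
  assumes "\<beta> \<in> \<Delta>"
  obtains C where "C \<in> coxeter_components \<Delta>" "\<beta> \<in> C"
  using assms unfolding coxeter_components_def quotient_def by blast

end

subsection \<open>Polynomials on the complexified space\<close>

lemma cdot_add_right: "cdot x (y + z) = cdot x y + cdot x z"
  and cdot_diff_right: "cdot x (y - z) = cdot x y - cdot x z"
  and cdot_scale_right: "cdot x (a *s y) = a * cdot x y"
  and cdot_sum_right: "cdot x (\<Sum>i\<in>I. f i) = (\<Sum>i\<in>I. cdot x (f i))"
  by (simp_all add: cdot_def algebra_simps sum.distrib sum_subtractf sum_distrib_left sum_distrib_right)
    (rule sum.swap)

lemma cdot_cvec: "cdot (cvec a) (cvec b) = complex_of_real (a \<bullet> b)"
  by (simp add: cdot_def cvec_def inner_vec_def)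

lemma cdot_cvec_add: "cdot (cvec (a + b)) x = cdot (cvec a) x + cdot (cvec b) x"
  and cdot_cvec_scale: "cdot (cvec (r *\<^sub>R a)) x = of_real r * cdot (cvec a) x"
  and cdot_cvec_minus: "cdot (cvec (- a)) x = - cdot (cvec a) x"
  and cdot_cvec_zero: "cdot (cvec 0) x = 0"
  by (simp_all add: cdot_def cvec_def algebra_simps sum.distrib sum_distrib_left sum_negf)

lemma cdot_cvec_sum: "cdot (cvec (\<Sum>i\<in>I. f i)) x = (\<Sum>i\<in>I. cdot (cvec (f i)) x)"
  by (induction I rule: infinite_finite_induct) (simp_all add: cdot_cvec_add cdot_cvec_zero)

lemma cdot_cvec_span_zero:
  assumes "\<And>\<beta>. \<beta> \<in> S \<Longrightarrow> cdot (cvec \<beta>) x = 0" "v \<in> span S"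
  shows "cdot (cvec v) x = 0"
  using assms(2)
  by (induction rule: span_induct_alt)
    (simp_all add: assms(1) cdot_cvec_add cdot_cvec_scale cdot_cvec_zero)

lemma polys_cdot: "(\<lambda>x. cdot v x) \<in> polys"
  unfolding cdot_def by (intro polys_sum polys.mult polys.const polys.coord)

lemma polys_scale: "p \<in> polys \<Longrightarrow> (\<lambda>x. a * p x) \<in> polys"
  by (intro polys.mult polys.const)

lemma polys_prod: "(\<And>i. i \<in> I \<Longrightarrow> f i \<in> polys) \<Longrightarrow> (\<lambda>x. \<Prod>i\<in>I. f i x) \<in> polys"
  by (induction I rule: infinite_finite_induct) (auto intro: polys.intros)

lemma complexify_add: "complexify w (x + y) = complexify w x + complexify w y"
  and complexify_scale: "complexify w (a *s x) = a *s complexify w x"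
  by (simp_all add: complexify_def matrix_vector_right_distrib vector_scalar_commute)

lemma complexify_cvec:
  assumes "linear w"
  shows "complexify w (cvec a) = cvec (w a)"
proof -
  have "w a = matrix w *v a" using assms by (simp add: matrix_works)
  then show ?thesis
    by (simp add: complexify_def cvec_def vec_eq_iff matrix_vector_mult_def)
qed

lemma cvec_decompose:
  obtains a b where "x = cvec a + \<i> *s cvec b"
proof
  show "x = cvec (\<chi> i. Re (x $ i)) + \<i> *s cvec (\<chi> i. Im (x $ i))"
    by (simp add: vec_eq_iff cvec_def complex_eq)
qed

lemma complexify_comp:
  assumes "linear v" "linear w"
  shows "complexify w (complexify v x) = complexify (w \<circ> v) x"
proof -
  obtain a b where "x = cvec a + \<i> *s cvec b" by (rule cvec_decompose)
  then show ?thesis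
    using assms by (simp add: complexify_add complexify_scale complexify_cvec linear_compose)
qed

lemma complexify_id: "complexify id (x :: complex^'n) = x"
proof -
  obtain a b where "x = cvec a + \<i> *s cvec b" by (rule cvec_decompose)
  moreover have "linear (id :: real^'n \<Rightarrow> real^'n)" by (simp add: linear_iff)
  ultimately show ?thesis by (simp add: complexify_add complexify_scale complexify_cvec)
qed

lemma cdot_complexify:
  assumes "orthogonal_transformation w"
  shows "cdot (cvec (w a)) (complexify w x) = cdot (cvec a) x"
proof -
  obtain b b' where "x = cvec b + \<i> *s cvec b'" by (rule cvec_decompose)
  then show ?thesis
    using assms unfolding orthogonal_transformation_def
    by (simp add: complexify_add complexify_scale complexify_cvec cdot_add_right
        cdot_scale_right cdot_cvec)
qed

text \<open>A single gradient with polynomial entries serves all points and directions, so that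
  directional derivatives are seen at once to be polynomial in the point and linear in the
  direction.\<close>

lemma polys_gradient:
  fixes p :: "complex^'n \<Rightarrow> complex"
  assumes "p \<in> polys"
  obtains D where "\<And>i. D i \<in> polys"
    "\<And>x \<xi>. ((\<lambda>s. p (x + s *s \<xi>)) has_field_derivative (\<Sum>i\<in>UNIV. D i x * \<xi> $ i)) (at 0)"
    "\<And>x \<xi>. dir_deriv \<xi> p x = (\<Sum>i\<in>UNIV. D i x * \<xi> $ i)"
proof -
  have "\<exists>D. (\<forall>i. D i \<in> polys) \<and> (\<forall>x \<xi>.
    ((\<lambda>s. p (x + s *s \<xi>)) has_field_derivative (\<Sum>i\<in>UNIV. D i x * \<xi> $ i)) (at 0))"
    using assms
  proof (induction p rule: polys.induct)
    case (const a)
    show ?case by (rule exI[of _ "\<lambda>i x. 0"]) (auto intro: polys.const)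
  next
    case (coord j)
    have "(\<Sum>i\<in>UNIV. (if i = j then 1 else 0) * \<xi> $ i) = \<xi> $ j" for \<xi> :: "complex^'n"
      by (simp add: if_distrib[of "\<lambda>z. z * _"] cong: if_cong)
    then show ?case
      by (intro exI[of _ "\<lambda>i x. if i = j then 1 else 0"])
        (auto intro!: polys.const derivative_eq_intros)
  next
    case (add p q)
    then obtain D E where D: "\<forall>i. D i \<in> polys" "\<forall>x \<xi>.
        ((\<lambda>s. p (x + s *s \<xi>)) has_field_derivative (\<Sum>i\<in>UNIV. D i x * \<xi> $ i)) (at 0)"
      and E: "\<forall>i. E i \<in> polys" "\<forall>x \<xi>.
        ((\<lambda>s. q (x + s *s \<xi>)) has_field_derivative (\<Sum>i\<in>UNIV. E i x * \<xi> $ i)) (at 0)"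
      by blast
    show ?case
    proof (intro exI[of _ "\<lambda>i x. D i x + E i x"] conjI allI)
      fix x \<xi>
      show "((\<lambda>s. p (x + s *s \<xi>) + q (x + s *s \<xi>)) has_field_derivative
          (\<Sum>i\<in>UNIV. (D i x + E i x) * \<xi> $ i)) (at 0)"
        using DERIV_add[OF D(2)[rule_format, of x \<xi>] E(2)[rule_format, of x \<xi>]]
        by (simp add: distrib_right sum.distrib)
    qed (use D(1) E(1) in \<open>auto intro: polys.add\<close>)
  next
    case (mult p q)
    then obtain D E where D: "\<forall>i. D i \<in> polys" "\<forall>x \<xi>.
        ((\<lambda>s. p (x + s *s \<xi>)) has_field_derivative (\<Sum>i\<in>UNIV. D i x * \<xi> $ i)) (at 0)"
      and E: "\<forall>i. E i \<in> polys" "\<forall>x \<xi>.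
        ((\<lambda>s. q (x + s *s \<xi>)) has_field_derivative (\<Sum>i\<in>UNIV. E i x * \<xi> $ i)) (at 0)"
      by blast
    show ?case
    proof (intro exI[of _ "\<lambda>i x. D i x * q x + E i x * p x"] conjI allI)
      fix x \<xi>
      show "((\<lambda>s. p (x + s *s \<xi>) * q (x + s *s \<xi>)) has_field_derivative
          (\<Sum>i\<in>UNIV. (D i x * q x + E i x * p x) * \<xi> $ i)) (at 0)"
        using DERIV_mult[OF D(2)[rule_format, of x \<xi>] E(2)[rule_format, of x \<xi>]]
        by (simp add: algebra_simps sum.distrib sum_distrib_left)
      show "(\<lambda>x. D i x * q x + E i x * p x) \<in> polys" for i
        by (intro polys.add polys.mult D(1)[rule_format] E(1)[rule_format] mult.hyps)
    qed
  qed
  then obtain D where "\<And>i. D i \<in> polys" and D: "\<And>x \<xi>.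
    ((\<lambda>s. p (x + s *s \<xi>)) has_field_derivative (\<Sum>i\<in>UNIV. D i x * \<xi> $ i)) (at 0)"
    by blast
  with that[of D] DERIV_imp_deriv[OF D] show thesis by (simp add: dir_deriv_def)
qed

lemma has_field_derivative_dir_deriv:
  assumes "p \<in> polys"
  shows "((\<lambda>s. p (x + s *s \<xi>)) has_field_derivative dir_deriv \<xi> p x) (at 0)"
  using polys_gradient[OF assms] by metis

lemma dir_deriv_eqI:
  "((\<lambda>s. p (x + s *s \<xi>)) has_field_derivative d) (at 0) \<Longrightarrow> dir_deriv \<xi> p x = d"
  unfolding dir_deriv_def by (rule DERIV_imp_deriv)

lemma polys_dir_deriv:
  assumes "p \<in> polys"
  shows "dir_deriv \<xi> p \<in> polys"
proof -
  obtain D where D: "\<And>i. D i \<in> polys" "\<And>x \<xi>. dir_deriv \<xi> p x = (\<Sum>i\<in>UNIV. D i x * \<xi> $ i)"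
    using polys_gradient[OF assms] by metis
  then have "dir_deriv \<xi> p = (\<lambda>x. \<Sum>i\<in>UNIV. D i x * \<xi> $ i)" by blast
  then show ?thesis using D(1) by (simp only: polys_sum polys.mult polys.const)
qed

lemma dir_deriv_linear:
  assumes "p \<in> polys"
  shows "dir_deriv (\<xi> - \<eta>) p x = dir_deriv \<xi> p x - dir_deriv \<eta> p x"
    and "dir_deriv (a *s \<xi>) p x = a * dir_deriv \<xi> p x"
    and "dir_deriv (\<Sum>i\<in>I. f i) p x = (\<Sum>i\<in>I. dir_deriv (f i) p x)"
proof -
  obtain D where D: "\<And>x \<xi>. dir_deriv \<xi> p x = (\<Sum>i\<in>UNIV. D i x * \<xi> $ i)"
    using polys_gradient[OF assms] by metis
  show "dir_deriv (\<xi> - \<eta>) p x = dir_deriv \<xi> p x - dir_deriv \<eta> p x"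
    by (simp add: D algebra_simps sum_subtractf)
  show "dir_deriv (a *s \<xi>) p x = a * dir_deriv \<xi> p x"
    by (simp add: D sum_distrib_left mult_ac)
  show "dir_deriv (\<Sum>i\<in>I. f i) p x = (\<Sum>i\<in>I. dir_deriv (f i) p x)"
    unfolding D by (simp add: sum_distrib_left) (rule sum.swap)
qed

lemma divided_difference:
  assumes "p \<in> polys" "\<alpha> \<noteq> 0"
  shows "divided_difference \<alpha> p \<in> polys"
    and "cdot (cvec \<alpha>) x * divided_difference \<alpha> p x = p x - p (complexify (reflection \<alpha>) x)"
  using theI'[OF divided_difference_ex1[OF assms]]
  unfolding divided_difference_def by (simp_all add: group_act_def inv_reflection)

text \<open>On the line \<open>x + s *s cvec \<alpha>\<close> the reflection is the change of sign
  of \<open>s\<close>. The defining equation becomes one between odd functions of \<open>s\<close>,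
  and their derivatives at zero give the value at \<open>x\<close>.\<close>

lemma divided_difference_on_mirror:
  assumes p: "p \<in> polys" and \<alpha>: "\<alpha> \<noteq> 0" and x: "cdot (cvec \<alpha>) x = 0"
  shows "divided_difference \<alpha> p x = 2 / complex_of_real (\<alpha> \<bullet> \<alpha>) * dir_deriv (cvec \<alpha>) p x"
proof -
  define N where "N = complex_of_real (\<alpha> \<bullet> \<alpha>)"
  have N: "N \<noteq> 0" using \<alpha> by (simp add: N_def)
  define f where "f = (\<lambda>s. p (x + s *s cvec \<alpha>))"
  define q where "q = divided_difference \<alpha> p"
  have q: "q \<in> polys" unfolding q_def by (rule divided_difference(1)[OF p \<alpha>])
  have "s * N * q (x + s *s cvec \<alpha>) = f s - f (- s)" for s
  proof -
    have 1: "cdot (cvec \<alpha>) (x + s *s cvec \<alpha>) = s * N"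
      by (simp add: cdot_add_right cdot_scale_right x cdot_cvec N_def)
    have "complexify (reflection \<alpha>) (x + s *s cvec \<alpha>) $ i = (x + (- s) *s cvec \<alpha>) $ i" for i
      unfolding complexify_reflection 1
      using N by (simp add: N_def cvec_def field_simps)
    then have "complexify (reflection \<alpha>) (x + s *s cvec \<alpha>) = x + (- s) *s cvec \<alpha>"
      by (simp only: vec_eq_iff) blast
    with divided_difference(2)[OF p \<alpha>, of "x + s *s cvec \<alpha>"] 1 show ?thesis
      by (simp add: q_def f_def)
  qed
  then have eq: "(\<lambda>s. s * N * q (x + s *s cvec \<alpha>)) = (\<lambda>s. f s - f (- s))" by blast
  have "((\<lambda>s. s * N) has_field_derivative N) (at 0)"
    by (auto intro!: derivative_eq_intros)
  from DERIV_mult[OF this has_field_derivative_dir_deriv[OF q]]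
  have "((\<lambda>s. s * N * q (x + s *s cvec \<alpha>)) has_field_derivative N * q x) (at 0)"
    by simp
  then have 1: "((\<lambda>s. f s - f (- s)) has_field_derivative N * q x) (at 0)"
    unfolding eq by simp
  have f: "(f has_field_derivative dir_deriv (cvec \<alpha>) p x) (at 0)"
    unfolding f_def by (rule has_field_derivative_dir_deriv[OF p])
  have "((\<lambda>s. f (- s)) has_field_derivative dir_deriv (cvec \<alpha>) p x * (- 1)) (at 0)"
    by (rule DERIV_chain2[of f]) (auto intro!: f derivative_eq_intros)
  from DERIV_diff[OF f this]
  have 2: "((\<lambda>s. f s - f (- s)) has_field_derivative 2 * dir_deriv (cvec \<alpha>) p x) (at 0)"
    by simp
  from DERIV_unique[OF 1 2] N show ?thesis by (simp add: q_def N_def field_simps)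
qed

lemma polys_dunkl:
  assumes "p \<in> polys" "0 \<notin> P"
  shows "dunkl P c \<xi> p \<in> polys"
proof -
  have "(\<lambda>x. \<Sum>\<alpha>\<in>P. c \<alpha> * cdot (cvec \<alpha>) \<xi> * divided_difference \<alpha> p x) \<in> polys"
    using assms(2) by (intro polys_sum polys_scale divided_difference(1)[OF assms(1)]) auto
  then have "(\<lambda>x. dir_deriv \<xi> p x + (- 1) * (\<Sum>\<alpha>\<in>P. c \<alpha> * cdot (cvec \<alpha>) \<xi> * divided_difference \<alpha> p x)) \<in> polys"
    using polys_dir_deriv[OF assms(1)] by (intro polys.add polys_scale) auto
  then show ?thesis by (simp add: dunkl_def)
qed

subsection \<open>Dunkl operators on parabolic ideals\<close>

locale dunkl_setting =
  fixes W :: "(real^'n \<Rightarrow> real^'n) set"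
    and R P \<Delta> \<Gamma> :: "(real^'n) set"
    and c :: "real^'n \<Rightarrow> complex"
    and k :: complex
    and t :: "real^'n"
  assumes W: "finite_reflection_group W"
    and R: "coxeter_root_system W R"
    and regular: "\<alpha> \<in> R \<Longrightarrow> t \<bullet> \<alpha> \<noteq> 0"
    and P: "P = {\<alpha> \<in> R. t \<bullet> \<alpha> > 0}"
    and simple: "simple_roots P \<Delta>"
    and c_invariant: "w \<in> W \<Longrightarrow> \<alpha> \<in> R \<Longrightarrow> c (w \<alpha>) = c \<alpha>"
    and \<Gamma>: "\<Gamma> \<subseteq> \<Delta>"
    and c_\<Gamma>: "\<beta> \<in> \<Gamma> \<Longrightarrow> c \<beta> = k"
begin

lemma id_in_W: "id \<in> W"
  and comp_in_W: "v \<in> W \<Longrightarrow> w \<in> W \<Longrightarrow> v \<circ> w \<in> W"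
  and inv_in_W: "w \<in> W \<Longrightarrow> inv w \<in> W"
  using W unfolding finite_reflection_group_def by (auto intro: generated_group.intros)

lemma orthogonal_W: assumes "w \<in> W" shows "orthogonal_transformation w"
proof -
  obtain S where S: "S \<subseteq> {reflection v |v. v \<noteq> 0}" "W = generated_group S"
    using W unfolding finite_reflection_group_def by blast
  from assms show ?thesis
    unfolding S(2)
  proof (induction rule: generated_group.induct)
    case (incl s)
    with S(1) show ?case using orthogonal_transformation_reflection by blast
  next
    case (mult f g)
    then show ?case using orthogonal_transformation_compose[of f g] by (simp add: o_def)
  next
    case (inv f)
    then show ?case by (intro orthogonal_transformation_inv)
  qed (simp add: id_def)
qed

lemma linear_W: "w \<in> W \<Longrightarrow> linear w"
  using orthogonal_W orthogonal_transformation_linear by blast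

lemma bij_W: "w \<in> W \<Longrightarrow> bij w"
  using orthogonal_W orthogonal_transformation_bij by blast

lemma root_nonzero: "\<alpha> \<in> R \<Longrightarrow> \<alpha> \<noteq> 0"
  and reflection_in_W: "\<alpha> \<in> R \<Longrightarrow> reflection \<alpha> \<in> W"
  and W_root: "w \<in> W \<Longrightarrow> \<alpha> \<in> R \<Longrightarrow> w \<alpha> \<in> R"
  using R unfolding coxeter_root_system_def by blast+

lemma root_pair:
  assumes "\<alpha> \<in> R"
  shows "\<exists>\<gamma>. {\<beta> \<in> R. reflection \<beta> = reflection \<alpha>} = {\<gamma>, - \<gamma>}"
  using R root_nonzero[OF assms] reflection_in_W[OF assms]
  unfolding coxeter_root_system_def by blast

lemma finite_roots: "finite R"
proof -
  have "finite W" using W by (simp add: finite_reflection_group_def)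
  then have fin: "finite (reflection ` R)"
    by (rule finite_subset[rotated]) (use reflection_in_W in blast)
  have "R = (\<Union>s\<in>reflection ` R. {\<beta> \<in> R. reflection \<beta> = s})" by blast
  moreover have "finite {\<beta> \<in> R. reflection \<beta> = s}" if s: "s \<in> reflection ` R" for s
  proof -
    obtain \<alpha> where "\<alpha> \<in> R" "s = reflection \<alpha>" using s by blast
    with root_pair[of \<alpha>] show ?thesis by (metis finite.emptyI finite.insertI)
  qed
  ultimately show ?thesis using fin by (metis (no_types, lifting) finite_UN)
qed

lemma bij_roots: "w \<in> W \<Longrightarrow> bij_betw w R R"
  unfolding bij_betw_def
  using endo_inj_surj[OF finite_roots, of w] W_root bij_W
  by (metis bij_is_inj image_subsetI inj_on_subset subset_UNIV)

sublocale roots: simple_system R \<Delta> t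
proof
  fix \<alpha> a assume *: "\<alpha> \<in> R" "a *\<^sub>R \<alpha> \<in> R"
  then have "a \<noteq> 0" using root_nonzero by fastforce
  then have eq: "reflection (a *\<^sub>R \<alpha>) = reflection \<alpha>" by (rule reflection_eq_scale)
  obtain \<gamma> where \<gamma>: "{\<beta> \<in> R. reflection \<beta> = reflection \<alpha>} = {\<gamma>, - \<gamma>}"
    using root_pair[OF *(1)] by blast
  have "\<alpha> \<in> {\<gamma>, - \<gamma>}" "a *\<^sub>R \<alpha> \<in> {\<gamma>, - \<gamma>}"
    unfolding \<gamma>[symmetric] using * eq by auto
  then have "a *\<^sub>R \<alpha> = 1 *\<^sub>R \<alpha> \<or> a *\<^sub>R \<alpha> = (- 1) *\<^sub>R \<alpha>" by auto
  with root_nonzero[OF *(1)] show "a = 1 \<or> a = -1"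
    by (simp only: scaleR_right_imp_eq scaleR_cancel_right) simp
next
  show "\<Delta> \<subseteq> R" "independent \<Delta>" "\<And>\<beta>. \<beta> \<in> \<Delta> \<Longrightarrow> t \<bullet> \<beta> > 0"
    using simple by (auto simp: simple_roots_def P)
  show "\<exists>a. (\<forall>\<beta>\<in>\<Delta>. a \<beta> \<ge> 0) \<and> \<alpha> = (\<Sum>\<beta>\<in>\<Delta>. a \<beta> *\<^sub>R \<beta>)" if "\<alpha> \<in> R" "t \<bullet> \<alpha> > 0" for \<alpha>
    using simple that by (auto simp: simple_roots_def P)
  show "reflection \<alpha> \<beta> \<in> R" if "\<alpha> \<in> R" "\<beta> \<in> R" for \<alpha> \<beta>
    using W_root reflection_in_W that by blast
qed (use finite_roots regular in auto)

sublocale par: simple_system "R \<inter> span \<Gamma>" \<Gamma> t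
  by (rule roots.subsystem[OF \<Gamma>])

text \<open>Parabolic roots are conjugate to roots of \<Gamma> by reflections in \<Gamma>.\<close>

lemma c_parabolic: assumes "\<alpha> \<in> R \<inter> span \<Gamma>" shows "c \<alpha> = k"
proof -
  obtain L \<beta> where L: "set L \<subseteq> \<Gamma>" "\<beta> \<in> \<Gamma>" "\<alpha> = word L \<beta>"
    using par.conjugate_to_simple[OF assms] by blast
  have "word L \<in> W"
    using L(1) by (induction L) (use id_in_W comp_in_W reflection_in_W par.simple_in in auto)
  with L c_\<Gamma> c_invariant par.simple_in show ?thesis by auto
qed

definition fixed_space :: "(complex^'n) set" where
  "fixed_space = {x. \<forall>\<beta>\<in>\<Gamma>. cdot (cvec \<beta>) x = 0}"

lemma stratum_eq: "parabolic_stratum W \<Gamma> = (\<Union>w\<in>W. complexify w ` fixed_space)"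
  by (simp add: parabolic_stratum_def fixed_space_def)

lemma fixed_spaceI: "w \<in> W \<Longrightarrow> x \<in> fixed_space \<Longrightarrow> complexify w x \<in> parabolic_stratum W \<Gamma>"
  unfolding stratum_eq by blast

lemma stratum_invariant:
  assumes "v \<in> W" "y \<in> parabolic_stratum W \<Gamma>"
  shows "complexify v y \<in> parabolic_stratum W \<Gamma>"
proof -
  obtain w x where "w \<in> W" "x \<in> fixed_space" "y = complexify w x"
    using assms(2) unfolding stratum_eq by blast
  then show ?thesis
    using assms(1) fixed_spaceI[OF comp_in_W[OF assms(1)]]
    by (simp add: complexify_comp linear_W)
qed

lemma fixed_space_combination:
  "x \<in> fixed_space \<Longrightarrow> y \<in> fixed_space \<Longrightarrow> x + s *s y \<in> fixed_space"
  by (simp add: fixed_space_def cdot_add_right cdot_scale_right)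

lemma fixed_space_span: "x \<in> fixed_space \<Longrightarrow> v \<in> span \<Gamma> \<Longrightarrow> cdot (cvec v) x = 0"
  by (rule cdot_cvec_span_zero[of \<Gamma>]) (simp_all add: fixed_space_def)

text \<open>The vector \<open>u\<close> represents the functional that is 0 on \<Gamma> and 1 on the
  other simple roots. A positive root orthogonal to it has nonnegative coefficients that add up to
  zero outside \<Gamma>, so only those at \<Gamma> remain.\<close>

lemma generic_point:
  obtains u :: "real^'n" where "cvec u \<in> fixed_space"
    "\<And>\<alpha>. \<alpha> \<in> R \<Longrightarrow> u \<bullet> \<alpha> = 0 \<Longrightarrow> \<alpha> \<in> span \<Gamma>"
proof -
  obtain g :: "real^'n \<Rightarrow> real" where g: "linear g" "\<And>\<beta>. \<beta> \<in> \<Delta> \<Longrightarrow> g \<beta> = (if \<beta> \<in> \<Gamma> then 0 else 1)"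
    using linear_independent_extend[OF roots.indep, of "\<lambda>\<beta>. if \<beta> \<in> \<Gamma> then 0 else 1"] by blast
  define u where "u = adjoint g 1"
  have u: "u \<bullet> v = g v" for v
    using adjoint_works[OF g(1), of v 1] by (simp add: u_def inner_commute)
  have pos: "\<alpha> \<in> span \<Gamma>" if \<alpha>: "\<alpha> \<in> R" "t \<bullet> \<alpha> > 0" "u \<bullet> \<alpha> = 0" for \<alpha>
  proof -
    obtain a where a: "\<forall>\<beta>\<in>\<Delta>. a \<beta> \<ge> 0" "\<alpha> = (\<Sum>\<beta>\<in>\<Delta>. a \<beta> *\<^sub>R \<beta>)"
      using roots.combination[OF \<alpha>(1,2)] by blast
    have "(\<Sum>\<beta>\<in>\<Delta>. a \<beta> * g \<beta>) = 0"
      using \<alpha>(3) unfolding u a(2) by (simp add: linear_sum[OF g(1)] linear_scale[OF g(1)])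
    moreover have "\<forall>\<beta>\<in>\<Delta>. a \<beta> * g \<beta> \<ge> 0" using a(1) g(2) by simp
    ultimately have "\<forall>\<beta>\<in>\<Delta>. a \<beta> * g \<beta> = 0"
      using sum_nonneg_eq_0_iff[OF roots.finite_simple, of "\<lambda>\<beta>. a \<beta> * g \<beta>"] by blast
    then have "a \<beta> *\<^sub>R \<beta> \<in> span \<Gamma>" if "\<beta> \<in> \<Delta>" for \<beta>
      using that g(2)[OF that] by (cases "\<beta> \<in> \<Gamma>") (auto intro: span_scale span_base simp: span_zero)
    then show ?thesis unfolding a(2) by (rule span_sum)
  qed
  show thesis
  proof (rule that[of u])
    show "cvec u \<in> fixed_space"
      using g(2) \<Gamma> u by (auto simp: fixed_space_def cdot_cvec inner_commute)
    fix \<alpha> assume \<alpha>: "\<alpha> \<in> R" "u \<bullet> \<alpha> = 0"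
    show "\<alpha> \<in> span \<Gamma>"
    proof (cases "t \<bullet> \<alpha> > 0")
      case False
      with regular[OF \<alpha>(1)] have "t \<bullet> (- \<alpha>) > 0" by simp
      with pos[of "- \<alpha>"] \<alpha> roots.minus_closed have "- \<alpha> \<in> span \<Gamma>" by simp
      then show ?thesis using span_neg by fastforce
    qed (use pos \<alpha> in blast)
  qed
qed

text \<open>The complex linear extension of \<open>par.frame\<close>. Summing over roots of both
  signs absorbs the factor 2 in the derivative on a mirror.\<close>

definition cframe :: "complex^'n \<Rightarrow> complex^'n" where
  "cframe \<xi> = (\<Sum>\<alpha>\<in>R \<inter> span \<Gamma>. (cdot (cvec \<alpha>) \<xi> / complex_of_real (\<alpha> \<bullet> \<alpha>)) *s cvec \<alpha>)"

lemma cdot_cframe: "cdot (cvec v) (cframe \<xi>) = cdot (cvec (par.frame v)) \<xi>"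
  by (simp add: cframe_def par.frame_def cdot_sum_right cdot_scale_right cdot_cvec cdot_cvec_sum
      cdot_cvec_scale inner_commute mult_ac)

text \<open>Elements of \<open>W\<close> permute \<open>R\<close> but in general not
  \<open>P\<close>, so a sum over \<open>P\<close> is doubled before it is reindexed.\<close>

lemma sum_positive:
  fixes f :: "real^'n \<Rightarrow> complex"
  assumes "\<And>\<alpha>. f (- \<alpha>) = f \<alpha>"
  shows "2 * (\<Sum>\<alpha>\<in>P. f \<alpha>) = (\<Sum>\<alpha>\<in>R. f \<alpha>)"
proof -
  have "R = P \<union> uminus ` P" "P \<inter> uminus ` P = {}"
    using regular roots.minus_closed unfolding P
    by (auto simp: image_iff) (metis add.inverse_inverse inner_minus_right linorder_neqE neg_0_less_iff_less)
  moreover have "finite P" using finite_roots by (simp add: P)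
  ultimately have "(\<Sum>\<alpha>\<in>R. f \<alpha>) = (\<Sum>\<alpha>\<in>P. f \<alpha>) + (\<Sum>\<alpha>\<in>uminus ` P. f \<alpha>)"
    using sum.union_disjoint by (metis finite_imageI)
  also have "(\<Sum>\<alpha>\<in>uminus ` P. f \<alpha>) = (\<Sum>\<alpha>\<in>P. f \<alpha>)"
    by (subst sum.reindex) (simp_all add: assms)
  finally show ?thesis by simp
qed

text \<open>At a generic point of the stratum only the parabolic roots contribute, each through
  the derivative along the root.\<close>

lemma dunkl_at_generic_point:
  assumes p: "p \<in> parabolic_ideal W \<Gamma>" and w: "w \<in> W" and x: "x \<in> fixed_space"
    and gen: "\<And>\<alpha>. \<alpha> \<in> R \<Longrightarrow> cdot (cvec \<alpha>) x = 0 \<Longrightarrow> \<alpha> \<in> span \<Gamma>"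
  shows "dunkl P c (complexify w \<xi>) p (complexify w x) =
    dir_deriv (complexify w (\<xi> - k *s cframe \<xi>)) p (complexify w x)"
proof -
  define y where "y = complexify w x"
  define G where "G = (\<lambda>v. dir_deriv v p y)"
  have poly: "p \<in> polys" and van: "\<And>z. z \<in> parabolic_stratum W \<Gamma> \<Longrightarrow> p z = 0"
    using p by (auto simp: parabolic_ideal_def)
  have yD: "y \<in> parabolic_stratum W \<Gamma>" unfolding y_def using w x by (rule fixed_spaceI)
  define f where "f = (\<lambda>\<alpha>. if cdot (cvec \<alpha>) y = 0
    then c \<alpha> * cdot (cvec \<alpha>) (complexify w \<xi>) * (2 / complex_of_real (\<alpha> \<bullet> \<alpha>) * G (cvec \<alpha>)) else 0)"
  have summand: "c \<alpha> * cdot (cvec \<alpha>) (complexify w \<xi>) * divided_difference \<alpha> p y = f \<alpha>"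
    if "\<alpha> \<in> P" for \<alpha>
  proof -
    have \<alpha>: "\<alpha> \<in> R" "\<alpha> \<noteq> 0" using that root_nonzero by (auto simp: P)
    show ?thesis
    proof (cases "cdot (cvec \<alpha>) y = 0")
      case True
      then show ?thesis
        by (simp add: f_def G_def divided_difference_on_mirror[OF poly \<alpha>(2) True])
    next
      case False
      \<comment> \<open>Off the mirror of \<alpha> the divided difference is zero, because
        \<open>p\<close> vanishes at \<open>y\<close> and at its mirror image, which is again in the
        stratum.\<close>
      have "p (complexify (reflection \<alpha>) y) = 0"
        by (intro van stratum_invariant reflection_in_W \<alpha> yD)
      with divided_difference(2)[OF poly \<alpha>(2), of y] van[OF yD] False
      show ?thesis by (simp add: f_def)
    qed
  qed
  have wR: "cdot (cvec (w \<alpha>)) (complexify w z) = cdot (cvec \<alpha>) z" for \<alpha> z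
    by (rule cdot_complexify[OF orthogonal_W[OF w]])
  have G_minus: "G (cvec (- \<alpha>)) = - G (cvec \<alpha>)" for \<alpha>
  proof -
    have "cvec (- \<alpha>) = (- 1) *s cvec \<alpha>" by (simp add: cvec_def vec_eq_iff)
    then show ?thesis by (simp only: G_def dir_deriv_linear(2)[OF poly]) simp
  qed
  have c_minus: "c (- \<alpha>) = c \<alpha>" if "\<alpha> \<in> R" for \<alpha>
    using c_invariant[OF reflection_in_W[OF that] that] by simp
  \<comment> \<open>\<open>c\<close> is known to be even on \<open>R\<close> only; extension by zero
    gives a function that is even everywhere, as \<open>sum_positive\<close> demands.\<close>
  define f' where "f' = (\<lambda>\<alpha>. if \<alpha> \<in> R then f \<alpha> else 0)"
  have f'_even: "f' (- \<alpha>) = f' \<alpha>" for \<alpha>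
    using roots.minus_closed[of \<alpha>] roots.minus_closed[of "- \<alpha>"] c_minus[of \<alpha>]
    by (auto simp: f'_def f_def cdot_cvec_minus G_minus)
  from sum_positive[of f', OF f'_even] have "2 * (\<Sum>\<alpha>\<in>P. f \<alpha>) = (\<Sum>\<alpha>\<in>R. f \<alpha>)"
    by (simp add: f'_def P)
  \<comment> \<open>Reindexing by \<open>w\<close> turns mirrors through \<open>y\<close> into
    mirrors through \<open>x\<close>, where genericity singles out the parabolic roots.\<close>
  also have "\<dots> = (\<Sum>\<alpha>\<in>R. f (w \<alpha>))"
    using sum.reindex_bij_betw[OF bij_roots[OF w], of f] by simp
  also have "\<dots> = (\<Sum>\<alpha>\<in>R \<inter> span \<Gamma>. f (w \<alpha>))"
  proof (rule sum.mono_neutral_right[OF finite_roots])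
    show "\<forall>\<alpha>\<in>R - R \<inter> span \<Gamma>. f (w \<alpha>) = 0"
      using gen by (auto simp: f_def y_def wR)
  qed simp
  also have "\<dots> = (\<Sum>\<alpha>\<in>R \<inter> span \<Gamma>.
      2 * G (complexify w ((k * (cdot (cvec \<alpha>) \<xi> / complex_of_real (\<alpha> \<bullet> \<alpha>))) *s cvec \<alpha>)))"
  proof (rule sum.cong[OF refl])
    fix \<alpha> assume \<alpha>: "\<alpha> \<in> R \<inter> span \<Gamma>"
    have "cdot (cvec \<alpha>) x = 0" using fixed_space_span[OF x] \<alpha> by blast
    moreover have "w \<alpha> \<bullet> w \<alpha> = \<alpha> \<bullet> \<alpha>"
      using orthogonal_W[OF w] by (simp add: orthogonal_transformation_def)
    moreover have "c (w \<alpha>) = k" using c_parabolic[OF \<alpha>] c_invariant[OF w] \<alpha> by simp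
    moreover have "G (complexify w (a *s cvec \<alpha>)) = a * G (cvec (w \<alpha>))" for a
      by (simp add: complexify_scale complexify_cvec[OF linear_W[OF w]] G_def
          dir_deriv_linear(2)[OF poly])
    ultimately show "f (w \<alpha>) =
        2 * G (complexify w ((k * (cdot (cvec \<alpha>) \<xi> / complex_of_real (\<alpha> \<bullet> \<alpha>))) *s cvec \<alpha>))"
      by (simp add: f_def y_def wR)
  qed
  also have "\<dots> = 2 * G (complexify w (k *s cframe \<xi>))"
  proof -
    have "complexify w (\<Sum>\<alpha>\<in>A. h \<alpha>) = (\<Sum>\<alpha>\<in>A. complexify w (h \<alpha>))" for A and h :: "real^'n \<Rightarrow> complex^'n"
      unfolding complexify_def by (rule linear_sum) (rule matrix_vector_mul_linear)
    moreover have "k *s cframe \<xi> = (\<Sum>\<alpha>\<in>R \<inter> span \<Gamma>.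
        (k * (cdot (cvec \<alpha>) \<xi> / complex_of_real (\<alpha> \<bullet> \<alpha>))) *s cvec \<alpha>)"
      by (simp add: cframe_def vec_eq_iff sum_distrib_left mult_ac)
    ultimately show ?thesis
      by (simp add: G_def dir_deriv_linear(3)[OF poly] sum_distrib_left)
  qed
  finally have "(\<Sum>\<alpha>\<in>P. f \<alpha>) = G (complexify w (k *s cframe \<xi>))" by simp
  moreover have "complexify w (\<xi> - k *s cframe \<xi>) = complexify w \<xi> - complexify w (k *s cframe \<xi>)"
    by (simp add: complexify_def matrix_vector_mult_diff_distrib)
  ultimately show ?thesis
    unfolding dunkl_def y_def[symmetric] using summand
    by (simp add: G_def dir_deriv_linear(1)[OF poly])
qed

lemma ideal_polys: "p \<in> parabolic_ideal W \<Gamma> \<Longrightarrow> p \<in> polys"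
  by (simp add: parabolic_ideal_def)

text \<open>Multiplications preserve vanishing on the stratum, and so does \<open>W\<close>, as the
  stratum is invariant; only the Dunkl generators impose a condition.\<close>

lemma invariant_iff_dunkl:
  "cherednik_invariant W P c (parabolic_ideal W \<Gamma>) \<longleftrightarrow>
    (\<forall>\<xi>. \<forall>p\<in>parabolic_ideal W \<Gamma>. dunkl P c \<xi> p \<in> parabolic_ideal W \<Gamma>)"
    (is "?inv \<longleftrightarrow> ?dunkl")
proof
  assume ?inv
  then show ?dunkl
    unfolding cherednik_invariant_def using cherednik_algebra.dunkl by blast
next
  assume d: ?dunkl
  let ?I = "parabolic_ideal W \<Gamma>"
  have sub: "poly_subspace ?I"
    unfolding poly_subspace_def parabolic_ideal_def by (auto intro: polys.intros)
  have "\<forall>p\<in>?I. A p \<in> ?I" if "A \<in> cherednik_algebra W P c" for A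
    using that
  proof (induction rule: cherednik_algebra.induct)
    case (poly f)
    then show ?case unfolding parabolic_ideal_def by (auto intro: polys.intros)
  next
    case (group w)
    show ?case
    proof
      fix p assume p: "p \<in> ?I"
      have "group_act w p x = 0" if "x \<in> parabolic_stratum W \<Gamma>" for x
        using p stratum_invariant[OF inv_in_W[OF group] that]
        by (simp add: parabolic_ideal_def group_act_def)
      moreover have "group_act w p \<in> polys" using p by (intro polys_group_act ideal_polys)
      ultimately show "group_act w p \<in> ?I" by (simp add: parabolic_ideal_def)
    qed
  next
    case (dunkl \<xi>)
    then show ?case using d by blast
  next
    case (add A B)
    then show ?case using sub by (simp add: poly_subspace_def)
  next
    case (scale A a)
    then show ?case using sub by (simp add: poly_subspace_def)
  qed simp
  with sub show ?inv by (simp add: cherednik_invariant_def)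
qed

text \<open>The eigenvalue condition makes \<eta> tangent to the fixed space, and \<open>p\<close>
  vanishes along the translates of that space. This settles generic points; any other point is a
  limit of generic ones on a line in the direction of \<open>u\<close>.\<close>

lemma invariant_if:
  assumes eig: "\<And>\<beta>. \<beta> \<in> \<Gamma> \<Longrightarrow> \<exists>a. par.frame \<beta> = a *\<^sub>R \<beta> \<and> k * of_real a = 1"
    and p: "p \<in> parabolic_ideal W \<Gamma>"
  shows "dunkl P c \<xi> p \<in> parabolic_ideal W \<Gamma>"
proof -
  have q: "dunkl P c \<xi> p \<in> polys"
    using p roots.zero_notin by (intro polys_dunkl) (auto simp: parabolic_ideal_def P)
  have "dunkl P c \<xi> p y = 0" if y: "y \<in> parabolic_stratum W \<Gamma>" for y
  proof -
    from y obtain w x where w: "w \<in> W" and x: "x \<in> fixed_space" and y: "y = complexify w x"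
      unfolding stratum_eq by blast
    define \<xi>' where "\<xi>' = complexify (inv w) \<xi>"
    have "w \<circ> inv w = id" using bij_W[OF w] by (meson bij_is_surj surj_iff)
    then have \<xi>: "\<xi> = complexify w \<xi>'"
      by (simp add: \<xi>'_def complexify_comp linear_W w inv_in_W complexify_id)
    define \<eta> where "\<eta> = \<xi>' - k *s cframe \<xi>'"
    have \<eta>: "\<eta> \<in> fixed_space"
    proof -
      have "cdot (cvec \<beta>) \<eta> = 0" if \<beta>: "\<beta> \<in> \<Gamma>" for \<beta>
      proof -
        obtain a where a: "par.frame \<beta> = a *\<^sub>R \<beta>" "k * of_real a = 1" using eig[OF \<beta>] by blast
        have "cdot (cvec \<beta>) \<eta> = (1 - k * of_real a) * cdot (cvec \<beta>) \<xi>'"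
          by (simp add: \<eta>_def cdot_diff_right cdot_scale_right cdot_cframe a(1) cdot_cvec_scale
              algebra_simps)
        with a(2) show ?thesis by simp
      qed
      then show ?thesis by (simp add: fixed_space_def)
    qed
    have zero: "dunkl P c \<xi> p (complexify w z) = 0"
      if z: "z \<in> fixed_space" "\<And>\<alpha>. \<alpha> \<in> R \<Longrightarrow> cdot (cvec \<alpha>) z = 0 \<Longrightarrow> \<alpha> \<in> span \<Gamma>" for z
    proof -
      have "p (complexify w z + s *s complexify w \<eta>) = 0" for s
        using fixed_spaceI[OF w fixed_space_combination[OF z(1) \<eta>, of s]] p
        by (simp add: parabolic_ideal_def complexify_add complexify_scale)
      then have "dir_deriv (complexify w \<eta>) p (complexify w z) = 0"
        by (intro dir_deriv_eqI) simp
      then show ?thesis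
        using dunkl_at_generic_point[OF p w z, of \<xi>'] by (simp add: \<xi> \<eta>_def)
    qed
    obtain u where u: "cvec u \<in> fixed_space" "\<And>\<alpha>. \<alpha> \<in> R \<Longrightarrow> u \<bullet> \<alpha> = 0 \<Longrightarrow> \<alpha> \<in> span \<Gamma>"
      using generic_point by blast
    \<comment> \<open>The parameters at which the line can meet a nonparabolic mirror. Removing 0
      also discards roots orthogonal to \<open>u\<close>, whose quotient is 0 by convention, and
      leaves a punctured neighbourhood of 0 outside \<open>F\<close>.\<close>
    define F where "F = (\<lambda>\<alpha>. - cdot (cvec \<alpha>) x / of_real (u \<bullet> \<alpha>)) ` R - {0}"
    define g where "g = (\<lambda>s. dunkl P c \<xi> p (complexify w (x + s *s cvec u)))"
    have g0: "g s = 0" if s: "s \<noteq> 0" "s \<notin> F" for s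
      unfolding g_def
    proof (rule zero)
      show "x + s *s cvec u \<in> fixed_space" by (rule fixed_space_combination[OF x u(1)])
      fix \<alpha> assume \<alpha>: "\<alpha> \<in> R" "cdot (cvec \<alpha>) (x + s *s cvec u) = 0"
      show "\<alpha> \<in> span \<Gamma>"
      proof (rule u(2)[OF \<alpha>(1)], rule ccontr)
        assume "u \<bullet> \<alpha> \<noteq> 0"
        moreover have "cdot (cvec \<alpha>) x + s * of_real (u \<bullet> \<alpha>) = 0"
          using \<alpha>(2) by (simp add: cdot_add_right cdot_scale_right cdot_cvec inner_commute)
        ultimately have "s = - cdot (cvec \<alpha>) x / of_real (u \<bullet> \<alpha>)"
          by (simp add: field_simps add_eq_0_iff)
        with s \<alpha>(1) show False by (auto simp: F_def)
      qed
    qed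
    have "finite F" using finite_roots by (simp add: F_def)
    then have "open (- F)" by (intro open_Compl finite_imp_closed)
    then have "\<forall>\<^sub>F s in at 0. s \<in> - F" by (rule eventually_at_in_open') (simp add: F_def)
    moreover have "\<forall>\<^sub>F s in at 0. s \<noteq> (0::complex)" by (simp add: eventually_at_filter)
    ultimately have "\<forall>\<^sub>F s in at 0. 0 = g s"
      by eventually_elim (use g0 in auto)
    then have lim0: "(g \<longlongrightarrow> 0) (at 0)"
      by (rule Lim_transform_eventually[OF tendsto_const])
    have "(\<lambda>s. dunkl P c \<xi> p (complexify w x + s *s complexify w (cvec u))) = g"
      by (simp add: g_def fun_eq_iff complexify_add complexify_scale)
    with has_field_derivative_dir_deriv[OF q, of "complexify w x" "complexify w (cvec u)"]
    have "isCont g 0" using DERIV_isCont by metis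
    then have "(g \<longlongrightarrow> g 0) (at 0)" by (simp add: isCont_def)
    from tendsto_unique[OF trivial_limit_at this lim0] show ?thesis by (simp add: g_def y)
  qed
  with q show ?thesis by (simp add: parabolic_ideal_def)
qed

text \<open>For each \<open>w\<close> whose translate of the fixed space misses \<open>u\<close>,
  the factor \<open>q\<close> contains a linear form that is zero on the translate but not at
  \<open>u\<close>. For any other \<open>w\<close>, genericity makes \<open>w\<close> map
  \<open>span \<Gamma>\<close> onto itself, so the form of \<beta> is zero on the translate.\<close>

lemma separating_polynomial:
  assumes gen: "\<And>\<alpha>. \<alpha> \<in> R \<Longrightarrow> u \<bullet> \<alpha> = 0 \<Longrightarrow> \<alpha> \<in> span \<Gamma>" and \<beta>: "\<beta> \<in> \<Gamma>"
  obtains q where "q \<in> polys" "q (cvec u) \<noteq> 0"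
    "(\<lambda>x. cdot (cvec \<beta>) x * q x) \<in> parabolic_ideal W \<Gamma>"
proof -
  define W' where "W' = {w \<in> W. \<exists>\<gamma>\<in>\<Gamma>. u \<bullet> w \<gamma> \<noteq> 0}"
  have "\<forall>w\<in>W'. \<exists>\<gamma>. \<gamma> \<in> \<Gamma> \<and> u \<bullet> w \<gamma> \<noteq> 0" by (auto simp: W'_def)
  then obtain g where g: "\<And>w. w \<in> W' \<Longrightarrow> g w \<in> \<Gamma> \<and> u \<bullet> w (g w) \<noteq> 0"
    by (metis bchoice)
  have fin: "finite W'" using W by (simp add: W'_def finite_reflection_group_def)
  define q where "q = (\<lambda>x. \<Prod>w\<in>W'. cdot (cvec (w (g w))) x)"
  have qp: "q \<in> polys" unfolding q_def by (intro polys_prod polys_cdot)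
  have "q (cvec u) \<noteq> 0"
    using fin g by (auto simp: q_def cdot_cvec inner_commute)
  moreover have "cdot (cvec \<beta>) z * q z = 0" if z: "z \<in> parabolic_stratum W \<Gamma>" for z
  proof -
    from z obtain w x where w: "w \<in> W" and x: "x \<in> fixed_space" and z: "z = complexify w x"
      unfolding stratum_eq by blast
    show ?thesis
    proof (cases "w \<in> W'")
      case True
      then have "cdot (cvec (w (g w))) z = 0"
        using g[OF True] x by (simp add: z cdot_complexify[OF orthogonal_W[OF w]] fixed_space_def)
      with True fin have "q z = 0" by (auto simp: q_def)
      then show ?thesis by simp
    next
      case False
      have lin: "linear w" "inj w" using linear_W[OF w] bij_W[OF w] bij_is_inj by blast+
      have "w ` \<Gamma> \<subseteq> span \<Gamma>"
      proof
        fix v assume "v \<in> w ` \<Gamma>"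
        then obtain \<gamma> where \<gamma>: "\<gamma> \<in> \<Gamma>" "v = w \<gamma>" by blast
        with False w have "u \<bullet> w \<gamma> = 0" by (auto simp: W'_def)
        moreover have "w \<gamma> \<in> R" using W_root[OF w] \<gamma>(1) par.simple_in by blast
        ultimately show "v \<in> span \<Gamma>" using gen \<gamma>(2) by blast
      qed
      then have "span (w ` \<Gamma>) \<subseteq> span \<Gamma>" by (simp add: span_minimal)
      then have "w ` span \<Gamma> \<subseteq> span \<Gamma>" by (simp add: linear_span_image[OF lin(1)])
      moreover have "dim (w ` span \<Gamma>) = dim (span \<Gamma>)"
        using dim_image_eq[OF lin(1), of "span \<Gamma>"] lin(2) inj_on_subset by blast
      ultimately have "w ` span \<Gamma> = span \<Gamma>"
        by (intro subspace_dim_equal linear_subspace_image lin subspace_span) auto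
      then obtain v where v: "v \<in> span \<Gamma>" "\<beta> = w v" using span_base[OF \<beta>] by blast
      have "cdot (cvec \<beta>) z = 0"
        using fixed_space_span[OF x v(1)] by (simp add: v(2) z cdot_complexify[OF orthogonal_W[OF w]])
      then show ?thesis by simp
    qed
  qed
  ultimately show thesis
    using that[OF qp] qp by (auto simp: parabolic_ideal_def intro: polys.mult polys_cdot)
qed

text \<open>The linear factor of the test polynomial is zero at \<open>u\<close>, so the derivative
  along \<eta> is (\<beta>, \<eta>) times a nonzero number. For the direction
  \<open>cvec \<beta>\<close>, the product (\<beta>, \<eta>) is 1 - k a times the squared length of
  \<beta>.\<close>

lemma eigenvalue_if_invariant:
  assumes inv: "\<And>\<xi> p. p \<in> parabolic_ideal W \<Gamma> \<Longrightarrow> dunkl P c \<xi> p \<in> parabolic_ideal W \<Gamma>"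
    and \<beta>: "\<beta> \<in> \<Gamma>" and a: "par.frame \<beta> = a *\<^sub>R \<beta>"
  shows "k * of_real a = 1"
proof -
  obtain u where u: "cvec u \<in> fixed_space" "\<And>\<alpha>. \<alpha> \<in> R \<Longrightarrow> u \<bullet> \<alpha> = 0 \<Longrightarrow> \<alpha> \<in> span \<Gamma>"
    using generic_point by blast
  obtain q where q: "q \<in> polys" "q (cvec u) \<noteq> 0"
    and p: "(\<lambda>x. cdot (cvec \<beta>) x * q x) \<in> parabolic_ideal W \<Gamma>" (is "?p \<in> _")
    using separating_polynomial[OF u(2) \<beta>] by blast
  define \<eta> where "\<eta> = cvec \<beta> - k *s cframe (cvec \<beta>)"
  have u0: "cdot (cvec \<beta>) (cvec u) = 0" using u(1) \<beta> by (simp add: fixed_space_def)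
  have uD: "cvec u \<in> parabolic_stratum W \<Gamma>"
    using fixed_spaceI[OF id_in_W u(1)] by (simp add: complexify_id)
  have "((\<lambda>s. s * cdot (cvec \<beta>) \<eta>) has_field_derivative cdot (cvec \<beta>) \<eta>) (at 0)"
    by (auto intro!: derivative_eq_intros)
  from DERIV_mult[OF this has_field_derivative_dir_deriv[OF q(1), of "cvec u" \<eta>]]
  have "((\<lambda>s. ?p (cvec u + s *s \<eta>)) has_field_derivative cdot (cvec \<beta>) \<eta> * q (cvec u)) (at 0)"
    by (simp add: cdot_add_right cdot_scale_right u0)
  then have "dir_deriv \<eta> ?p (cvec u) = cdot (cvec \<beta>) \<eta> * q (cvec u)"
    by (rule dir_deriv_eqI)
  moreover have "dunkl P c (cvec \<beta>) ?p (cvec u) = dir_deriv \<eta> ?p (cvec u)"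
    using dunkl_at_generic_point[OF p id_in_W u(1), of "cvec \<beta>"] u(2)
    by (simp add: complexify_id \<eta>_def cdot_cvec inner_commute)
  moreover have "dunkl P c (cvec \<beta>) ?p (cvec u) = 0"
    using inv[OF p] uD by (simp add: parabolic_ideal_def)
  ultimately have "cdot (cvec \<beta>) \<eta> = 0" using q(2) by simp
  moreover have "cdot (cvec \<beta>) \<eta> = (1 - k * of_real a) * of_real (\<beta> \<bullet> \<beta>)"
    by (simp add: \<eta>_def cdot_diff_right cdot_scale_right cdot_cframe a cdot_cvec_scale cdot_cvec
        algebra_simps)
  moreover have "\<beta> \<bullet> \<beta> \<noteq> 0" using par.simple_nonzero[OF \<beta>] by simp
  ultimately show ?thesis by simp
qed

lemma invariant_iff_coxeter_number:
  "cherednik_invariant W P c (parabolic_ideal W \<Gamma>) \<longleftrightarrow>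
    (\<exists>h::nat. \<forall>C\<in>coxeter_components \<Gamma>. coxeter_number C = h \<and> of_nat h = 1 / k)"
proof
  assume "cherednik_invariant W P c (parabolic_ideal W \<Gamma>)"
  then have inv: "\<And>\<xi> p. p \<in> parabolic_ideal W \<Gamma> \<Longrightarrow> dunkl P c \<xi> p \<in> parabolic_ideal W \<Gamma>"
    by (simp add: invariant_iff_dunkl)
  have C: "of_nat (coxeter_number C) = 1 / k" if C: "C \<in> coxeter_components \<Gamma>" for C
  proof -
    obtain \<beta> where \<beta>: "\<beta> \<in> C" "\<beta> \<in> \<Gamma>" using par.frame_component(1,2)[OF C] by blast
    from eigenvalue_if_invariant[OF inv \<beta>(2) par.frame_component(4)[OF C \<beta>(1)]]
    show ?thesis by (cases "k = 0") (simp_all add: field_simps)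
  qed
  show "\<exists>h::nat. \<forall>C\<in>coxeter_components \<Gamma>. coxeter_number C = h \<and> of_nat h = 1 / k"
  \<comment> \<open>For empty \<Gamma> there are no components, and any \<open>h\<close>
    serves.\<close>
  proof (cases "coxeter_components \<Gamma> = {}")
    case False
    then obtain C0 where C0: "C0 \<in> coxeter_components \<Gamma>" by blast
    have "coxeter_number C = coxeter_number C0" if "C \<in> coxeter_components \<Gamma>" for C
      using C[OF that] C[OF C0] by (metis of_nat_eq_iff)
    with C show ?thesis by metis
  qed simp
next
  assume "\<exists>h::nat. \<forall>C\<in>coxeter_components \<Gamma>. coxeter_number C = h \<and> of_nat h = 1 / k"
  then obtain h where h: "\<And>C. C \<in> coxeter_components \<Gamma> \<Longrightarrow> coxeter_number C = h \<and> of_nat h = 1 / k"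
    by blast
  have "\<exists>a. par.frame \<beta> = a *\<^sub>R \<beta> \<and> k * of_real a = 1" if \<beta>: "\<beta> \<in> \<Gamma>" for \<beta>
  proof -
    obtain C where C: "C \<in> coxeter_components \<Gamma>" "\<beta> \<in> C" using par.in_component[OF \<beta>] by blast
    \<comment> \<open>Since \<open>1 / 0\<close> is 0 here, the equation
      \<open>of_nat h = 1 / k\<close> alone would admit \<open>h = 0\<close> with
      \<open>k = 0\<close>; positivity of the Coxeter number excludes this.\<close>
    have "h > 0" using par.frame_component(3)[OF C(1)] h[OF C(1)] by simp
    with h[OF C(1)] have "k * of_nat h = 1" by (cases "k = 0") auto
    with par.frame_component(4)[OF C] h[OF C(1)] show ?thesis by (metis of_real_of_nat_eq)
  qed
  then show "cherednik_invariant W P c (parabolic_ideal W \<Gamma>)"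
    using invariant_if by (simp add: invariant_iff_dunkl)
qed

end

theorem theorem2:
  fixes W :: "(real^'n \<Rightarrow> real^'n) set"
    and R P \<Delta> \<Gamma>\<^sub>0 :: "(real^'n) set"
    and c :: "real^'n \<Rightarrow> complex"
    and k :: complex
  assumes "finite_reflection_group W"
    and "coxeter_root_system W R"
    and "positive_subsystem R P"
    and "simple_roots P \<Delta>"
    and "\<And>w \<alpha>. w \<in> W \<Longrightarrow> \<alpha> \<in> R \<Longrightarrow> c (w \<alpha>) = c \<alpha>"
    and "\<Gamma>\<^sub>0 \<subseteq> \<Delta>"
    and "\<And>\<beta>. \<beta> \<in> \<Gamma>\<^sub>0 \<Longrightarrow> c \<beta> = k"
  shows "cherednik_invariant W P c (parabolic_ideal W \<Gamma>\<^sub>0) \<longleftrightarrow>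
    (\<exists>h::nat. \<forall>C\<in>coxeter_components \<Gamma>\<^sub>0. coxeter_number C = h \<and> of_nat h = 1 / k)"
proof -
  obtain t where "\<forall>\<alpha>\<in>R. t \<bullet> \<alpha> \<noteq> 0" "P = {\<alpha> \<in> R. t \<bullet> \<alpha> > 0}"
    using assms(3) unfolding positive_subsystem_def by blast
  then interpret dunkl_setting W R P \<Delta> \<Gamma>\<^sub>0 c k t
    using assms by unfold_locales auto
  show ?thesis by (rule invariant_iff_coxeter_number)
qed

end
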